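(* Consider the dynamical system $(\partial\mathbb D,\mathcal B,\lambda,f,d)$, where $f$ is a one-component, centred inner function (centred: $f(0)=0$). Let $\{r_n\}_{n\in\mathbb N}$ be a sequence of positive real numbers, and let $$\mathcal R(f,\{r_n\}):=\{z\in\partial\mathbb D:f^n(z)\in B(z,r_n)\text{ for infinitely many }n\in\mathbb N\}.$$ Then $$\lambda(\mathcal R(f,\{r_n\}))=\begin{cases}0&\text{if }\sum_{n=1}^\infty r_n<\infty,\\1&\text{if }\sum_{n=1}^\infty r_n=\infty.\end{cases}$$
   Context: $\mathbb D$ is the open unit disk in $\mathbb C$, $\partial\mathbb D$ its boundary with Borel $\sigma$-algebra $\mathcal B$, $\lambda$ is normalised Lebesgue measure on $\partial\mathbb D$, and $d$ is normalised arc length, with respect to which balls are taken. An inner function is a holomorphic map $f:\mathbb D\to\mathbb D$ such that for $\lambda$-almost every $e^{i\theta}\in\partial\mathbb D$ the radial limit $\lim_{r\to1^-}f(re^{i\theta})$ exists and belongs to $\partial\mathbb D$; the resulting ($\lambda$-a.e. defined) boundary map is also denoted $f$, and $f^n$ is its $n$-th iterate. An inner function $f$ is one-component if there exists $0<r<1$ such that $\{z\in\mathbb D:|f(z)|<r\}$ is connected.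
   Formalization: The formal theorem additionally assumes that f is not a rotation z ↦ cz with |c| = 1; the claim as stated fails for rotations, e.g. for f(z) = z the recurrence set is the whole circle even when the sum of r_n converges. *)

theory Defs
  imports "HOL-Analysis.Analysis"
begin

abbreviation unit_disk :: "complex set" where
  "unit_disk \<equiv> ball 0 1"

abbreviation unit_circle :: "complex set" where
  "unit_circle \<equiv> sphere 0 1"

definition circle_measure :: "complex measure" where
  "circle_measure =
     distr (uniform_measure lborel {0..<2 * pi}) (restrict_space borel unit_circle) cis"

text \<open>For points of the unit circle, \<open>\<bar>Arg (w / z)\<bar>\<close> is the length of the shorter arc joining
  \<open>z\<close> to \<open>w\<close>. The normalisation gives the circle total length 1.\<close>

definition arc_dist :: "complex \<Rightarrow> complex \<Rightarrow> real" where
  "arc_dist z w = \<bar>Arg (w / z)\<bar> / (2 * pi)"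

definition arc_ball :: "complex \<Rightarrow> real \<Rightarrow> complex set" where
  "arc_ball z \<rho> = {w \<in> unit_circle. arc_dist z w < \<rho>}"

definition has_boundary_value :: "(complex \<Rightarrow> complex) \<Rightarrow> complex \<Rightarrow> bool" where
  "has_boundary_value f z \<longleftrightarrow>
     (\<exists>w \<in> unit_circle. ((\<lambda>r. f (complex_of_real r * z)) \<longlongrightarrow> w) (at_left 1))"

text \<open>Meaningful only at points satisfying \<^const>\<open>has_boundary_value\<close>; elsewhere the value is
  arbitrary.\<close>

definition boundary_map :: "(complex \<Rightarrow> complex) \<Rightarrow> complex \<Rightarrow> complex" where
  "boundary_map f z = Lim (at_left 1) (\<lambda>r. f (complex_of_real r * z))"

definition inner_function :: "(complex \<Rightarrow> complex) \<Rightarrow> bool" where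
  "inner_function f \<longleftrightarrow>
     f holomorphic_on unit_disk \<and> f ` unit_disk \<subseteq> unit_disk \<and>
     (AE z in circle_measure. has_boundary_value f z)"

definition one_component :: "(complex \<Rightarrow> complex) \<Rightarrow> bool" where
  "one_component f \<longleftrightarrow>
     inner_function f \<and> (\<exists>r. 0 < r \<and> r < 1 \<and> connected {z \<in> unit_disk. cmod (f z) < r})"

text \<open>The boundary map is only partially defined, so a return at time \<open>n\<close> requires that the
  first \<open>n\<close> iterates of the boundary map are defined at \<open>z\<close>.\<close>

definition recurrence_set :: "(complex \<Rightarrow> complex) \<Rightarrow> (nat \<Rightarrow> real) \<Rightarrow> complex set" where
  "recurrence_set f r =
     {z \<in> unit_circle. infinite {n. n \<ge> 1 \<and>
        (\<forall>k<n. has_boundary_value f ((boundary_map f ^^ k) z)) \<and>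
        (boundary_map f ^^ n) z \<in> arc_ball z (r n)}}"

end

theory Submission
  imports Defs "HOL-Complex_Analysis.Complex_Analysis" "HOL-Probability.Probability_Measure"
begin

text \<open>
  On the boundary put \<open>g\<^sub>n z = f\<^sup>n z / z\<close>. This is again the boundary function of an inner function, and
  its value at the origin is \<open>a\<^sup>n\<close> with \<open>a = f' 0\<close>, \<open>\<bar>a\<bar> < 1\<close>. A return at time \<open>n\<close> means that \<open>g\<^sub>n z\<close> is
  close to 1, and it is detected by the Poisson kernel \<open>P\<^sub>\<rho>\<close> with \<open>1 - \<rho>\<close> comparable to \<open>r n\<close>. The
  mean of \<open>P\<^sub>\<rho> \<circ> g\<^sub>n\<close> is \<open>P\<^sub>\<rho> (a\<^sup>n)\<close>, which is bounded above and below, so a return at time \<open>n\<close> has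
  probability at most a multiple of \<open>r n\<close>, and the convergent case is the Borel-Cantelli lemma.

  In the divergent case one may discard the times with \<open>r n < 1 / n\<^sup>2\<close>. Expanding the Poisson kernels
  in powers, the covariance of \<open>P\<^sub>\<rho> \<circ> g\<^sub>m\<close> and \<open>P\<^sub>\<tau> \<circ> g\<^sub>n\<close>, \<open>m < n\<close>, reduces to the correlations of
  \<open>g\<^sub>m\<^sup>J\<close> with \<open>g\<^sub>n\<^sup>k\<close>. For \<open>J \<le> k\<close> these are powers of \<open>a\<close> by the mean value property; for \<open>J > k\<close> they
  are controlled by low-order Taylor coefficients of the powers of \<open>f\<^sup>m\<close> and of \<open>f\<^sup>l x / x\<close>, \<open>l = n - m\<close>,
  which are exponentially small in the larger of \<open>m\<close> and \<open>l\<close> because the iterates of \<open>f\<close> contract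
  to 0 by the Schwarz-Pick lemma. Chebyshev's inequality then shows that the sums of the weighted
  kernels grow like the partial sums of \<open>r\<close>. Taking \<open>1 - \<rho> = \<epsilon> r n\<close>, all but a proportion of order \<open>\<epsilon>\<close> of this
  growth comes from actual returns, so almost every point returns infinitely often.
\<close>

section \<open>Integration over the circle\<close>

text \<open>The target of a return moves with the point, so mixing of \<open>f\<close> does not
  apply directly; dividing by \<open>z\<close> fixes the target at 1 and keeps analyticity, as
  \<open>cnj z = 1 / z\<close> on the circle. Products of analytic boundary functions have exactly
  computable means, so the real difficulty is a conjugate on the earlier return. There the bound on
  correlations grows quadratically with the frequency, and summing it against the Poisson weights
  costs negative powers of the radii; the discarded times are those where this loss could outweigh
  the exponential decay. The Poisson kernel also has a tail outside its arc, which is why it is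
  taken at the smaller scale \<open>\<epsilon> r n\<close>: outside the arc of radius
  \<open>r n\<close> it is then of order \<open>\<epsilon>\<close> relative to the kernel at scale
  \<open>r n\<close>. The other obstacle is boundary values of composites, since \<open>f\<close>
  does not map radial approach to radial approach. It is avoided by dilating the function applied
  last and passing to limits in mean, which only needs that the function applied before it preserves
  arc length.\<close>

abbreviation \<mu> :: "complex measure" where
  "\<mu> \<equiv> circle_measure"

abbreviation circle_mean :: "(complex \<Rightarrow> 'a::{banach, second_countable_topology}) \<Rightarrow> 'a" (binder "\<E>" 10) where
  "circle_mean h \<equiv> integral\<^sup>L \<mu> h"

lemmas mean_cong = Bochner_Integration.integral_cong

lemma measurable_cis_circle [measurable]: "cis \<in> borel \<rightarrow>\<^sub>M restrict_space borel unit_circle"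
proof (rule measurable_restrict_space2)
  show "cis \<in> borel_measurable borel"
    by (intro borel_measurable_continuous_onI continuous_intros)
qed simp

lemma space_circle [simp]: "space \<mu> = unit_circle"
  by (simp add: circle_measure_def space_restrict_space)

lemma sets_circle [measurable_cong]: "sets \<mu> = sets (restrict_space borel unit_circle)"
  by (simp add: circle_measure_def)

lemma prob_space_circle: "prob_space \<mu>"
  unfolding circle_measure_def
proof (rule prob_space.prob_space_distr)
  show "prob_space (uniform_measure lborel {0..<2 * pi})"
    by (rule prob_space_uniform_measure) auto
  show "cis \<in> uniform_measure lborel {0..<2 * pi} \<rightarrow>\<^sub>M restrict_space borel unit_circle"
    using measurable_cis_circle by (simp cong: measurable_cong_sets)
qed

interpretation circle: prob_space \<mu>
  by (rule prob_space_circle)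

lemma borel_measurable_circleI:
  "v \<in> borel \<rightarrow>\<^sub>M N \<Longrightarrow> v \<in> \<mu> \<rightarrow>\<^sub>M N"
  unfolding circle_measure_def by (simp add: measurable_restrict_space1)

lemma borel_measurable_circle_ident [measurable]: "(\<lambda>z. z) \<in> borel_measurable \<mu>"
  by (rule borel_measurable_circleI) simp

lemma circle_cnj: "cmod z = 1 \<Longrightarrow> z * cnj z = 1" "cmod z = 1 \<Longrightarrow> cnj z * z = 1"
  by (metis complex_norm_square mult.commute of_real_1 one_power2)+

text \<open>Since \<open>cnj z = 1 / z\<close> and \<open>dz = i z dt\<close> on the circle, this is
  the Cauchy integral of \<open>v\<close>. It extends a boundary function to the disc without
  mentioning radial limits; at the origin it is the mean.\<close>

definition cauchy_ext :: "(complex \<Rightarrow> complex) \<Rightarrow> complex \<Rightarrow> complex" where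
  "cauchy_ext v x = (\<E> z. v z / (1 - x * cnj z))"

lemma analytic_on_cball_ball:
  assumes "q analytic_on cball 0 (1::real)"
  obtains R where "R > 1" "q holomorphic_on ball (0::complex) R"
proof -
  obtain S where S: "open S" "cball 0 1 \<subseteq> S" "q holomorphic_on S"
    using assms unfolding analytic_on_holomorphic by blast
  show ?thesis
  proof (cases "S = UNIV")
    case True
    then show ?thesis using S that[of 2] holomorphic_on_subset by fastforce
  next
    case False
    obtain e where e: "e > 0" "(\<Union>x\<in>cball (0::complex) 1. ball x e) \<subseteq> S"
      by (rule compact_subset_open_imp_ball_epsilon_subset[OF compact_cball S(1,2)])
    have "ball 0 (1+e) \<subseteq> S"
    proof
      fix z :: complex assume z: "z \<in> ball 0 (1+e)"
      show "z \<in> S"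
      proof (cases "cmod z \<le> 1")
        case True then show ?thesis using S(2) by auto
      next
        case False
        then have "z \<noteq> 0" by auto
        then have "z - sgn z = (cmod z - 1) *\<^sub>R sgn z"
          by (simp add: sgn_eq scaleR_conv_of_real field_simps)
        then have "cmod (z - sgn z) = cmod z - 1"
          using False by (auto simp: norm_sgn)
        then have "z \<in> ball (sgn z) e" using z by (simp add: dist_norm norm_minus_commute)
        moreover have "sgn z \<in> cball 0 1" by (simp add: norm_sgn)
        ultimately show ?thesis using e(2) by blast
      qed
    qed
    then show ?thesis using that[of "1+e"] e(1) S(3) holomorphic_on_subset by auto
  qed
qed

lemma one_minus_cnj_nonzero:
  assumes "cmod x < 1" "cmod z \<le> 1"
  shows "1 - x * cnj z \<noteq> 0" "1 - cmod x \<le> cmod (1 - x * cnj z)"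
proof -
  have "cmod (x * cnj z) \<le> cmod x"
    using assms by (simp add: norm_mult mult_left_le)
  then show "1 - cmod x \<le> cmod (1 - x * cnj z)"
    by (smt (verit) norm_one norm_triangle_ineq2)
  then show "1 - x * cnj z \<noteq> 0" using assms by auto
qed

lemma continuous_on_analytic_sphere:
  "q analytic_on cball 0 1 \<Longrightarrow> continuous_on unit_circle q"
  by (meson analytic_imp_holomorphic continuous_on_subset holomorphic_on_imp_continuous_on sphere_cball)

lemma borel_measurable_circle_continuous:
  fixes h :: "complex \<Rightarrow> 'b::{topological_space}"
  assumes "continuous_on unit_circle h"
  shows "h \<in> borel_measurable \<mu>"
  using borel_measurable_continuous_on_restrict[OF assms]
  by (simp add: measurable_cong_sets[OF sets_circle refl])

lemma integral_circle_continuous: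
  fixes h :: "complex \<Rightarrow> complex"
  assumes cont: "continuous_on unit_circle h"
  shows "(\<E> z. h z) = integral {0..2*pi} (\<lambda>t. h (cis t)) / (2*pi)"
proof -
  have m1: "cis \<in> uniform_measure lborel {0..<2 * pi} \<rightarrow>\<^sub>M restrict_space borel unit_circle"
    using measurable_cis_circle by (simp cong: measurable_cong_sets)
  have m2: "h \<in> borel_measurable (restrict_space borel unit_circle)"
    by (rule borel_measurable_continuous_on_restrict[OF cont])
  have [measurable]: "(\<lambda>t. h (cis t)) \<in> borel_measurable borel"
    by (rule measurable_compose[OF measurable_cis_circle m2])
  have u: "uniform_measure lborel {0..<2*pi} =
      density lborel (\<lambda>x. ennreal (indicator {0..<2*pi} x / (2*pi)))"
    unfolding uniform_measure_def
    by (rule density_cong) (auto simp: indicator_def divide_ennreal[symmetric] ennreal_1[symmetric] simp del: ennreal_1)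
  have "(\<E> z. h z) = (\<integral>t. h (cis t) \<partial>uniform_measure lborel {0..<2*pi})"
    unfolding circle_measure_def by (rule integral_distr[OF m1 m2])
  also have "\<dots> = (\<integral>t. (indicator {0..<2*pi} t / (2*pi)) *\<^sub>R h (cis t) \<partial>lborel)"
    unfolding u by (rule integral_density) auto
  also have "\<dots> = (\<integral>t. (indicator {0..2*pi} t *\<^sub>R h (cis t)) / (2*pi) \<partial>lborel)"
  proof (rule integral_cong_AE)
    have "AE t in lborel. t \<noteq> 2*pi" by (rule AE_lborel_singleton)
    then show "AE t in lborel. (indicator {0..<2*pi} t / (2*pi)) *\<^sub>R h (cis t)
        = (indicator {0..2*pi} t *\<^sub>R h (cis t)) / (2*pi)"
      by eventually_elim (auto simp: indicator_def scaleR_conv_of_real)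
  qed measurable
  also have "\<dots> = (LINT t:{0..2*pi}|lborel. h (cis t)) / (2*pi)"
    by (simp add: set_lebesgue_integral_def)
  also have "(LINT t:{0..2*pi}|lborel. h (cis t)) = integral {0..2*pi} (\<lambda>t. h (cis t))"
    by (intro set_borel_integral_eq_integral borel_integrable_atLeastAtMost' continuous_intros
        continuous_on_compose2[OF cont]) auto
  finally show ?thesis .
qed

lemma cauchy_ext_analytic:
  assumes q: "q analytic_on cball 0 1" and x: "cmod x < 1"
  shows "cauchy_ext q x = q x"
proof -
  have cq: "continuous_on unit_circle q" by (rule continuous_on_analytic_sphere[OF q])
  have "((\<lambda>u. q u / (u - x)) has_contour_integral 2 * of_real pi * \<i> * q x) (circlepath 0 1)"
    using analytic_imp_holomorphic[OF q] x by (intro Cauchy_integral_circlepath_simple) auto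
  then have "((\<lambda>t. q (0 + of_real 1 * cis t) / (0 + of_real 1 * cis t - x) * of_real 1 * \<i> * cis t) has_integral 2 * of_real pi * \<i> * q x) {0..2*pi}"
    unfolding circlepath_def by (subst (asm) has_contour_integral_part_circlepath_iff) auto
  then have "((\<lambda>t. (1/\<i>) * (q (cis t) / (cis t - x) * \<i> * cis t)) has_integral (1/\<i>) * (2 * of_real pi * \<i> * q x)) {0..2*pi}"
    by (intro has_integral_mult_right) simp
  moreover have "(1/\<i>) * (q (cis t) / (cis t - x) * \<i> * cis t) = q (cis t) / (1 - x * cnj (cis t))" for t
  proof -
    have "cis t - x \<noteq> 0" using x by (metis eq_iff_diff_eq_0 norm_cis less_irrefl)
    moreover have "1 - x * cnj (cis t) \<noteq> 0" by (rule one_minus_cnj_nonzero[OF x]) simp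
    moreover have "cis t * (1 - x * cnj (cis t)) = cis t - x"
      using circle_cnj[of "cis t"] by (simp add: algebra_simps)
    ultimately have "q (cis t) / (cis t - x) * cis t = q (cis t) / (1 - x * cnj (cis t))"
      by (metis cis_neq_zero mult.commute nonzero_mult_divide_mult_cancel_left times_divide_eq_left)
    moreover have "(1/\<i>) * (Q * \<i> * c) = Q * c" for Q c :: complex
      by (simp add: field_simps)
    ultimately show ?thesis by metis
  qed
  moreover have "(1/\<i>) * (2 * of_real pi * \<i> * q x) = 2 * pi * q x"
    by (simp add: field_simps)
  ultimately have "((\<lambda>t. q (cis t) / (1 - x * cnj (cis t))) has_integral 2 * pi * q x) {0..2*pi}"
    by (simp only:)
  then have "integral {0..2*pi} (\<lambda>t. q (cis t) / (1 - x * cnj (cis t))) = 2 * pi * q x"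
    by (rule integral_unique)
  moreover have "continuous_on unit_circle (\<lambda>z. q z / (1 - x * cnj z))"
    using one_minus_cnj_nonzero[OF x] by (intro continuous_intros cq) auto
  ultimately show ?thesis
    unfolding cauchy_ext_def by (subst integral_circle_continuous) auto
qed

section \<open>Boundary values of bounded analytic functions\<close>

lemma borel_measurable_cnj [measurable]: "cnj \<in> borel_measurable borel"
  by (intro borel_measurable_continuous_onI continuous_intros)

lemma integrable_circle:
  fixes v :: "complex \<Rightarrow> 'b::{banach, second_countable_topology}"
  assumes "v \<in> borel_measurable \<mu>" "\<And>z. cmod z = 1 \<Longrightarrow> norm (v z) \<le> C"
  shows "integrable \<mu> v"
  using assms by (intro circle.integrable_const_bound[where B = C] AE_I2) auto

lemma integrable_circle_diff:
  fixes v w :: "complex \<Rightarrow> complex"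
  assumes [measurable]: "v \<in> borel_measurable \<mu>" "w \<in> borel_measurable \<mu>"
    and "\<And>z. cmod z = 1 \<Longrightarrow> cmod (v z) \<le> C" "\<And>z. cmod z = 1 \<Longrightarrow> cmod (w z) \<le> D"
  shows "integrable \<mu> (\<lambda>z. cmod (v z - w z))"
proof (rule integrable_circle)
  fix z :: complex assume "cmod z = 1"
  then show "norm (cmod (v z - w z)) \<le> C + D"
    using norm_triangle_ineq4[of "v z" "w z"] assms(3,4)[of z] by simp
qed measurable

text \<open>The boundary functions of bounded analytic functions, described as limits in mean of functions
  analytic on a neighbourhood of the closed disc, uniformly bounded there. In this form they are
  closed under products and compositions without any theorem on nontangential limits.\<close>

definition Hinfty :: "real \<Rightarrow> (complex \<Rightarrow> complex) \<Rightarrow> bool" where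
  "Hinfty C v \<longleftrightarrow>
     v \<in> borel_measurable \<mu> \<and> (\<forall>z. cmod z = 1 \<longrightarrow> cmod (v z) \<le> C) \<and>
     (\<forall>\<epsilon>>0. \<exists>q. q analytic_on cball 0 1 \<and> (\<forall>x\<in>cball 0 1. cmod (q x) \<le> C) \<and>
        (\<E> z. cmod (v z - q z)) < \<epsilon>)"

lemma Hinfty_measurable [measurable_dest]:
  "Hinfty C v \<Longrightarrow> v \<in> borel_measurable \<mu>"
  and Hinfty_bound: "Hinfty C v \<Longrightarrow> cmod z = 1 \<Longrightarrow> cmod (v z) \<le> C"
  by (auto simp: Hinfty_def)

lemma Hinfty_nonneg: "Hinfty C v \<Longrightarrow> C \<ge> 0"
  using Hinfty_bound[of C v 1] by (smt (verit) norm_ge_zero norm_one)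

lemma measurable_analytic_circle:
  "q analytic_on cball 0 1 \<Longrightarrow> q \<in> borel_measurable \<mu>"
  by (intro borel_measurable_circle_continuous continuous_on_analytic_sphere)

lemma Hinfty_seqD:
  assumes "Hinfty C v"
  obtains q where "\<And>n. q n analytic_on cball 0 1" "\<And>n x. cmod x \<le> 1 \<Longrightarrow> cmod (q n x) \<le> C"
    "(\<lambda>n. \<E> z. cmod (v z - q n z)) \<longlonglongrightarrow> 0"
proof -
  have "\<forall>n. \<exists>q. q analytic_on cball 0 1 \<and> (\<forall>x\<in>cball 0 1. cmod (q x) \<le> C) \<and>
        (\<E> z. cmod (v z - q z)) < 1 / real (Suc n)"
    using assms by (simp add: Hinfty_def)
  then obtain q where q: "\<And>n. q n analytic_on cball 0 1" "\<And>n x. x \<in> cball 0 1 \<Longrightarrow> cmod (q n x) \<le> C"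
    "\<And>n. (\<E> z. cmod (v z - q n z)) < 1 / real (Suc n)"
    by metis
  have "(\<lambda>n. \<E> z. cmod (v z - q n z)) \<longlonglongrightarrow> 0"
  proof (rule tendsto_sandwich[where f = "\<lambda>_. 0" and h = "\<lambda>n. 1 / real (Suc n)"])
    show "(\<lambda>n. 1 / real (Suc n)) \<longlonglongrightarrow> 0"
      using LIMSEQ_inverse_real_of_nat by (simp add: inverse_eq_divide)
  qed (use q(3) in \<open>auto intro!: always_eventually less_imp_le\<close>)
  with q(1,2) show ?thesis by (intro that) auto
qed

lemma Hinfty_seqI:
  assumes "v \<in> borel_measurable \<mu>" "\<And>z. cmod z = 1 \<Longrightarrow> cmod (v z) \<le> C"
    and "\<And>n. q n analytic_on cball 0 1" "\<And>n x. cmod x \<le> 1 \<Longrightarrow> cmod (q n x) \<le> C"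
    "(\<lambda>n. \<E> z. cmod (v z - q n z)) \<longlonglongrightarrow> 0"
  shows "Hinfty C v"
  unfolding Hinfty_def
proof (intro conjI allI impI)
  fix \<epsilon> :: real assume "\<epsilon> > 0"
  then have "\<forall>\<^sub>F n in sequentially. (\<E> z. cmod (v z - q n z)) < \<epsilon>"
    using assms(5) by (simp add: order_tendsto_iff)
  then obtain n where "(\<E> z. cmod (v z - q n z)) < \<epsilon>"
    by (auto simp: eventually_sequentially)
  then show "\<exists>q. q analytic_on cball 0 1 \<and> (\<forall>x\<in>cball 0 1. cmod (q x) \<le> C) \<and>
        (\<E> z. cmod (v z - q z)) < \<epsilon>"
    using assms(3,4) by (intro exI[of _ "q n"]) auto
qed (use assms in auto)

lemma Hinfty_analytic:
  assumes "q analytic_on cball 0 1" "\<And>x. cmod x \<le> 1 \<Longrightarrow> cmod (q x) \<le> C"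
  shows "Hinfty C q"
  by (rule Hinfty_seqI[where q = "\<lambda>_. q"])
    (use assms in \<open>auto simp: measurable_analytic_circle\<close>)

text \<open>The Cauchy kernel is at most \<open>1 / (1 - cmod x)\<close> on the circle. Hence
  convergence in mean on the boundary forces pointwise convergence of the extensions inside, on
  which the closure properties below rest.\<close>

lemma cauchy_ext_diff:
  assumes [measurable]: "v \<in> borel_measurable \<mu>" "w \<in> borel_measurable \<mu>"
    and v: "\<And>z. cmod z = 1 \<Longrightarrow> cmod (v z) \<le> C" and w: "\<And>z. cmod z = 1 \<Longrightarrow> cmod (w z) \<le> D"
    and x: "cmod x < 1"
  shows "cmod (cauchy_ext v x - cauchy_ext w x)
    \<le> (\<E> z. cmod (v z - w z)) / (1 - cmod x)"
proof -
  have ker: "cmod (a / (1 - x * cnj z)) \<le> cmod a / (1 - cmod x)" if "cmod z = 1" for a z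
    unfolding norm_divide
    using one_minus_cnj_nonzero[OF x, of z] x that by (intro divide_left_mono) (auto intro!: mult_pos_pos)
  have int: "integrable \<mu> (\<lambda>z. h z / (1 - x * cnj z))"
    if [measurable]: "h \<in> borel_measurable \<mu>" and h: "\<And>z. cmod z = 1 \<Longrightarrow> cmod (h z) \<le> E"
    for h E
  proof (rule integrable_circle)
    show "cmod (h z / (1 - x * cnj z)) \<le> E / (1 - cmod x)" if "cmod z = 1" for z
      using ker[OF that, of "h z"] h[OF that] x by (smt (verit) divide_right_mono)
  qed measurable
  have int_d: "integrable \<mu> (\<lambda>z. cmod (v z - w z) / (1 - cmod x))"
  proof (rule integrable_circle)
    show "norm (cmod (v z - w z) / (1 - cmod x)) \<le> (C + D) / (1 - cmod x)" if "cmod z = 1" for z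
      using v[OF that] w[OF that] x norm_triangle_ineq4[of "v z" "w z"] by (simp add: divide_right_mono)
  qed measurable
  have "cauchy_ext v x - cauchy_ext w x = (\<E> z. (v z - w z) / (1 - x * cnj z))"
    unfolding cauchy_ext_def
    by (subst Bochner_Integration.integral_diff[symmetric])
       (auto intro!: int v w simp: diff_divide_distrib)
  also have "cmod \<dots> \<le> (\<E> z. cmod (v z - w z) / (1 - cmod x))"
    by (rule Bochner_Integration.integral_norm_bound_integral)
       (use ker int_d int[of "\<lambda>z. v z - w z" "C + D"] v w in
         \<open>auto intro!: order_trans[OF norm_triangle_ineq4] add_mono\<close>)
  finally show ?thesis by simp
qed

lemma cauchy_ext_tendsto:
  assumes "\<And>n. v n \<in> borel_measurable \<mu>" "w \<in> borel_measurable \<mu>"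
    and "\<And>n z. cmod z = 1 \<Longrightarrow> cmod (v n z) \<le> C" and "\<And>z. cmod z = 1 \<Longrightarrow> cmod (w z) \<le> C"
    and "(\<lambda>n. \<E> z. cmod (w z - v n z)) \<longlonglongrightarrow> 0"
    and "cmod x < 1"
  shows "(\<lambda>n. cauchy_ext (v n) x) \<longlonglongrightarrow> cauchy_ext w x"
proof -
  have "(\<lambda>n. (\<E> z. cmod (w z - v n z)) / (1 - cmod x)) \<longlonglongrightarrow> 0"
    using assms(5,6) by (auto intro!: tendsto_eq_intros)
  then have "(\<lambda>n. cauchy_ext (v n) x - cauchy_ext w x) \<longlonglongrightarrow> 0"
    by (rule tendsto_0_le[where K = 1])
       (use cauchy_ext_diff[of w "v _" C C x] assms in
         \<open>auto simp: norm_minus_commute intro!: always_eventually order_trans[OF _ abs_ge_self]\<close>)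
  then show ?thesis by (simp add: LIM_zero_iff)
qed

lemma Hinfty_cauchy_seq:
  assumes "Hinfty C v"
  obtains q where "\<And>n. q n analytic_on cball 0 1" "\<And>n x. cmod x \<le> 1 \<Longrightarrow> cmod (q n x) \<le> C"
    "(\<lambda>n. \<E> z. cmod (v z - q n z)) \<longlonglongrightarrow> 0"
    "\<And>x. cmod x < 1 \<Longrightarrow> (\<lambda>n. q n x) \<longlonglongrightarrow> cauchy_ext v x"
proof -
  obtain q where q: "\<And>n. q n analytic_on cball 0 1" "\<And>n x. cmod x \<le> 1 \<Longrightarrow> cmod (q n x) \<le> C"
    "(\<lambda>n. \<E> z. cmod (v z - q n z)) \<longlonglongrightarrow> 0"
    by (rule Hinfty_seqD[OF assms]) (rule that)
  have "(\<lambda>n. q n x) \<longlonglongrightarrow> cauchy_ext v x" if "cmod x < 1" for x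
    using cauchy_ext_tendsto[of q v C x] q that assms
    by (auto simp: measurable_analytic_circle Hinfty_measurable Hinfty_bound cauchy_ext_analytic)
  with q show ?thesis by (intro that) auto
qed

lemma cauchy_ext_bound:
  assumes "Hinfty C v" "cmod x < 1"
  shows "cmod (cauchy_ext v x) \<le> C"
proof -
  obtain q where q: "\<And>n x. cmod x \<le> 1 \<Longrightarrow> cmod (q n x) \<le> C"
    "(\<lambda>n::nat. q n x) \<longlonglongrightarrow> cauchy_ext v x"
    using Hinfty_cauchy_seq[OF assms(1)] assms(2) by metis
  show ?thesis
    by (rule LIMSEQ_le_const2[OF tendsto_norm[OF q(2)]]) (use q(1) assms(2) in \<open>auto\<close>)
qed

text \<open>Approximants are multiplied; their uniform bounds control the error in mean of the
  product. Multiplicativity of the extension is clear for functions analytic across the circle and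
  survives the limit. At the origin it says that the mean of a product is the product of the means,
  the source of the exact correlations later on.\<close>

lemma Hinfty_mult:
  assumes v: "Hinfty C v" and w: "Hinfty D w"
  shows "Hinfty (C * D) (\<lambda>z. v z * w z)" (is ?th1)
    and "cmod x < 1 \<Longrightarrow> cauchy_ext (\<lambda>z. v z * w z) x = cauchy_ext v x * cauchy_ext w x"
      (is "_ \<Longrightarrow> ?th2")
proof -
  note [measurable] = Hinfty_measurable[OF v] Hinfty_measurable[OF w]
  note C0 = Hinfty_nonneg[OF v] Hinfty_nonneg[OF w]
  obtain q where q: "\<And>n. q n analytic_on cball 0 1" "\<And>n x. cmod x \<le> 1 \<Longrightarrow> cmod (q n x) \<le> C"
    "(\<lambda>n. \<E> z. cmod (v z - q n z)) \<longlonglongrightarrow> 0"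
    "\<And>x. cmod x < 1 \<Longrightarrow> (\<lambda>n. q n x) \<longlonglongrightarrow> cauchy_ext v x"
    by (rule Hinfty_cauchy_seq[OF v]) (rule that)
  obtain p where p: "\<And>n. p n analytic_on cball 0 1" "\<And>n x. cmod x \<le> 1 \<Longrightarrow> cmod (p n x) \<le> D"
    "(\<lambda>n. \<E> z. cmod (w z - p n z)) \<longlonglongrightarrow> 0"
    "\<And>x. cmod x < 1 \<Longrightarrow> (\<lambda>n. p n x) \<longlonglongrightarrow> cauchy_ext w x"
    by (rule Hinfty_cauchy_seq[OF w]) (rule that)
  note [measurable] = measurable_analytic_circle[OF q(1)] measurable_analytic_circle[OF p(1)]
  have vb: "cmod (v z * w z) \<le> C * D" if "cmod z = 1" for z
    unfolding norm_mult using Hinfty_bound[OF v that] Hinfty_bound[OF w that]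
    by (intro mult_mono C0) auto
  have qb: "cmod (q n z * p n z) \<le> C * D" if "cmod z \<le> 1" for z n
    unfolding norm_mult using q(2)[OF that] p(2)[OF that] by (intro mult_mono C0) auto
  have iv: "integrable \<mu> (\<lambda>z. cmod (v z - q n z))" for n
    by (rule integrable_circle_diff[where C = C and D = C]) (use Hinfty_bound[OF v] q(2) in auto)
  have iw: "integrable \<mu> (\<lambda>z. cmod (w z - p n z))" for n
    by (rule integrable_circle_diff[where C = D and D = D]) (use Hinfty_bound[OF w] p(2) in auto)
  have ivw: "integrable \<mu> (\<lambda>z. cmod (v z * w z - q n z * p n z))" for n
    by (rule integrable_circle_diff[where C = "C * D" and D = "C * D"]) (use vb qb in auto)
  have L1: "(\<E> z. cmod (v z * w z - q n z * p n z))
      \<le> D * (\<E> z. cmod (v z - q n z)) + C * (\<E> z. cmod (w z - p n z))" for n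
  proof -
    have "(\<E> z. cmod (v z * w z - q n z * p n z))
      \<le> (\<E> z. D * cmod (v z - q n z) + C * cmod (w z - p n z))"
    proof (rule integral_mono[OF ivw])
      fix z assume "z \<in> space \<mu>"
      then have z: "cmod z = 1" by simp
      have "v z * w z - q n z * p n z = w z * (v z - q n z) + q n z * (w z - p n z)"
        by (simp add: algebra_simps)
      also have "cmod \<dots> \<le> cmod (w z) * cmod (v z - q n z) + cmod (q n z) * cmod (w z - p n z)"
        by (metis norm_mult norm_triangle_ineq)
      also have "\<dots> \<le> D * cmod (v z - q n z) + C * cmod (w z - p n z)"
        using Hinfty_bound[OF w z] q(2)[of z n] z by (intro add_mono mult_right_mono) auto
      finally show "cmod (v z * w z - q n z * p n z) \<le> D * cmod (v z - q n z) + C * cmod (w z - p n z)" .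
    qed (use iv iw in auto)
    then show ?thesis using iv iw by simp
  qed
  have lim: "(\<lambda>n. \<E> z. cmod (v z * w z - q n z * p n z)) \<longlonglongrightarrow> 0"
  proof (rule tendsto_sandwich[OF _ _ tendsto_const])
    show "(\<lambda>n. D * (\<E> z. cmod (v z - q n z)) + C * (\<E> z. cmod (w z - p n z))) \<longlonglongrightarrow> 0"
      by (auto intro!: tendsto_eq_intros q(3) p(3))
  qed (use L1 in \<open>auto intro!: always_eventually\<close>)
  show ?th1
    by (rule Hinfty_seqI[where q = "\<lambda>n z. q n z * p n z"])
       (use vb qb lim in \<open>auto intro!: analytic_intros q(1) p(1)\<close>)
  show ?th2 if x: "cmod x < 1"
  proof -
    have "(\<lambda>n. cauchy_ext (\<lambda>z. q n z * p n z) x) \<longlonglongrightarrow> cauchy_ext (\<lambda>z. v z * w z) x"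
      by (rule cauchy_ext_tendsto[where C = "C * D"]) (use vb qb lim x in auto)
    moreover have "cauchy_ext (\<lambda>z. q n z * p n z) x = q n x * p n x" for n
      by (intro cauchy_ext_analytic analytic_intros q(1) p(1) x)
    ultimately have "(\<lambda>n. q n x * p n x) \<longlonglongrightarrow> cauchy_ext (\<lambda>z. v z * w z) x" by simp
    moreover have "(\<lambda>n. q n x * p n x) \<longlonglongrightarrow> cauchy_ext v x * cauchy_ext w x"
      by (intro tendsto_mult q(4) p(4) x)
    ultimately show ?thesis by (rule LIMSEQ_unique)
  qed
qed

lemma Hinfty_one: "Hinfty 1 (\<lambda>_. 1)"
  and Hinfty_id: "Hinfty 1 (\<lambda>z. z)"
  by (intro Hinfty_analytic; auto intro: analytic_intros)+

lemma Hinfty_power: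
  assumes v: "Hinfty 1 v"
  shows "Hinfty 1 (\<lambda>z. v z ^ n)"
    and "cmod x < 1 \<Longrightarrow> cauchy_ext (\<lambda>z. v z ^ n) x = cauchy_ext v x ^ n"
proof -
  have "Hinfty 1 (\<lambda>z. v z ^ n) \<and>
      (cmod x < 1 \<longrightarrow> cauchy_ext (\<lambda>z. v z ^ n) x = cauchy_ext v x ^ n)"
  proof (induction n)
    case 0
    then show ?case
      using Hinfty_one cauchy_ext_analytic[of "\<lambda>_. 1" x] by (auto intro: analytic_intros)
  next
    case (Suc n)
    then show ?case using Hinfty_mult[OF v, of 1 "\<lambda>z. v z ^ n"] by auto
  qed
  then show "Hinfty 1 (\<lambda>z. v z ^ n)"
    and "cmod x < 1 \<Longrightarrow> cauchy_ext (\<lambda>z. v z ^ n) x = cauchy_ext v x ^ n" by auto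
qed

lemma cauchy_ext_0: "cauchy_ext v 0 = (\<E> z. v z)"
  by (simp add: cauchy_ext_def)

lemma Hinfty_limit:
  assumes v: "\<And>n. Hinfty C (v n)" and [measurable]: "w \<in> borel_measurable \<mu>"
    and w: "\<And>z. cmod z = 1 \<Longrightarrow> cmod (w z) \<le> C"
    and lim: "AE z in \<mu>. (\<lambda>n. v n z) \<longlonglongrightarrow> w z"
  shows "Hinfty C w" (is ?th1)
    and "cmod x < 1 \<Longrightarrow> (\<lambda>n. cauchy_ext (v n) x) \<longlonglongrightarrow> cauchy_ext w x" (is "_ \<Longrightarrow> ?th2")
proof -
  note [measurable] = Hinfty_measurable[OF v]
  have "(\<lambda>n. \<E> z. cmod (w z - v n z)) \<longlonglongrightarrow> (\<E> z. 0)"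
  proof (rule integral_dominated_convergence[where w = "\<lambda>_. C + C"])
    show "AE z in \<mu>. (\<lambda>n. cmod (w z - v n z)) \<longlonglongrightarrow> 0"
      using lim by eventually_elim (auto intro!: tendsto_eq_intros)
    show "AE z in \<mu>. norm (cmod (w z - v n z)) \<le> C + C" for n
    proof (rule AE_I2)
      fix z assume "z \<in> space \<mu>"
      then show "norm (cmod (w z - v n z)) \<le> C + C"
        using norm_triangle_le_diff[of "w z" "v n z" "C + C"] w[of z] Hinfty_bound[OF v, of z n]
        by simp
    qed
  qed auto
  then have L: "(\<lambda>n. \<E> z. cmod (w z - v n z)) \<longlonglongrightarrow> 0" by simp
  show ?th2 if "cmod x < 1"
    by (rule cauchy_ext_tendsto[where C = C]) (use L that w Hinfty_bound[OF v] in auto)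
  show ?th1
    unfolding Hinfty_def
  proof (intro conjI allI impI)
    fix \<epsilon> :: real assume "\<epsilon> > 0"
    then have "\<forall>\<^sub>F n in sequentially. (\<E> z. cmod (w z - v n z)) < \<epsilon>/2"
      by (intro order_tendstoD(2)[OF L]) simp
    then obtain n where n: "(\<E> z. cmod (w z - v n z)) < \<epsilon>/2"
      by (auto simp: eventually_sequentially)
    obtain q where q: "q analytic_on cball 0 1" "\<forall>x\<in>cball 0 1. cmod (q x) \<le> C"
        "(\<E> z. cmod (v n z - q z)) < \<epsilon>/2"
      using v[of n] \<open>\<epsilon> > 0\<close> unfolding Hinfty_def by (meson half_gt_zero)
    note [measurable] = measurable_analytic_circle[OF q(1)]
    have i: "integrable \<mu> (\<lambda>z. cmod (w z - v n z))"
        "integrable \<mu> (\<lambda>z. cmod (v n z - q z))"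
        "integrable \<mu> (\<lambda>z. cmod (w z - q z))"
      by (rule integrable_circle_diff[where C = C and D = C];
          use w Hinfty_bound[OF v] q(2) in \<open>auto\<close>)+
    have "(\<E> z. cmod (w z - q z))
       \<le> (\<E> z. cmod (w z - v n z) + cmod (v n z - q z))"
    proof (rule integral_mono)
      show "cmod (w z - q z) \<le> cmod (w z - v n z) + cmod (v n z - q z)" for z
        using dist_triangle[of "w z" "q z" "v n z"] by (simp add: dist_norm)
    qed (use i in auto)
    also have "\<dots> < \<epsilon>" using i n q(3) by simp
    finally show "\<exists>q. q analytic_on cball 0 1 \<and> (\<forall>x\<in>cball 0 1. cmod (q x) \<le> C) \<and>
        (\<E> z. cmod (w z - q z)) < \<epsilon>"
      using q by blast
  qed (use w in auto)
qed

lemma analytic_lipschitz_cball: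
  assumes "p analytic_on cball 0 (1::real)"
  obtains L where "L \<ge> 0" "\<And>x y. cmod x \<le> 1 \<Longrightarrow> cmod y \<le> 1 \<Longrightarrow> cmod (p x - p y) \<le> L * cmod (x - y)"
proof -
  obtain R where R: "R > 1" "p holomorphic_on ball (0::complex) R"
    by (rule analytic_on_cball_ball[OF assms]) (rule that)
  have sub: "cball (0::complex) 1 \<subseteq> ball 0 R" using R(1) by auto
  have "continuous_on (cball 0 1) (deriv p)"
    using R(2) sub by (meson holomorphic_deriv holomorphic_on_imp_continuous_on holomorphic_on_subset open_ball)
  then have "bounded (deriv p ` cball 0 1)"
    by (intro compact_imp_bounded compact_continuous_image) auto
  then obtain L where L: "L > 0" "\<And>x. cmod x \<le> 1 \<Longrightarrow> cmod (deriv p x) \<le> L"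
    unfolding bounded_pos by auto
  have d: "(p has_field_derivative deriv p x) (at x within cball 0 1)" if "x \<in> cball 0 1" for x
    using holomorphic_derivI[OF R(2) open_ball] sub that by auto
  show ?thesis
  proof (rule that[of L])
    show "cmod (p x - p y) \<le> L * cmod (x - y)" if "cmod x \<le> 1" "cmod y \<le> 1" for x y
      by (rule field_differentiable_bound[OF convex_cball d]) (use that L(2) in auto)
  qed (use L in auto)
qed

text \<open>Being analytic across the circle, \<open>p\<close> is Lipschitz on the closed disc, so
  it carries approximants of \<open>u\<close> to approximants of the composite, the error in mean
  growing at most by the Lipschitz constant.\<close>

lemma Hinfty_compose_analytic:
  assumes p: "p analytic_on cball 0 1" "\<And>x. cmod x \<le> 1 \<Longrightarrow> cmod (p x) \<le> C"
    and u: "Hinfty 1 u"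
  shows "Hinfty C (\<lambda>z. p (u z))" (is ?th1)
    and "cmod x < 1 \<Longrightarrow> cauchy_ext (\<lambda>z. p (u z)) x = p (cauchy_ext u x)" (is "_ \<Longrightarrow> ?th2")
proof -
  note [measurable] = Hinfty_measurable[OF u]
  obtain L where L: "L \<ge> 0" "\<And>x y. cmod x \<le> 1 \<Longrightarrow> cmod y \<le> 1 \<Longrightarrow> cmod (p x - p y) \<le> L * cmod (x - y)"
    by (rule analytic_lipschitz_cball[OF p(1)]) (rule that)
  obtain q where q: "\<And>n. q n analytic_on cball 0 1" "\<And>n x. cmod x \<le> 1 \<Longrightarrow> cmod (q n x) \<le> 1"
    "(\<lambda>n. \<E> z. cmod (u z - q n z)) \<longlonglongrightarrow> 0"
    "\<And>x. cmod x < 1 \<Longrightarrow> (\<lambda>n. q n x) \<longlonglongrightarrow> cauchy_ext u x"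
    by (rule Hinfty_cauchy_seq[OF u]) (rule that)
  have pq: "(\<lambda>z. p (q n z)) analytic_on cball 0 1" for n
  proof -
    have "p analytic_on (q n ` cball 0 1)"
      by (rule analytic_on_subset[OF p(1)]) (use q(2) in auto)
    from analytic_on_compose[OF q(1) this] show ?thesis by (simp add: o_def)
  qed
  have u1: "cmod (u z) \<le> 1" if "cmod z = 1" for z using Hinfty_bound[OF u that] .
  \<comment> \<open>Regularity of \<open>p\<close> is known only near the closed disc; setting it to
    0 off the disc makes it a Borel function on the plane, and on the circle \<open>u\<close> takes
    its values in the disc.\<close>
  have "(\<lambda>z. if z \<in> cball 0 1 then p z else 0) \<in> borel_measurable borel"
    using holomorphic_on_imp_continuous_on[OF analytic_imp_holomorphic[OF p(1)]]
    by (intro borel_measurable_continuous_on_if continuous_intros) auto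
  from measurable_compose[OF Hinfty_measurable[OF u] this]
  have "(\<lambda>z. if u z \<in> cball 0 1 then p (u z) else 0) \<in> borel_measurable \<mu>" .
  then have [measurable]: "(\<lambda>z. p (u z)) \<in> borel_measurable \<mu>"
    by (subst measurable_cong[where g = "\<lambda>z. if u z \<in> cball 0 1 then p (u z) else 0"]) (use u1 in auto)
  note [measurable] = measurable_analytic_circle[OF q(1)] measurable_analytic_circle[OF pq]
  have L1: "(\<E> z. cmod (p (u z) - p (q n z))) \<le> L * (\<E> z. cmod (u z - q n z))" for n
  proof -
    have i: "integrable \<mu> (\<lambda>z. cmod (u z - q n z))"
      by (rule integrable_circle_diff[where C = 1 and D = 1]) (use u1 q(2) in auto)
    have j: "integrable \<mu> (\<lambda>z. cmod (p (u z) - p (q n z)))"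
      by (rule integrable_circle_diff[where C = C and D = C]) (use u1 q(2) p(2) in auto)
    have "(\<E> z. cmod (p (u z) - p (q n z))) \<le> (\<E> z. L * cmod (u z - q n z))"
      by (rule integral_mono) (use i j L(2) u1 q(2) in auto)
    then show ?thesis by simp
  qed
  have lim: "(\<lambda>n. \<E> z. cmod (p (u z) - p (q n z))) \<longlonglongrightarrow> 0"
  proof (rule tendsto_sandwich[OF _ _ tendsto_const])
    show "(\<lambda>n. L * (\<E> z. cmod (u z - q n z))) \<longlonglongrightarrow> 0"
      by (auto intro!: tendsto_eq_intros q(3))
  qed (use L1 in \<open>auto intro!: always_eventually\<close>)
  show ?th1
    by (rule Hinfty_seqI[where q = "\<lambda>n z. p (q n z)"]) (use u1 q(2) p(2) pq lim in auto)
  show ?th2 if x: "cmod x < 1"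
  proof -
    have "(\<lambda>n. cauchy_ext (\<lambda>z. p (q n z)) x) \<longlonglongrightarrow> cauchy_ext (\<lambda>z. p (u z)) x"
      by (rule cauchy_ext_tendsto[where C = C]) (use u1 q(2) p(2) lim x in auto)
    then have "(\<lambda>n. p (q n x)) \<longlonglongrightarrow> cauchy_ext (\<lambda>z. p (u z)) x"
      by (simp add: cauchy_ext_analytic[OF pq x])
    moreover have "(\<lambda>n. p (q n x)) \<longlonglongrightarrow> p (cauchy_ext u x)"
      by (rule continuous_on_tendsto_compose[OF
            holomorphic_on_imp_continuous_on[OF analytic_imp_holomorphic[OF p(1)]] q(4)[OF x]])
         (use cauchy_ext_bound[OF u x] q(2) x in auto)
    ultimately show ?thesis by (rule LIMSEQ_unique)
  qed
qed

section \<open>The Poisson kernel and preservation of arc length\<close>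

text \<open>The real part of the Herglotz kernel: for unimodular \<open>x\<close> this is the
  Poisson kernel of radius \<open>\<rho>\<close> with pole 1. Written as the real part of a function
  analytic in \<open>x\<close> across the circle, it has means given by the mean value
  property.\<close>

definition poisson :: "real \<Rightarrow> complex \<Rightarrow> real" where
  "poisson \<rho> x = Re ((1 + of_real \<rho> * x) / (1 - of_real \<rho> * x))"

lemma borel_measurable_poisson [measurable]: "poisson \<rho> \<in> borel_measurable borel"
  unfolding poisson_def by measurable

lemma poisson_eq: "poisson \<rho> x = (1 - (\<rho> * cmod x)\<^sup>2) / (cmod (1 - of_real \<rho> * x))\<^sup>2"
proof -
  let ?w = "of_real \<rho> * x"
  have "(1 + ?w) / (1 - ?w) = (1 + ?w) * cnj (1 - ?w) / of_real ((cmod (1 - ?w))\<^sup>2)"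
    by (simp add: complex_div_cnj[of "1 + ?w"] flip: of_real_power)
  then have "poisson \<rho> x = Re ((1 + ?w) * cnj (1 - ?w)) / (cmod (1 - ?w))\<^sup>2"
    unfolding poisson_def by (simp only: Re_divide_of_real)
  also have "Re ((1 + ?w) * cnj (1 - ?w)) = 1 - (cmod ?w)\<^sup>2"
    by (simp add: cmod_power2) (simp add: algebra_simps power2_eq_square)
  finally show ?thesis by (simp add: norm_mult power_mult_distrib)
qed

lemma poisson_cnj: "poisson \<rho> (cnj x) = poisson \<rho> x"
proof -
  have "cmod (1 - of_real \<rho> * cnj x) = cmod (1 - of_real \<rho> * x)"
    by (metis complex_cnj_complex_of_real complex_cnj_diff complex_cnj_mult complex_cnj_one complex_mod_cnj)
  then show ?thesis by (simp add: poisson_eq)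
qed

lemma poisson_denominator:
  assumes "0 \<le> \<rho>" "\<rho> < 1" "cmod x \<le> 1"
  shows "1 - \<rho> \<le> cmod (1 - of_real \<rho> * x)" "1 - of_real \<rho> * x \<noteq> 0"
  using one_minus_cnj_nonzero[of "of_real \<rho>" "cnj x"] assms by auto

lemma poisson_nonneg:
  assumes "0 \<le> \<rho>" "\<rho> < 1" "cmod x \<le> 1"
  shows "poisson \<rho> x \<ge> 0"
proof -
  have "\<rho> * cmod x \<le> 1" using assms by (simp add: mult_le_one)
  then show ?thesis using assms unfolding poisson_eq by (simp add: power_le_one)
qed

lemma poisson_bound:
  assumes "0 \<le> \<rho>" "\<rho> < 1" "cmod x \<le> 1"
  shows "cmod ((1 + of_real \<rho> * x) / (1 - of_real \<rho> * x)) \<le> (1 + \<rho>) / (1 - \<rho>)"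
    and "poisson \<rho> x \<le> (1 + \<rho>) / (1 - \<rho>)"
proof -
  have "cmod (1 + of_real \<rho> * x) \<le> 1 + \<rho>"
    using norm_triangle_ineq[of 1 "of_real \<rho> * x"] assms mult_left_mono[of "cmod x" 1 \<rho>]
    by (simp add: norm_mult)
  then show *: "cmod ((1 + of_real \<rho> * x) / (1 - of_real \<rho> * x)) \<le> (1 + \<rho>) / (1 - \<rho>)"
    unfolding norm_divide using poisson_denominator[OF assms] assms by (intro frac_le) auto
  show "poisson \<rho> x \<le> (1 + \<rho>) / (1 - \<rho>)"
    unfolding poisson_def by (rule order_trans[OF complex_Re_le_cmod *])
qed

text \<open>Harnack's inequality, read off from the largest possible denominator. Neither this bound
  nor the upper one below depends on \<open>\<rho>\<close>, so the mean of the kernel stays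
  controlled as the arc shrinks.\<close>

lemma poisson_lower:
  assumes "0 \<le> \<rho>" "\<rho> < 1" "cmod x < 1"
  shows "poisson \<rho> x \<ge> (1 - cmod x) / (1 + cmod x)"
proof -
  define t where "t = \<rho> * cmod x"
  have t: "0 \<le> t" "t < 1" "t \<le> cmod x" using assms
    unfolding t_def by (auto simp: mult_left_le_one_le mult.commute intro: le_less_trans[of _ "cmod x"])
  have d: "cmod (1 - of_real \<rho> * x) \<le> 1 + t" "1 - of_real \<rho> * x \<noteq> 0"
    using norm_triangle_ineq4[of 1 "of_real \<rho> * x"] assms poisson_denominator(2)[of \<rho> x]
    by (auto simp: t_def norm_mult)
  have "(1 - cmod x) / (1 + cmod x) \<le> (1 - t) / (1 + t)"
    using t assms by (intro frac_le) auto
  also have "(1 - t) / (1 + t) = ((1 - t) * (1 + t)) / ((1 + t) * (1 + t))"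
    using t by simp
  also have "\<dots> = (1 - t\<^sup>2) / (1 + t)\<^sup>2"
    by (simp add: algebra_simps power2_eq_square)
  also have "\<dots> \<le> (1 - t\<^sup>2) / (cmod (1 - of_real \<rho> * x))\<^sup>2"
    using t d by (intro divide_left_mono power_mono) (auto intro!: mult_pos_pos simp: power_le_one)
  finally show ?thesis by (simp add: poisson_eq t_def)
qed

lemma poisson_upper:
  assumes "0 \<le> \<rho>" "\<rho> < 1" "cmod x < 1"
  shows "poisson \<rho> x \<le> (1 + cmod x) / (1 - cmod x)"
proof -
  define t where "t = \<rho> * cmod x"
  have t: "0 \<le> t" "t < 1" "t \<le> cmod x" using assms
    unfolding t_def by (auto simp: mult_left_le_one_le mult.commute intro: le_less_trans[of _ "cmod x"])
  have d: "1 - t \<le> cmod (1 - of_real \<rho> * x)"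
    using norm_triangle_ineq2[of 1 "of_real \<rho> * x"] assms
    by (auto simp: t_def norm_mult)
  have "poisson \<rho> x = (1 - t\<^sup>2) / (cmod (1 - of_real \<rho> * x))\<^sup>2"
    by (simp add: poisson_eq t_def)
  also have "\<dots> \<le> (1 - t\<^sup>2) / (1 - t)\<^sup>2"
    using t d by (intro divide_left_mono power_mono) (auto intro!: mult_pos_pos simp: power_le_one)
  also have "\<dots> = ((1 + t) * (1 - t)) / ((1 - t) * (1 - t))"
    by (simp add: algebra_simps power2_eq_square)
  also have "\<dots> = (1 + t) / (1 - t)"
    using t by simp
  also have "\<dots> \<le> (1 + cmod x) / (1 - cmod x)"
    using t assms by (intro frac_le) auto
  finally show ?thesis .
qed

lemma integral_poisson:
  assumes \<rho>: "0 \<le> \<rho>" "\<rho> < 1" and c: "cmod c \<le> 1" and u: "Hinfty 1 u"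
  shows "(\<E> z. poisson \<rho> (c * u z)) = poisson \<rho> (c * cauchy_ext u 0)"
proof -
  define p where "p x = (1 + of_real \<rho> * (c * x)) / (1 - of_real \<rho> * (c * x))" for x
  have cx: "cmod (c * x) \<le> 1" if "cmod x \<le> 1" for x
    using c that by (simp add: norm_mult mult_le_one)
  have p: "p analytic_on cball 0 1"
    unfolding p_def by (intro analytic_intros) (use poisson_denominator(2)[OF \<rho> cx] in auto)
  have pb: "cmod (p x) \<le> (1 + \<rho>) / (1 - \<rho>)" if "cmod x \<le> 1" for x
    unfolding p_def using poisson_bound(1)[OF \<rho> cx[OF that]] .
  note pu = Hinfty_compose_analytic[OF p pb u]
  have i: "integrable \<mu> (\<lambda>z. p (u z))"
    by (rule integrable_circle) (use pu(1) Hinfty_measurable Hinfty_bound in blast)+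
  have "(\<E> z. poisson \<rho> (c * u z)) = Re (\<E> z. p (u z))"
    unfolding poisson_def p_def[symmetric] using i by (rule integral_Re)
  also have "\<dots> = Re (p (cauchy_ext u 0))" using pu(2)[of 0] by (simp add: cauchy_ext_0)
  finally show ?thesis by (simp add: poisson_def p_def)
qed

lemma integral_poisson_kernel:
  assumes "0 \<le> \<rho>" "\<rho> < 1" "cmod w \<le> 1"
  shows "(\<E> \<zeta>. poisson \<rho> (cnj \<zeta> * w)) = 1"
proof -
  have "poisson \<rho> (cnj \<zeta> * w) = poisson \<rho> (cnj w * \<zeta>)" for \<zeta>
    using poisson_cnj[of \<rho> "cnj w * \<zeta>"] by (simp add: mult.commute)
  then show ?thesis
    using integral_poisson[of \<rho> "cnj w" "\<lambda>z. z"] assms Hinfty_id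
      cauchy_ext_analytic[of "\<lambda>z. z" 0]
    by (simp add: poisson_def analytic_on_id[unfolded id_def])
qed

text \<open>Loewner's lemma for open sets. Let \<open>F\<close> be the Poisson integral of the
  indicator of \<open>U\<close>, taken at \<open>u z\<close> pulled radially inwards. Integrating
  over \<open>z\<close> first, each kernel has mean 1 because the extension of \<open>u\<close>
  vanishes at the origin, so the mean of \<open>F\<close> is the measure of \<open>U\<close>; and
  \<open>F\<close> tends to 1 wherever \<open>u z\<close> lies in \<open>U\<close>.\<close>

lemma open_preimage_measure_le:
  assumes u: "Hinfty 1 u" and u1: "\<And>z. cmod z = 1 \<Longrightarrow> cmod (u z) = 1"
    and u0: "cauchy_ext u 0 = 0" and U: "open U"
  shows "measure \<mu> {z \<in> space \<mu>. u z \<in> U}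
    \<le> measure \<mu> {z \<in> space \<mu>. z \<in> U}"
proof -
  note [measurable] = Hinfty_measurable[OF u]
  have [measurable]: "U \<in> sets borel" using U by simp
  interpret P: pair_prob_space \<mu> \<mu> ..
  define \<rho> where "\<rho> n = 1 - 1 / real (n + 2)" for n
  have \<rho>: "0 \<le> \<rho> n" "\<rho> n < 1" for n by (auto simp: \<rho>_def)
  have \<rho>1: "\<rho> \<longlonglongrightarrow> 1" unfolding \<rho>_def by real_asymp
  define F where "F n z = (\<E> \<zeta>. indicator U \<zeta> * poisson (\<rho> n) (cnj \<zeta> * u z))" for n z
  have pk: "0 \<le> poisson (\<rho> n) (cnj \<zeta> * u z)"
      "poisson (\<rho> n) (cnj \<zeta> * u z) \<le> (1 + \<rho> n) / (1 - \<rho> n)"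
    if "cmod z = 1" "cmod \<zeta> = 1" for n z \<zeta>
    using poisson_nonneg[OF \<rho>] poisson_bound(2)[OF \<rho>] u1 that by (auto simp: norm_mult)
  have B0: "0 \<le> (1 + \<rho> n) / (1 - \<rho> n)" for n using \<rho>[of n] by simp
  have ipk: "integrable \<mu> (\<lambda>\<zeta>. indicator A \<zeta> * poisson (\<rho> n) (cnj \<zeta> * u z))"
    if "cmod z = 1" "A \<in> sets borel" for A n z
    by (rule integrable_circle[where C = "(1 + \<rho> n) / (1 - \<rho> n)"])
       (use pk that B0 in \<open>auto simp: indicator_def\<close>)
  have F_int: "integrable \<mu> (F n)"
    and F_mean: "(\<E> z. F n z) = measure \<mu> {z \<in> space \<mu>. z \<in> U}" for n
  proof -
    have int: "integrable (\<mu> \<Otimes>\<^sub>M \<mu>)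
        (\<lambda>(z, \<zeta>). indicator U \<zeta> * poisson (\<rho> n) (cnj \<zeta> * u z))"
    proof (rule P.P.integrable_const_bound[where B = "(1 + \<rho> n) / (1 - \<rho> n)"])
      show "AE x in \<mu> \<Otimes>\<^sub>M \<mu>.
          norm (case x of (z, \<zeta>) \<Rightarrow> indicator U \<zeta> * poisson (\<rho> n) (cnj \<zeta> * u z)) \<le> (1 + \<rho> n) / (1 - \<rho> n)"
        using pk B0 by (intro AE_I2) (auto simp: indicator_def space_pair_measure)
      have m: "(\<lambda>x. u (fst x)) \<in> borel_measurable (\<mu> \<Otimes>\<^sub>M \<mu>)"
        "(\<lambda>x. cnj (snd x)) \<in> borel_measurable (\<mu> \<Otimes>\<^sub>M \<mu>)"
        "(\<lambda>x. indicator U (snd x) :: real) \<in> borel_measurable (\<mu> \<Otimes>\<^sub>M \<mu>)"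
        by (intro measurable_compose[OF measurable_fst Hinfty_measurable[OF u]]
            measurable_compose[OF measurable_snd borel_measurable_circleI]
            borel_measurable_cnj borel_measurable_indicator; simp)+
      show "(\<lambda>(z, \<zeta>). indicator U \<zeta> * poisson (\<rho> n) (cnj \<zeta> * u z))
          \<in> borel_measurable (\<mu> \<Otimes>\<^sub>M \<mu>)"
        unfolding split_beta
        by (intro borel_measurable_times m measurable_compose[OF _ borel_measurable_poisson])
    qed
    show "integrable \<mu> (F n)"
      unfolding F_def using P.integrable_fst'[OF int] by simp
    have "(\<E> z. F n z) =
        (\<E> \<zeta>. (\<E> z. indicator U \<zeta> * poisson (\<rho> n) (cnj \<zeta> * u z)))"
      unfolding F_def using P.Fubini_integral[OF int] by simp
    also have "\<dots> = (\<E> \<zeta>. indicator U \<zeta>)"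
      by (rule mean_cong)
         (use integral_poisson[OF \<rho> _ u] u0 in \<open>auto simp: poisson_def\<close>)
    also have "\<dots> = measure \<mu> {z \<in> space \<mu>. z \<in> U}"
      by (subst mean_cong[OF refl, where g = "indicator {z \<in> space \<mu>. z \<in> U}"])
         (auto simp: indicator_def intro!: arg_cong[where f = circle.prob])
    finally show "(\<E> z. F n z) = measure \<mu> {z \<in> space \<mu>. z \<in> U}" .
  qed
  have F0: "0 \<le> F n z" and F1: "F n z \<le> 1" and Fc: "1 - F n z =
      (\<E> \<zeta>. indicator (-U) \<zeta> * poisson (\<rho> n) (cnj \<zeta> * u z))"
    if z: "cmod z = 1" for n z
  proof -
    show "0 \<le> F n z" unfolding F_def
      by (rule Bochner_Integration.integral_nonneg) (use pk z in \<open>auto simp: indicator_def\<close>)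
    have "F n z + (\<E> \<zeta>. indicator (-U) \<zeta> * poisson (\<rho> n) (cnj \<zeta> * u z))
      = (\<E> \<zeta>. indicator U \<zeta> * poisson (\<rho> n) (cnj \<zeta> * u z) +
           indicator (-U) \<zeta> * poisson (\<rho> n) (cnj \<zeta> * u z))"
      unfolding F_def by (rule Bochner_Integration.integral_add[symmetric]; intro ipk z) auto
    also have "\<dots> = (\<E> \<zeta>. poisson (\<rho> n) (cnj \<zeta> * u z))"
      by (rule mean_cong) (auto simp: indicator_def)
    also have "\<dots> = 1" using integral_poisson_kernel[OF \<rho>] u1[OF z] by simp
    finally show c: "1 - F n z = (\<E> \<zeta>. indicator (-U) \<zeta> * poisson (\<rho> n) (cnj \<zeta> * u z))"
      by simp
    have "0 \<le> 1 - F n z" unfolding c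
      by (rule Bochner_Integration.integral_nonneg) (use pk z in \<open>auto simp: indicator_def\<close>)
    then show "F n z \<le> 1" by simp
  qed
  have lim: "(\<lambda>n. F n z) \<longlonglongrightarrow> 1" if z: "cmod z = 1" and zU: "u z \<in> U" for z
  proof -
    obtain \<delta> where \<delta>: "\<delta> > 0" "ball (u z) \<delta> \<subseteq> U" using U zU open_contains_ball by metis
    have "\<forall>\<^sub>F n in sequentially. 1 - \<rho> n < \<delta> / 2"
      by (rule order_tendstoD(2)[of _ 0]) (use \<delta> in \<open>auto intro!: tendsto_eq_intros \<rho>1\<close>)
    then have "\<forall>\<^sub>F n in sequentially. norm (F n z - 1) \<le> norm ((1 - (\<rho> n)\<^sup>2) * (4 / \<delta>\<^sup>2)) * 1"
    proof eventually_elim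
      case (elim n)
      \<comment> \<open>Poles outside \<open>U\<close> are at distance at least
        \<open>\<delta>\<close> from \<open>u z\<close>, and pulling inwards costs less than
        \<open>\<delta> / 2\<close>; the denominator of the kernel is thus at least
        \<open>(\<delta> / 2)^2\<close>, while its numerator tends to 0.\<close>
      have "1 - F n z \<le> (\<E> \<zeta>. (1 - (\<rho> n)\<^sup>2) * (4 / \<delta>\<^sup>2))"
        unfolding Fc[OF z]
      proof (rule integral_mono)
        fix \<zeta> assume "\<zeta> \<in> space \<mu>"
        then have \<zeta>: "cmod \<zeta> = 1" by simp
        show "indicator (- U) \<zeta> * poisson (\<rho> n) (cnj \<zeta> * u z) \<le> (1 - (\<rho> n)\<^sup>2) * (4 / \<delta>\<^sup>2)"
        proof (cases "\<zeta> \<in> U")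
          case True
          then show ?thesis using \<rho>[of n] by (simp add: power_le_one)
        next
          case False
          then have d: "cmod (u z - \<zeta>) \<ge> \<delta>" using \<delta>(2) by (auto simp: dist_norm subset_iff not_less)
          have "cmod (1 - of_real (\<rho> n) * (cnj \<zeta> * u z)) = cmod (\<zeta> * (1 - of_real (\<rho> n) * (cnj \<zeta> * u z)))"
            using \<zeta> by (simp add: norm_mult)
          also have "\<zeta> * (1 - of_real (\<rho> n) * (cnj \<zeta> * u z)) = (\<zeta> - u z) + of_real (1 - \<rho> n) * u z"
            using circle_cnj[OF \<zeta>] by (simp add: algebra_simps)
          also have "cmod \<dots> \<ge> \<delta> / 2"
            using norm_diff_ineq[of "\<zeta> - u z" "of_real (1 - \<rho> n) * u z"] d elim u1[OF z] \<rho>(2)[of n]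
            by (simp add: norm_mult norm_minus_commute del: of_real_diff)
          finally have k: "cmod (1 - of_real (\<rho> n) * (cnj \<zeta> * u z)) \<ge> \<delta> / 2" .
          have "poisson (\<rho> n) (cnj \<zeta> * u z) = (1 - (\<rho> n)\<^sup>2) / (cmod (1 - of_real (\<rho> n) * (cnj \<zeta> * u z)))\<^sup>2"
            using \<zeta> u1[OF z] by (simp add: poisson_eq norm_mult)
          also have "\<dots> \<le> (1 - (\<rho> n)\<^sup>2) / (\<delta> / 2)\<^sup>2"
            using k \<delta>(1) \<rho>[of n] by (intro divide_left_mono power_mono mult_pos_pos zero_less_power)
              (auto simp: power_le_one)
          finally show ?thesis using False by (simp add: power_divide)
        qed
      qed (auto intro!: ipk z)
      then show ?case using F1[OF z, of n] \<rho>[of n] circle.prob_space by (simp add: power_le_one)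
    qed
    moreover have "(\<lambda>n. (1 - (\<rho> n)\<^sup>2) * (4 / \<delta>\<^sup>2)) \<longlonglongrightarrow> 0"
      using tendsto_mult[OF tendsto_diff[OF tendsto_const[of 1] tendsto_power[OF \<rho>1, of 2]]
          tendsto_const[of "4 / \<delta>\<^sup>2"]] by simp
    ultimately have "(\<lambda>n. F n z - 1) \<longlonglongrightarrow> 0" by (rule tendsto_0_le[rotated])
    then show ?thesis by (simp add: LIM_zero_iff)
  qed
  define A where "A = {z \<in> space \<mu>. u z \<in> U}"
  have A_eq: "A = u -` U \<inter> space \<mu>" by (auto simp: A_def)
  have A: "A \<in> sets \<mu>"
    unfolding A_eq by (rule measurable_sets[OF Hinfty_measurable[OF u]]) (use U in simp)
  have "(\<lambda>n. \<E> z. indicator A z * F n z) \<longlonglongrightarrow> (\<E> z. indicator A z)"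
  proof (rule integral_dominated_convergence[where w = "\<lambda>_. 1"])
    show "AE z in \<mu>. (\<lambda>n. indicator A z * F n z) \<longlonglongrightarrow> indicator A z"
      using lim by (intro AE_I2) (auto simp: A_def indicator_def)
    show "AE z in \<mu>. norm (indicator A z * F n z) \<le> 1" for n
      using F0 F1 by (intro AE_I2) (auto simp: indicator_def)
    show "(\<lambda>z. indicator A z * F n z) \<in> borel_measurable \<mu>" for n
      by (intro borel_measurable_times borel_measurable_indicator A borel_measurable_integrable[OF F_int])
  qed (use A in \<open>auto intro!: borel_measurable_indicator\<close>)
  moreover have "A \<inter> space \<mu> = A" by (auto simp: A_def)
  ultimately have L: "(\<lambda>n. \<E> z. indicator A z * F n z) \<longlonglongrightarrow> measure \<mu> A"
    by (metis Bochner_Integration.integral_indicator)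
  have "(\<E> z. indicator A z * F n z) \<le> measure \<mu> {z \<in> space \<mu>. z \<in> U}" for n
  proof -
    have "(\<E> z. indicator A z * F n z) \<le> (\<E> z. F n z)"
      by (rule integral_mono_AE')
         (use F_int F0 in \<open>auto intro!: AE_I2 simp: indicator_def\<close>)
    then show ?thesis by (simp add: F_mean)
  qed
  then show ?thesis unfolding A_def[symmetric] by (intro LIMSEQ_le_const2[OF L]) auto
qed

text \<open>Outer regularity extends the inequality from open to Borel sets; applied also to the
  complement, it becomes an equality between probability measures.\<close>

lemma distr_circle_eq:
  assumes u: "Hinfty 1 u" and u1: "\<And>z. cmod z = 1 \<Longrightarrow> cmod (u z) = 1"
    and u0: "cauchy_ext u 0 = 0"
  shows "u \<in> \<mu> \<rightarrow>\<^sub>M \<mu>" "distr \<mu> \<mu> u = \<mu>"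
proof -
  note [measurable] = Hinfty_measurable[OF u]
  show m: "u \<in> \<mu> \<rightarrow>\<^sub>M \<mu>"
    by (subst measurable_cong_sets[OF refl sets_circle], rule measurable_restrict_space2) (use u1 in auto)
  \<comment> \<open>Both measures are moved to the Borel sets of the plane, since outer regularity
    is stated for Borel measures on a whole space.\<close>
  define \<nu> where "\<nu> = distr \<mu> borel u"
  define \<mu>' where "\<mu>' = distr \<mu> borel (\<lambda>z::complex. z)"
  interpret \<nu>: prob_space \<nu> unfolding \<nu>_def by (rule circle.prob_space_distr) simp
  interpret \<mu>': prob_space \<mu>' unfolding \<mu>'_def by (rule circle.prob_space_distr) simp
  have op: "emeasure \<nu> U \<le> emeasure \<mu>' U" if "open U" for U
    using open_preimage_measure_le[OF u u1 u0 that] that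
    unfolding \<nu>.emeasure_eq_measure \<mu>'.emeasure_eq_measure
    by (simp add: \<nu>_def \<mu>'_def measure_distr vimage_def Int_def conj_commute)
  have le: "emeasure \<nu> B \<le> emeasure \<mu>' B" if B: "B \<in> sets borel" for B
  proof -
    have "emeasure \<nu> B \<le> (INF U \<in> {U. B \<subseteq> U \<and> open U}. emeasure \<mu>' U)"
    proof (rule INF_greatest)
      fix U assume "U \<in> {U. B \<subseteq> U \<and> open U}"
      then have U: "B \<subseteq> U" "open U" by auto
      have "emeasure \<nu> B \<le> emeasure \<nu> U" by (rule emeasure_mono) (use U in \<open>auto simp: \<nu>_def\<close>)
      also have "\<dots> \<le> emeasure \<mu>' U" by (rule op[OF U(2)])
      finally show "emeasure \<nu> B \<le> emeasure \<mu>' U" .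
    qed
    also have "\<dots> = emeasure \<mu>' B"
      by (rule outer_regular[symmetric]) (use B in \<open>auto simp: \<mu>'_def \<mu>'.emeasure_eq_measure[unfolded \<mu>'_def]\<close>)
    finally show ?thesis .
  qed
  have eq: "measure \<nu> B = measure \<mu>' B" if B: "B \<in> sets borel" for B
  proof -
    have "measure \<nu> B \<le> measure \<mu>' B" "measure \<nu> (-B) \<le> measure \<mu>' (-B)"
      using le[of B] le[of "-B"] B by (auto simp: \<nu>.emeasure_eq_measure \<mu>'.emeasure_eq_measure)
    moreover have "measure \<nu> (-B) = 1 - measure \<nu> B" "measure \<mu>' (-B) = 1 - measure \<mu>' B"
      using \<nu>.prob_compl[of B] \<mu>'.prob_compl[of B] B by (simp_all add: \<nu>_def \<mu>'_def Compl_eq_Diff_UNIV)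
    ultimately show ?thesis by simp
  qed
  show "distr \<mu> \<mu> u = \<mu>"
  proof (rule measure_eqI)
    fix A assume "A \<in> sets (distr \<mu> \<mu> u)"
    then have A: "A \<in> sets borel" "A \<subseteq> unit_circle" "A \<in> sets \<mu>"
      by (auto simp: sets_circle sets_restrict_space)
    have "emeasure (distr \<mu> \<mu> u) A = emeasure \<nu> A"
      using A m by (simp add: \<nu>_def emeasure_distr)
    also have "\<dots> = emeasure \<mu>' A" using eq[OF A(1)] by (simp add: \<nu>.emeasure_eq_measure \<mu>'.emeasure_eq_measure)
    also have "\<dots> = emeasure \<mu> A"
      using A by (simp add: \<mu>'_def emeasure_distr Int_absorb2)
    finally show "emeasure (distr \<mu> \<mu> u) A = emeasure \<mu> A" .
  qed simp
qed

section \<open>Iterates of a centred inner function\<close>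

text \<open>The dilates \<open>\<phi> (s x)\<close>, \<open>s < 1\<close>, are analytic across the
  circle, so they may be composed with \<open>u\<close>. Radial limits of \<open>\<phi>\<close>
  exist almost everywhere, hence at almost every \<open>u z\<close>, because \<open>u\<close>
  preserves arc length; the dilates therefore converge along \<open>u\<close>, and the limit
  inherits both membership and the extension. No nontangential approach is involved.\<close>

lemma Hinfty_compose_radial:
  assumes holo: "\<phi> holomorphic_on ball 0 1" and \<phi>: "\<And>x. cmod x < 1 \<Longrightarrow> cmod (\<phi> x) \<le> 1"
    and [measurable]: "v \<in> borel_measurable \<mu>" and v: "\<And>z. cmod z = 1 \<Longrightarrow> cmod (v z) \<le> 1"
    and radial: "AE z in \<mu>. ((\<lambda>r. \<phi> (of_real r * z)) \<longlongrightarrow> v z) (at_left 1)"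
    and u: "Hinfty 1 u" and u1: "\<And>z. cmod z = 1 \<Longrightarrow> cmod (u z) = 1"
    and u0: "cauchy_ext u 0 = 0"
  shows "Hinfty 1 (\<lambda>z. v (u z))" (is ?th1)
    and "cmod x < 1 \<Longrightarrow> cmod (cauchy_ext u x) < 1 \<Longrightarrow>
      cauchy_ext (\<lambda>z. v (u z)) x = \<phi> (cauchy_ext u x)" (is "_ \<Longrightarrow> _ \<Longrightarrow> ?th2")
proof -
  note [measurable] = distr_circle_eq(1)[OF u u1 u0]
  define s where "s n = 1 - 1 / real (n + 2)" for n
  have s: "0 < s n" "s n < 1" for n by (auto simp: s_def)
  have s1: "s \<longlonglongrightarrow> 1" unfolding s_def by real_asymp
  have s_left: "filterlim s (at_left 1) sequentially"
    by (rule tendsto_imp_filterlim_at_left[OF s1]) (use s in auto)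
  have sx: "cmod (of_real (s n) * x) < 1" if "cmod x \<le> 1" for n x
    using le_less_trans[OF mult_left_mono[OF that, of "s n"], of 1] s[of n] by (simp add: norm_mult)
  have an: "(\<lambda>x. \<phi> (of_real (s n) * x)) analytic_on cball 0 1" for n
  proof -
    have "\<phi> analytic_on ((\<lambda>x. of_real (s n) * x) ` cball 0 1)"
      by (rule analytic_on_subset[of _ "ball 0 1"]) (use holo sx in \<open>auto simp: analytic_on_open\<close>)
    from analytic_on_compose[OF _ this] show ?thesis by (auto simp: o_def intro!: analytic_intros)
  qed
  have bd: "cmod (\<phi> (of_real (s n) * x)) \<le> 1" if "cmod x \<le> 1" for n x
    using \<phi>[OF sx[OF that]] .
  have ba: "Hinfty 1 (\<lambda>z. \<phi> (of_real (s n) * u z))"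
    and ce: "cmod x < 1 \<Longrightarrow> cauchy_ext (\<lambda>z. \<phi> (of_real (s n) * u z)) x = \<phi> (of_real (s n) * cauchy_ext u x)" for n x
    using Hinfty_compose_analytic[OF an bd u] by auto
  have "AE z in distr \<mu> \<mu> u. ((\<lambda>r. \<phi> (of_real r * z)) \<longlongrightarrow> v z) (at_left 1)"
    using radial by (subst distr_circle_eq(2)[OF u u1 u0])
  then have "AE z in \<mu>. ((\<lambda>r. \<phi> (of_real r * u z)) \<longlongrightarrow> v (u z)) (at_left 1)"
    by (rule AE_distrD[rotated]) measurable
  then have lim: "AE z in \<mu>. (\<lambda>n. \<phi> (of_real (s n) * u z)) \<longlonglongrightarrow> v (u z)"
    by eventually_elim (rule filterlim_compose[OF _ s_left])
  have vu: "(\<lambda>z. v (u z)) \<in> borel_measurable \<mu>" by measurable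
  have vu1: "cmod (v (u z)) \<le> 1" if "cmod z = 1" for z using v u1[OF that] .
  show ?th1 by (rule Hinfty_limit(1)[OF ba vu vu1 lim])
  show ?th2 if x: "cmod x < 1" and y: "cmod (cauchy_ext u x) < 1"
  proof -
    have "(\<lambda>n. \<phi> (of_real (s n) * cauchy_ext u x)) \<longlonglongrightarrow> cauchy_ext (\<lambda>z. v (u z)) x"
      using Hinfty_limit(2)[OF ba vu vu1 lim x] ce[OF x] by simp
    moreover have "(\<lambda>n. \<phi> (of_real (s n) * cauchy_ext u x)) \<longlonglongrightarrow> \<phi> (1 * cauchy_ext u x)"
    proof (rule continuous_on_tendsto_compose[OF holomorphic_on_imp_continuous_on[OF holo]])
      show "(\<lambda>n. of_real (s n) * cauchy_ext u x) \<longlonglongrightarrow> 1 * cauchy_ext u x"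
        using tendsto_of_real[OF s1, where 'a = complex] by (intro tendsto_mult) auto
    qed (use y sx[of "cauchy_ext u x"] in auto)
    ultimately show ?thesis using LIMSEQ_unique by fastforce
  qed
qed

lemma Hinfty_cong:
  assumes "\<And>z. cmod z = 1 \<Longrightarrow> v z = w z"
  shows "Hinfty C v \<longleftrightarrow> Hinfty C w" and "cauchy_ext v x = cauchy_ext w x"
proof -
  have m: "v \<in> borel_measurable \<mu> \<longleftrightarrow> w \<in> borel_measurable \<mu>"
    by (rule measurable_cong) (use assms in auto)
  have i: "(\<E> z. cmod (v z - q z)) = (\<E> z. cmod (w z - q z))" for q
    by (rule mean_cong) (use assms in auto)
  show "Hinfty C v \<longleftrightarrow> Hinfty C w"
    unfolding Hinfty_def m i using assms by auto
  show "cauchy_ext v x = cauchy_ext w x"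
    unfolding cauchy_ext_def by (rule mean_cong) (use assms in auto)
qed

lemma cauchy_ext_ident: "cmod x < 1 \<Longrightarrow> cauchy_ext (\<lambda>z. z) x = x"
  by (rule cauchy_ext_analytic) (auto intro: analytic_intros)

text \<open>\<open>T\<close> is a total, measurable, unimodular version of the boundary map, tied to
  \<open>f\<close> only almost everywhere. By the Schwarz lemma the strict bound on the derivative
  excludes exactly the rotations.\<close>

locale centred_inner =
  fixes f T :: "complex \<Rightarrow> complex"
  assumes holo: "f holomorphic_on ball 0 1"
    and maps: "\<And>x. cmod x < 1 \<Longrightarrow> cmod (f x) < 1"
    and f0 [simp]: "f 0 = 0"
    and deriv_less_1: "cmod (deriv f 0) < 1"
    and T_measurable [measurable]: "T \<in> borel_measurable \<mu>"
    and T_unit: "\<And>z. cmod z = 1 \<Longrightarrow> cmod (T z) = 1"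
    and T_radial: "AE z in \<mu>. ((\<lambda>r. f (of_real r * z)) \<longlongrightarrow> T z) (at_left 1)"
begin

lemma f_funpow_0 [simp]: "(f ^^ n) 0 = 0"
  by (induction n) auto

lemma funpow_unit: "cmod z = 1 \<Longrightarrow> cmod ((T ^^ n) z) = 1"
  by (induction n) (auto simp: T_unit)

lemma funpow_less_1: "cmod x < 1 \<Longrightarrow> cmod ((f ^^ n) x) < 1"
  by (induction n) (auto simp: maps)

text \<open>Composing with one more \<open>T\<close> requires that \<open>T ^^ n\<close> preserve
  arc length. This is available because the extension of \<open>T ^^ n\<close> is
  \<open>f ^^ n\<close>, which fixes 0; so both claims run through one induction.\<close>

lemma funpow_boundary:
  shows "Hinfty 1 (T ^^ n)"
    and "cmod x < 1 \<Longrightarrow> cauchy_ext (T ^^ n) x = (f ^^ n) x"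
proof (induction n arbitrary: x)
  case 0
  { case 1 show ?case using Hinfty_id by (simp add: id_def) }
  { case 2 then show ?case using cauchy_ext_ident by (simp add: id_def) }
next
  case (Suc n)
  have eq: "(T ^^ Suc n) = (\<lambda>z. T ((T ^^ n) z))" by auto
  have u0: "cauchy_ext (T ^^ n) 0 = 0" using Suc(2)[of 0] by simp
  note R = Hinfty_compose_radial[OF holo _ T_measurable _ T_radial Suc(1) funpow_unit u0]
  { case 1 show ?case unfolding eq by (rule R(1)) (auto simp: T_unit intro: less_imp_le[OF maps]) }
  { case 2 then show ?case unfolding eq
      by (subst R(2)) (auto simp: T_unit Suc(2) funpow_less_1 intro: less_imp_le[OF maps]) }
qed

lemma funpow_distr:
  "T ^^ n \<in> \<mu> \<rightarrow>\<^sub>M \<mu>"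
  "distr \<mu> \<mu> (T ^^ n) = \<mu>"
  using distr_circle_eq[OF funpow_boundary(1) funpow_unit] funpow_boundary(2)[of 0 n] by auto

section \<open>Return functions and their values at the origin\<close>

definition quotient :: "complex \<Rightarrow> complex" where
  "quotient x = (if x = 0 then deriv f 0 else f x / x)"

lemma quotient_holomorphic: "quotient holomorphic_on ball 0 1"
  by (rule pole_theorem_open_0[OF holo, of 0]) (auto simp: quotient_def)

lemma f_eq_quotient: "f x = x * quotient x"
  by (simp add: quotient_def)

lemma quotient_le_1: "cmod x < 1 \<Longrightarrow> cmod (quotient x) \<le> 1"
  using Schwarz_Lemma(1)[OF holo f0 maps, of x] deriv_less_1
  by (auto simp: quotient_def norm_divide divide_le_eq)

lemma quotient_less_1:
  assumes "cmod x < 1" shows "cmod (quotient x) < 1"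
proof (rule ccontr)
  assume "\<not> ?thesis"
  then have 1: "cmod (quotient x) = 1" using quotient_le_1[OF assms] by simp
  then have x0: "x \<noteq> 0" using deriv_less_1 by (auto simp: quotient_def)
  then have "cmod (f x) = cmod x" using 1 by (simp add: quotient_def norm_divide field_simps)
  then obtain \<alpha> where \<alpha>: "\<And>z. cmod z < 1 \<Longrightarrow> f z = \<alpha> * z" "cmod \<alpha> = 1"
    using Schwarz_Lemma(3)[OF holo f0 maps assms] assms x0 by blast
  have "(f has_field_derivative \<alpha>) (at 0)"
  proof (rule has_field_derivative_transform_within_open[where S = "ball 0 1"])
    show "((\<lambda>z. \<alpha> * z) has_field_derivative \<alpha>) (at 0)" by (auto intro!: derivative_eq_intros)
  qed (use \<alpha> in auto)
  then show False using \<alpha>(2) deriv_less_1 by (simp add: DERIV_imp_deriv)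
qed

text \<open>\<open>return 0 n\<close> is the function \<open>g\<^sub>n\<close>.\<close>

definition return :: "nat \<Rightarrow> nat \<Rightarrow> complex \<Rightarrow> complex" where
  "return m l z = (T ^^ (m + l)) z * cnj ((T ^^ m) z)"

lemma return_unit: "cmod z = 1 \<Longrightarrow> cmod (return m l z) = 1"
  by (simp add: return_def norm_mult funpow_unit)

lemma return_Suc:
  assumes "cmod z = 1"
  shows "return m (Suc l) z = return m l z * return (m + l) 1 z"
  using circle_cnj(2)[OF funpow_unit[OF assms, of "m + l"]]
  by (simp add: return_def algebra_simps)

text \<open>A return over \<open>l\<close> steps is the product of \<open>l\<close> one-step
  quotients along the orbit. The step at time \<open>k\<close> is the boundary function of
  \<open>quotient\<close> composed with \<open>T ^^ k\<close>; its extension at 0 is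
  \<open>quotient 0 = deriv f 0\<close>, as \<open>f ^^ k\<close> fixes 0, and these values
  multiply.\<close>

lemma return_boundary:
  shows "Hinfty 1 (return m l)" and "cauchy_ext (return m l) 0 = deriv f 0 ^ l"
proof (induction l)
  case 0
  have eq: "return m 0 z = 1" if "cmod z = 1" for z
    using circle_cnj(1)[OF funpow_unit[OF that]] by (simp add: return_def)
  { case 1 show ?case
      using Hinfty_cong(1)[of "return m 0" "\<lambda>_. 1"] eq Hinfty_one by auto }
  { case 2 show ?case
      using Hinfty_cong(2)[of "return m 0" "\<lambda>_. 1" 0] eq cauchy_ext_analytic[of "\<lambda>_. 1" 0]
      by (auto intro: analytic_intros) }
next
  case (Suc l)
  have rad: "AE z in \<mu>. ((\<lambda>r. quotient (of_real r * z)) \<longlongrightarrow> T z * cnj z) (at_left 1)"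
    using T_radial AE_space
  proof eventually_elim
    case (elim z)
    then have z: "cmod z = 1" by simp
    have "((\<lambda>r. f (of_real r * z) * (cnj z / of_real r)) \<longlongrightarrow> T z * (cnj z / of_real 1)) (at_left 1)"
      by (intro tendsto_intros elim) auto
    moreover have "\<forall>\<^sub>F r in at_left 1. f (of_real r * z) * (cnj z / of_real r) = quotient (of_real r * z)"
    proof -
      have "\<forall>\<^sub>F r in at_left (1::real). r > 0"
        by (rule eventually_at_left_real[of 0 1, simplified, THEN eventually_mono]) auto
      then show ?thesis
      proof eventually_elim
        case (elim r)
        have "cnj z = 1 / z" using z circle_cnj[OF z] by (metis mult_eq_0_iff nonzero_eq_divide_eq zero_neq_one)
        then show ?case using z elim by (auto simp: quotient_def)
      qed
    qed
    ultimately show ?case by (simp add: filterlim_cong[OF refl refl])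
  qed
  have u0: "cauchy_ext (T ^^ (m + l)) 0 = 0" using funpow_boundary(2)[of 0] by simp
  have vm: "(\<lambda>z. T z * cnj z) \<in> borel_measurable \<mu>" by measurable
  note R = Hinfty_compose_radial[OF quotient_holomorphic quotient_le_1 vm _ rad
      funpow_boundary(1) funpow_unit u0]
  have ba1: "Hinfty 1 (return (m + l) 1)"
    using R(1) by (simp add: return_def[abs_def] T_unit norm_mult)
  have e1: "cauchy_ext (return (m + l) 1) 0 = deriv f 0"
    using R(2)[of 0] u0 by (simp add: return_def[abs_def] T_unit norm_mult quotient_def)
  note M = Hinfty_mult[OF Suc(1) ba1]
  note C = Hinfty_cong[of "return m (Suc l)" "\<lambda>z. return m l z * return (m + l) 1 z", OF return_Suc]
  { case 1 show ?case using C(1)[of 1] M(1) by simp }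
  { case 2 show ?case using C(2)[of 0] M(2)[of 0] Suc(2) e1 by simp }
qed

text \<open>Identifies the extension of the return function as \<open>(f ^^ l) x / x\<close>, so
  that contraction of the iterates becomes smallness of this extension.\<close>

lemma funpow_quotient:
  assumes "cmod x < 1"
  shows "(f ^^ l) x = x * cauchy_ext (return 0 l) x"
proof -
  have "(T ^^ l) z = z * return 0 l z" if "cmod z = 1" for z
    using circle_cnj[OF that] by (simp add: return_def)
  then have "cauchy_ext (T ^^ l) x = cauchy_ext (\<lambda>z. z * return 0 l z) x"
    by (rule Hinfty_cong(2))
  then show ?thesis
    using Hinfty_mult(2)[OF Hinfty_id return_boundary(1) assms, of 0 l] assms
      cauchy_ext_ident
    by (simp add: funpow_boundary)
qed

section \<open>Contraction of the iterates towards the origin\<close>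

definition rate :: real where
  "rate = (1 + cmod (deriv f 0)) / 2"

lemma rate: "0 < rate" "rate < 1" "cmod (deriv f 0) \<le> rate"
  using deriv_less_1 by (auto simp: rate_def intro: add_pos_nonneg)

text \<open>The Moebius map taking \<open>a = deriv f 0\<close> to 0 turns \<open>quotient\<close>
  into a self-map of the disc fixing 0; the Schwarz lemma then bounds the pseudo-hyperbolic distance
  from \<open>quotient x\<close> to \<open>a\<close> by \<open>cmod x\<close>. The rest extracts the
  largest modulus compatible with that.\<close>

lemma quotient_schwarz_pick:
  assumes x: "cmod x < 1"
  shows "cmod (quotient x) \<le> (cmod x + cmod (deriv f 0)) / (1 + cmod (deriv f 0) * cmod x)"
proof -
  define a where "a = deriv f 0"
  define h where "h y = (quotient y - a) / (1 - cnj a * quotient y)" for y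
  have a: "cmod a < 1" using deriv_less_1 by (simp add: a_def)
  have h_eq: "h = Moebius_function 0 a \<circ> quotient"
    by (auto simp: h_def Moebius_function_simple)
  have "h holomorphic_on ball 0 1" unfolding h_eq
    by (rule holomorphic_on_compose_gen[OF quotient_holomorphic Moebius_function_holomorphic[OF a]])
       (use quotient_less_1 in auto)
  moreover have "h 0 = 0" by (simp add: h_def quotient_def a_def)
  moreover have "cmod (h y) < 1" if "cmod y < 1" for y
    unfolding h_eq o_def by (rule Moebius_function_norm_lt_1[OF a quotient_less_1[OF that]])
  ultimately have hx: "cmod (h x) \<le> cmod x" using Schwarz_Lemma(1)[of h] x by blast
  define w where "w = quotient x"
  have w: "cmod w < 1" using quotient_less_1[OF x] by (simp add: w_def)
  have aw: "cmod (cnj a * w) < 1" using le_less_trans[OF mult_left_mono[OF less_imp_le[OF w], of "cmod a"], of 1] a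
    by (simp add: norm_mult)
  have nz: "1 - cnj a * w \<noteq> 0" using aw by auto
  define b where "b = cmod a"
  have "cmod (w - a) \<le> cmod x * cmod (1 - cnj a * w)"
    using hx nz by (simp add: h_def w_def[symmetric] norm_divide divide_le_eq)
  then have "(cmod (w - a))\<^sup>2 \<le> (cmod x)\<^sup>2 * (cmod (1 - cnj a * w))\<^sup>2"
    by (metis norm_ge_zero power_mono power_mult_distrib)
  \<comment> \<open>With this identity the bound involves \<open>w\<close> only through
    \<open>cmod w\<close> and \<open>cmod (w - a)\<close>, so the latter may be replaced by its
    lower bound \<open>\<bar>cmod w - cmod a\<bar>\<close>.\<close>
  moreover have "(cmod (1 - cnj a * w))\<^sup>2 = (cmod (w - a))\<^sup>2 + (1 - b\<^sup>2) * (1 - (cmod w)\<^sup>2)"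
    unfolding b_def by (simp add: cmod_power2) (simp add: algebra_simps power2_eq_square)
  ultimately have "(cmod (w - a))\<^sup>2 \<le> (cmod x)\<^sup>2 * ((cmod (w - a))\<^sup>2 + (1 - b\<^sup>2) * (1 - (cmod w)\<^sup>2))"
    by (simp only:)
  then have main: "(1 - (cmod x)\<^sup>2) * (cmod (w - a))\<^sup>2 \<le> (cmod x)\<^sup>2 * ((1 - b\<^sup>2) * (1 - (cmod w)\<^sup>2))"
    by (simp add: algebra_simps)
  define t where "t = cmod x"
  define y where "y = cmod w"
  have b: "0 \<le> b" "b < 1" and t: "0 \<le> t" "t < 1" and y: "0 \<le> y" "y < 1"
    using a x w by (auto simp: b_def t_def y_def)
  have "(y - b)\<^sup>2 \<le> (cmod (w - a))\<^sup>2"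
    using norm_triangle_ineq3[of w a] by (simp add: y_def b_def abs_le_square_iff[symmetric])
  then have "(1 - t\<^sup>2) * (y - b)\<^sup>2 \<le> (1 - t\<^sup>2) * (cmod (w - a))\<^sup>2"
    using t by (intro mult_left_mono) (auto simp: power_le_one)
  with main have "(1 - t\<^sup>2) * (y - b)\<^sup>2 \<le> t\<^sup>2 * ((1 - b\<^sup>2) * (1 - y\<^sup>2))"
    by (simp add: t_def y_def)
  then have "(y - b)\<^sup>2 \<le> t\<^sup>2 * (1 - b * y)\<^sup>2"
    by (simp add: algebra_simps power2_eq_square)
  then have "\<bar>y - b\<bar> \<le> \<bar>t * (1 - b * y)\<bar>"
    by (simp add: abs_le_square_iff power_mult_distrib)
  moreover have "b * y \<le> 1" using b y by (simp add: mult_le_one)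
  ultimately have "y - b \<le> t * (1 - b * y)"
    using t by simp
  then have "y * (1 + b * t) \<le> t + b" by (simp add: algebra_simps)
  moreover have "1 + b * t > 0" using b t by (simp add: add_pos_nonneg)
  ultimately have "y \<le> (t + b) / (1 + b * t)" by (simp add: pos_le_divide_eq)
  then show ?thesis by (simp add: y_def t_def b_def w_def a_def)
qed

text \<open>With \<open>b = cmod (deriv f 0)\<close>, the Schwarz-Pick bound multiplies
  \<open>t / (1 - t)\<close> by at most \<open>(t + b) / (1 + t)\<close>, which increases with
  \<open>t\<close> to \<open>(1 + b) / 2\<close>; that limit is \<open>rate\<close>. This quantity
  contracts uniformly up to the circle, where \<open>cmod x\<close> itself need not, and iterating
  costs only one factor \<open>1 / (1 - cmod x)\<close>.\<close>

lemma f_contracts: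
  assumes x: "cmod x < 1"
  shows "cmod (f x) / (1 - cmod (f x)) \<le> rate * (cmod x / (1 - cmod x))"
proof -
  define b where "b = cmod (deriv f 0)"
  define t where "t = cmod x"
  define s where "s = t * ((t + b) / (1 + b * t))"
  have b: "0 \<le> b" "b < 1" and t: "0 \<le> t" "t < 1"
    using deriv_less_1 x by (auto simp: b_def t_def)
  have pos: "1 + b * t > 0" using b t by (simp add: add_pos_nonneg)
  have fs: "cmod (f x) \<le> s"
    using mult_left_mono[OF quotient_schwarz_pick[OF x], of "cmod x"] f_eq_quotient[of x]
    by (simp add: s_def t_def b_def norm_mult)
  have s1: "1 - s = (1 - t) * (1 + t) / (1 + b * t)"
    using pos by (simp add: s_def field_simps)
  have s_lt: "s < 1"
  proof -
    have "1 - s > 0" unfolding s1 using t pos by (intro divide_pos_pos mult_pos_pos) auto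
    then show ?thesis by simp
  qed
  have "cmod (f x) / (1 - cmod (f x)) \<le> s / (1 - s)"
    using fs s_lt order_trans[OF norm_ge_zero fs] by (intro frac_le) auto
  also have "s / (1 - s) = (t + b) / (1 + t) * (t / (1 - t))"
    unfolding s1 using pos t by (simp add: s_def mult.commute)
  also have "\<dots> \<le> rate * (t / (1 - t))"
  proof (rule mult_right_mono)
    have "(t + b) * 2 \<le> (1 + b) * (1 + t)"
    proof -
      have "0 \<le> (1 - b) * (1 - t)" using b t by simp
      then show ?thesis by (simp add: algebra_simps)
    qed
    then show "(t + b) / (1 + t) \<le> rate"
      using t by (simp add: rate_def b_def[symmetric] divide_le_eq)
  qed (use t in auto)
  finally show ?thesis by (simp add: t_def)
qed

lemma funpow_contracts:
  assumes x: "cmod x < 1"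
  shows "cmod ((f ^^ n) x) \<le> rate ^ n * (cmod x / (1 - cmod x))"
proof -
  have "cmod ((f ^^ n) x) / (1 - cmod ((f ^^ n) x)) \<le> rate ^ n * (cmod x / (1 - cmod x))"
  proof (induction n)
    case (Suc n)
    show ?case
      using order_trans[OF f_contracts[OF funpow_less_1[OF x, of n]] mult_left_mono[OF Suc, of rate]] rate(1)
      by simp
  qed simp
  moreover have "cmod ((f ^^ n) x) \<le> cmod ((f ^^ n) x) / (1 - cmod ((f ^^ n) x))"
    using funpow_less_1[OF x, of n] by (simp add: le_divide_eq mult_left_le)
  ultimately show ?thesis by linarith
qed

end

section \<open>Fourier coefficients and mixed correlations\<close>

lemma circle_integral_norm_le:
  assumes "integrable \<mu> g" "\<And>z. cmod z = 1 \<Longrightarrow> cmod (h z) \<le> g z"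
  shows "cmod (\<E> z. h z) \<le> (\<E> z. g z)"
proof -
  have "cmod (\<E> z. h z) \<le> (\<E> z. cmod (h z))"
    by (rule integral_norm_bound)
  also have "\<dots> \<le> (\<E> z. g z)"
    by (rule integral_mono') (use assms order_trans[OF norm_ge_zero assms(2)] in auto)
  finally show ?thesis .
qed

text \<open>Cauchy's estimate. The mean against \<open>cnj z ^ i\<close> is the Taylor coefficient
  of order \<open>i\<close> of the extension, recovered by averaging the extension over the circle
  of radius \<open>\<rho>\<close>; Fubini exchanges this average with the Cauchy integral.\<close>

lemma fourier_coefficient_bound:
  assumes v: "Hinfty C v" and \<rho>: "0 < \<rho>" "\<rho> < 1"
    and B: "\<And>x. cmod x = \<rho> \<Longrightarrow> cmod (cauchy_ext v x) \<le> B"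
  shows "cmod (\<E> z. v z * cnj z ^ i) \<le> B / \<rho> ^ i"
proof -
  note [measurable] = Hinfty_measurable[OF v]
  interpret P: pair_prob_space \<mu> \<mu> ..
  let ?k = "\<lambda>t z. v z * (cnj t ^ i / (1 - of_real \<rho> * t * cnj z))"
  have \<rho>t: "cmod (of_real \<rho> * t) = \<rho>" if "cmod t = 1" for t
    using \<rho> that by (simp add: norm_mult)
  have kb: "cmod (?k t z) \<le> C / (1 - \<rho>)" if "cmod t = 1" "cmod z = 1" for t z
  proof -
    have "1 - \<rho> \<le> cmod (1 - of_real \<rho> * t * cnj z)"
      using one_minus_cnj_nonzero(2)[of "of_real \<rho> * t" z] \<rho> that by (simp add: \<rho>t)
    then show ?thesis
      using Hinfty_bound[OF v that(2)] \<rho> that Hinfty_nonneg[OF v]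
      by (auto simp: norm_mult norm_divide norm_power intro!: frac_le)
  qed
  have int: "integrable (\<mu> \<Otimes>\<^sub>M \<mu>) (\<lambda>(t, z). ?k t z)"
  proof (rule P.P.integrable_const_bound[where B = "C / (1 - \<rho>)"])
    show "AE x in \<mu> \<Otimes>\<^sub>M \<mu>. cmod (case x of (t, z) \<Rightarrow> ?k t z) \<le> C / (1 - \<rho>)"
      using kb by (intro AE_I2) (auto simp: space_pair_measure)
    have m: "(\<lambda>x. v (snd x)) \<in> borel_measurable (\<mu> \<Otimes>\<^sub>M \<mu>)"
        "(\<lambda>x. cnj (snd x)) \<in> borel_measurable (\<mu> \<Otimes>\<^sub>M \<mu>)"
        "(\<lambda>x. cnj (fst x)) \<in> borel_measurable (\<mu> \<Otimes>\<^sub>M \<mu>)"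
        "(\<lambda>x. fst x) \<in> borel_measurable (\<mu> \<Otimes>\<^sub>M \<mu>)"
      by (intro measurable_compose[OF measurable_snd Hinfty_measurable[OF v]]
          measurable_compose[OF measurable_snd borel_measurable_circleI]
          measurable_compose[OF measurable_fst borel_measurable_circleI]
          borel_measurable_cnj measurable_ident; simp)+
    show "(\<lambda>(t, z). ?k t z) \<in> borel_measurable (\<mu> \<Otimes>\<^sub>M \<mu>)"
      unfolding split_beta
      by (intro borel_measurable_times borel_measurable_divide borel_measurable_diff
          borel_measurable_power borel_measurable_const m)
  qed
  have inner: "(\<E> t. ?k t z) = of_real \<rho> ^ i * (v z * cnj z ^ i)" if z: "cmod z = 1" for z
  proof -
    have "(\<E> t. cnj t ^ i / (1 - of_real \<rho> * t * cnj z))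
        = (\<E> t. cnj (t ^ i / (1 - (of_real \<rho> * z) * cnj t)))"
      by (rule mean_cong) (auto simp: mult_ac)
    also have "\<dots> = cnj (cauchy_ext (\<lambda>t. t ^ i) (of_real \<rho> * z))"
      unfolding cauchy_ext_def by (rule Bochner_Integration.integral_cnj)
    also have "\<dots> = cnj ((of_real \<rho> * z) ^ i)"
      by (subst cauchy_ext_analytic) (use \<rho> z in \<open>auto simp: \<rho>t intro!: analytic_intros\<close>)
    finally have "(\<E> t. cnj t ^ i / (1 - of_real \<rho> * t * cnj z)) = of_real \<rho> ^ i * cnj z ^ i"
      by (simp add: power_mult_distrib)
    moreover have "(\<E> t. ?k t z)
        = v z * (\<E> t. cnj t ^ i / (1 - of_real \<rho> * t * cnj z))"
      by (rule integral_mult_right_zero)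
    ultimately show ?thesis by simp
  qed
  have "(\<E> t. cauchy_ext v (of_real \<rho> * t) * cnj t ^ i)
      = (\<E> t. (\<E> z. ?k t z))"
  proof (rule mean_cong)
    fix t
    have "cauchy_ext v (of_real \<rho> * t) * cnj t ^ i
        = (\<E> z. v z / (1 - of_real \<rho> * t * cnj z) * cnj t ^ i)"
      unfolding cauchy_ext_def by (rule integral_mult_left_zero[symmetric])
    then show "cauchy_ext v (of_real \<rho> * t) * cnj t ^ i = (\<E> z. ?k t z)"
      by simp
  qed simp
  also have "\<dots> = (\<E> z. (\<E> t. ?k t z))"
    using P.Fubini_integral[OF int] by simp
  also have "\<dots> = (\<E> z. of_real \<rho> ^ i * (v z * cnj z ^ i))"
    by (rule mean_cong) (use inner in auto)
  also have "\<dots> = of_real \<rho> ^ i * (\<E> z. v z * cnj z ^ i)"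
    by (rule integral_mult_right_zero)
  finally have eq: "(\<E> t. cauchy_ext v (of_real \<rho> * t) * cnj t ^ i)
      = of_real \<rho> ^ i * (\<E> z. v z * cnj z ^ i)" .
  have "B \<ge> 0" using B[of "of_real \<rho>"] \<rho> by (smt (verit) norm_ge_zero norm_of_real)
  have "cmod (\<E> t. cauchy_ext v (of_real \<rho> * t) * cnj t ^ i) \<le> (\<E> t. B)"
  proof (rule circle_integral_norm_le)
    show "cmod (cauchy_ext v (of_real \<rho> * t) * cnj t ^ i) \<le> B" if "cmod t = 1" for t
      using B \<rho> that by (auto simp: norm_mult norm_power)
  qed auto
  then have "cmod (\<E> t. cauchy_ext v (of_real \<rho> * t) * cnj t ^ i) \<le> B"
    using circle.prob_space by simp
  then show ?thesis
    unfolding eq using \<rho> by (simp add: norm_mult norm_power le_divide_eq mult.commute)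
qed

text \<open>An approximant analytic beyond the circle has an absolutely convergent Taylor series on
  it, which is truncated. The bound \<open>N0\<close> lets the polynomial be as long as
  needed.\<close>

lemma Hinfty_polynomial_approx:
  assumes v: "Hinfty C v" and \<epsilon>: "\<epsilon> > 0"
  shows "\<exists>c N. N0 \<le> N \<and> (\<E> z. cmod (v z - (\<Sum>i<N. c i * z ^ i))) < \<epsilon>"
proof -
  obtain q where q: "q analytic_on cball 0 1" "\<And>x. cmod x \<le> 1 \<Longrightarrow> cmod (q x) \<le> C"
      "(\<E> z. cmod (v z - q z)) < \<epsilon>/2"
    using v \<epsilon> unfolding Hinfty_def by (metis half_gt_zero mem_cball_0)
  obtain R where R: "R > 1" "q holomorphic_on ball (0::complex) R"
    by (rule analytic_on_cball_ball[OF q(1)]) (rule that)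
  define c where "c n = (deriv ^^ n) q 0 / fact n" for n
  have sums: "(\<lambda>n. c n * x ^ n) sums q x" if "cmod x < R" for x
    using holomorphic_power_series[OF R(2), of x] that by (simp add: c_def)
  have "summable (\<lambda>n. norm (c n * 1 ^ n))"
    by (rule powser_insidea[where x = "of_real ((1 + R) / 2)"])
       (use R(1) in \<open>auto intro!: sums_summable[OF sums] simp del: of_real_add of_real_divide\<close>)
  then have sc: "summable (\<lambda>n. cmod (c n))" by simp
  obtain N1 where N1: "\<And>n. n \<ge> N1 \<Longrightarrow> norm (\<Sum>i. cmod (c (i + n))) < \<epsilon> / 2"
    using suminf_exist_split[OF _ sc, of "\<epsilon>/2"] \<epsilon> by auto
  define N where "N = max N0 N1"
  have tail: "cmod (q z - (\<Sum>i<N. c i * z ^ i)) \<le> \<epsilon> / 2" if z: "cmod z = 1" for z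
  proof -
    have s: "(\<lambda>n. c n * z ^ n) sums q z" using sums[of z] z R(1) by simp
    have "(\<lambda>i. c (i + N) * z ^ (i + N)) sums (q z - (\<Sum>i<N. c i * z ^ i))"
      by (rule sums_split_initial_segment[OF s])
    then have "q z - (\<Sum>i<N. c i * z ^ i) = (\<Sum>i. c (i + N) * z ^ (i + N))"
      by (simp add: sums_iff)
    also have "cmod \<dots> \<le> (\<Sum>i. cmod (c (i + N)))"
      using summable_norm[of "\<lambda>i. c (i + N) * z ^ (i + N)"] summable_ignore_initial_segment[OF sc, of N] z
      by (simp add: norm_mult norm_power)
    also have "\<dots> \<le> \<epsilon> / 2" using N1[of N] by (simp add: N_def)
    finally show ?thesis .
  qed
  note [measurable] = Hinfty_measurable[OF v] measurable_analytic_circle[OF q(1)]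
  have pm: "(\<lambda>z. \<Sum>i<N. c i * z ^ i) \<in> borel_measurable \<mu>"
    by (rule borel_measurable_circleI) measurable
  have i1: "integrable \<mu> (\<lambda>z. cmod (v z - q z))"
    by (rule integrable_circle_diff[where C = C and D = C]) (use Hinfty_bound[OF v] q(2) in auto)
  have i2: "integrable \<mu> (\<lambda>z. cmod (v z - (\<Sum>i<N. c i * z ^ i)))"
  proof (rule integrable_circle[where C = "C + (C + \<epsilon>/2)"])
    fix z :: complex assume z: "cmod z = 1"
    have "v z - (\<Sum>i<N. c i * z ^ i) = v z + (- q z + (q z - (\<Sum>i<N. c i * z ^ i)))" by simp
    also have "cmod \<dots> \<le> C + (C + \<epsilon>/2)"
      using Hinfty_bound[OF v z] q(2)[of z] z tail[OF z]
      by (intro order_trans[OF norm_triangle_ineq] add_mono order_trans[OF norm_triangle_ineq]) auto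
    finally show "norm (cmod (v z - (\<Sum>i<N. c i * z ^ i))) \<le> C + (C + \<epsilon>/2)" by simp
  qed (use pm in measurable)
  have "(\<E> z. cmod (v z - (\<Sum>i<N. c i * z ^ i))) \<le> (\<E> z. cmod (v z - q z) + \<epsilon>/2)"
  proof (rule integral_mono)
    fix z assume "z \<in> space \<mu>"
    then show "cmod (v z - (\<Sum>i<N. c i * z ^ i)) \<le> cmod (v z - q z) + \<epsilon>/2"
      using tail[of z] dist_triangle[of "v z" "\<Sum>i<N. c i * z ^ i" "q z"] by (simp add: dist_norm)
  qed (use i1 i2 in auto)
  also have "\<dots> < \<epsilon>" using i1 q(3) circle.prob_space by simp
  finally show ?thesis by (intro exI[of _ c] exI[of _ N]) (auto simp: N_def)
qed

lemma integral_Hinfty_power: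
  assumes "Hinfty 1 v"
  shows "(\<E> z. v z ^ n) = cauchy_ext v 0 ^ n"
  using Hinfty_power(2)[OF assms, of 0] by (simp add: cauchy_ext_0)

lemma integral_monomials:
  "(\<E> z. z ^ j * cnj z ^ i) = (if i = j then 1 else 0)"
proof -
  have le: "(\<E> z. z ^ j * cnj z ^ i) = (if i = j then 1 else 0)" if "i \<le> j" for i j
  proof -
    have "(\<E> z. z ^ j * cnj z ^ i) = (\<E> z. z ^ (j - i))"
    proof (rule mean_cong)
      fix z assume "z \<in> space \<mu>"
      then have "z ^ j * cnj z ^ i = z ^ (j - i) * (z * cnj z) ^ i"
        using that by (simp add: power_mult_distrib flip: power_add mult.assoc)
      then show "z ^ j * cnj z ^ i = z ^ (j - i)" using circle_cnj[of z] \<open>z \<in> space \<mu>\<close> by simp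
    qed simp
    also have "\<dots> = 0 ^ (j - i)"
      using integral_Hinfty_power[OF Hinfty_id] cauchy_ext_ident[of 0] by simp
    finally show ?thesis using that by auto
  qed
  show ?thesis
  proof (cases "i \<le> j")
    case False
    have "(\<E> z. z ^ j * cnj z ^ i) = cnj (\<E> z. z ^ i * cnj z ^ j)"
      by (subst Bochner_Integration.integral_cnj[symmetric]) (simp add: mult.commute)
    then show ?thesis using le[of j i] False by simp
  qed (rule le)
qed

text \<open>Only the Taylor coefficients of \<open>v\<close> of order below \<open>p\<close> survive: the remaining part of
  \<open>u\<^sup>p (cnj \<circ> v \<circ> u)\<close> is anti-analytic, hence orthogonal to \<open>z\<^sup>p\<close>.\<close>

lemma mixed_correlation_bound:
  assumes u: "Hinfty 1 u" and u1: "\<And>z. cmod z = 1 \<Longrightarrow> cmod (u z) = 1"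
    and u0: "cauchy_ext u 0 = 0" and v: "Hinfty 1 v" and p: "p \<ge> 1"
  shows "cmod (\<E> z. (u z * cnj z) ^ p * cnj (v (u z)))
    \<le> (\<Sum>i<p. cmod (\<E> z. v z * cnj z ^ i) * cmod (\<E> z. u z ^ (p - i) * cnj z ^ p))"
    (is "cmod ?A \<le> (\<Sum>i<p. cmod (?d i) * cmod (?e i))")
proof (rule field_le_epsilon)
  fix \<epsilon>' :: real assume "\<epsilon>' > 0"
  \<comment> \<open>The error budget: one \<open>\<epsilon>\<close> for replacing \<open>v\<close>
    by a polynomial inside the integral, and one for each of the \<open>p\<close> coefficients that
    remain.\<close>
  define \<epsilon> where "\<epsilon> = \<epsilon>' / (real p + 1)"
  have "real p + 1 \<noteq> 0" by linarith
  then have "(real p + 1) * \<epsilon> = \<epsilon>'" by (simp add: \<epsilon>_def)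
  then have \<epsilon>p: "real p * \<epsilon> + \<epsilon> = \<epsilon>'" by (simp add: distrib_right)
  have \<epsilon>: "\<epsilon> > 0" using \<open>\<epsilon>' > 0\<close> by (simp add: \<epsilon>_def)
  obtain c N where N: "p \<le> N" and c: "(\<E> z. cmod (v z - (\<Sum>i<N. c i * z ^ i))) < \<epsilon>"
    using Hinfty_polynomial_approx[OF v \<epsilon>] by blast
  define P where "P z = (\<Sum>i<N. c i * z ^ i)" for z
  note [measurable] = Hinfty_measurable[OF v] Hinfty_measurable[OF u]
    distr_circle_eq(1)[OF u u1 u0]
  have Pm [measurable]: "P \<in> borel_measurable \<mu>"
    unfolding P_def by (rule borel_measurable_circleI) measurable
  have vum [measurable]: "(\<lambda>z. v (u z)) \<in> borel_measurable \<mu>"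
    by (rule measurable_compose[OF distr_circle_eq(1)[OF u u1 u0] Hinfty_measurable[OF v]])
  have Pum [measurable]: "(\<lambda>z. P (u z)) \<in> borel_measurable \<mu>"
    by (rule measurable_compose[OF distr_circle_eq(1)[OF u u1 u0] Pm])
  have cz [measurable]: "(\<lambda>z. cnj z) \<in> borel_measurable \<mu>"
    by (rule borel_measurable_circleI) measurable
  define K where "K = (\<Sum>i<N. cmod (c i))"
  have PK: "cmod (P z) \<le> K" if "cmod z = 1" for z
    unfolding P_def K_def using that
    by (intro order_trans[OF norm_sum] sum_mono) (simp add: norm_mult norm_power)
  have v1: "cmod (v z) \<le> 1" if "cmod z = 1" for z by (rule Hinfty_bound[OF v that])
  have iP: "integrable \<mu> (\<lambda>z. (u z * cnj z) ^ p * cnj (P (u z)))"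
    by (rule integrable_circle[where C = K]) (use u1 PK in \<open>auto simp: norm_mult norm_power\<close>)
  have iv: "integrable \<mu> (\<lambda>z. (u z * cnj z) ^ p * cnj (v (u z)))"
    by (rule integrable_circle[where C = 1]) (use u1 v1 in \<open>auto simp: norm_mult norm_power\<close>)
  have ivP: "integrable \<mu> (\<lambda>z. cmod (v z - P z))"
    by (rule integrable_circle_diff[where C = 1 and D = K]) (use v1 PK in auto)
  have dc: "cmod (?d i - c i) < \<epsilon>" if "i < N" for i
  proof -
    have "(\<E> z. P z * cnj z ^ i) = (\<E> z. (\<Sum>j<N. c j * (z ^ j * cnj z ^ i)))"
      by (simp add: P_def sum_distrib_right mult.assoc)
    also have "\<dots> = (\<Sum>j<N. c j * (\<E> z. z ^ j * cnj z ^ i))"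
      by (subst Bochner_Integration.integral_sum)
         (auto intro!: Bochner_Integration.integrable_mult_right integrable_circle[where C = 1] simp: norm_mult norm_power)
    also have "\<dots> = c i"
      using that by (simp add: integral_monomials if_distrib[of "(*) _"] cong: if_cong)
    finally have ci: "c i = (\<E> z. P z * cnj z ^ i)" by simp
    have "?d i - c i = (\<E> z. (v z - P z) * cnj z ^ i)"
      unfolding ci left_diff_distrib
    proof (rule Bochner_Integration.integral_diff[symmetric])
      show "integrable \<mu> (\<lambda>z. v z * cnj z ^ i)"
        by (rule integrable_circle[where C = 1]) (auto simp: norm_mult norm_power v1)
      show "integrable \<mu> (\<lambda>z. P z * cnj z ^ i)"
        by (rule integrable_circle[where C = K]) (auto simp: norm_mult norm_power PK)
    qed
    also have "cmod \<dots> \<le> (\<E> z. cmod (v z - P z))"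
      by (rule circle_integral_norm_le)
         (use ivP in \<open>auto simp: norm_mult norm_power\<close>)
    finally show ?thesis using c by (simp add: P_def)
  qed
  have ie: "integrable \<mu> (\<lambda>z. (u z * cnj z) ^ p * cnj (u z) ^ i)" for i
    by (rule integrable_circle[where C = 1]) (use u1 in \<open>auto simp: norm_mult norm_power\<close>)
  have term_lt: "(\<E> z. (u z * cnj z) ^ p * cnj (u z) ^ i) = ?e i" if "i < p" for i
  proof (rule mean_cong)
    fix z assume "z \<in> space \<mu>"
    then have "cmod (u z) = 1" using u1 by simp
    have "(u z * cnj z) ^ p * cnj (u z) ^ i = u z ^ (p - i) * (u z * cnj (u z)) ^ i * cnj z ^ p"
      using that by (simp add: power_mult_distrib mult_ac flip: power_add)
    then show "(u z * cnj z) ^ p * cnj (u z) ^ i = u z ^ (p - i) * cnj z ^ p"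
      using circle_cnj[OF \<open>cmod (u z) = 1\<close>] by simp
  qed simp
  have term_ge: "(\<E> z. (u z * cnj z) ^ p * cnj (u z) ^ i) = 0" if "i \<ge> p" for i
  proof -
    have "(\<E> z. (u z * cnj z) ^ p * cnj (u z) ^ i)
        = (\<E> z. cnj (z ^ p * u z ^ (i - p)))"
    proof (rule mean_cong)
      fix z assume "z \<in> space \<mu>"
      then have "cmod (u z) = 1" using u1 by simp
      have "cnj (u z) ^ i = cnj (u z) ^ p * cnj (u z) ^ (i - p)"
        using that by (simp flip: power_add)
      then have "(u z * cnj z) ^ p * cnj (u z) ^ i = (u z * cnj (u z)) ^ p * (cnj z ^ p * cnj (u z) ^ (i - p))"
        by (simp add: power_mult_distrib mult_ac)
      then show "(u z * cnj z) ^ p * cnj (u z) ^ i = cnj (z ^ p * u z ^ (i - p))"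
        using circle_cnj[OF \<open>cmod (u z) = 1\<close>] by simp
    qed simp
    also have "\<dots> = cnj (cauchy_ext (\<lambda>z. z ^ p * u z ^ (i - p)) 0)"
      by (simp add: cauchy_ext_0 Bochner_Integration.integral_cnj del: complex_cnj_mult)
    also have "cauchy_ext (\<lambda>z. z ^ p * u z ^ (i - p)) 0 = 0"
      using Hinfty_mult(2)[OF Hinfty_power(1)[OF Hinfty_id]
          Hinfty_power(1)[OF u], of 0 p "i - p"] p
      by (simp add: Hinfty_power(2)[OF Hinfty_id] cauchy_ext_ident)
    finally show ?thesis by simp
  qed
  have e1: "cmod (?e i) \<le> 1" for i
  proof -
    have "cmod (?e i) \<le> (\<E> z. 1)"
      by (rule circle_integral_norm_le) (use u1 in \<open>auto simp: norm_mult norm_power\<close>)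
    then show ?thesis using circle.prob_space by simp
  qed
  have "(\<E> z. (u z * cnj z) ^ p * cnj (P (u z)))
      = (\<E> z. (\<Sum>i<N. cnj (c i) * ((u z * cnj z) ^ p * cnj (u z) ^ i)))"
    by (simp add: P_def sum_distrib_left mult_ac)
  also have "\<dots> = (\<Sum>i<N. cnj (c i) * (\<E> z. (u z * cnj z) ^ p * cnj (u z) ^ i))"
    by (subst Bochner_Integration.integral_sum) (auto intro!: Bochner_Integration.integrable_mult_right ie)
  also have "\<dots> = (\<Sum>i<p. cnj (c i) * ?e i)"
    by (rule sum.mono_neutral_cong_right) (use N term_lt term_ge in auto)
  finally have PA: "(\<E> z. (u z * cnj z) ^ p * cnj (P (u z))) = (\<Sum>i<p. cnj (c i) * ?e i)" .
  have "?A - (\<Sum>i<p. cnj (c i) * ?e i) = (\<E> z. (u z * cnj z) ^ p * cnj (v (u z) - P (u z)))"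
    unfolding PA[symmetric] complex_cnj_diff right_diff_distrib
    by (rule Bochner_Integration.integral_diff[symmetric, OF iv iP])
  also have "cmod \<dots> \<le> (\<E> z. cmod (v (u z) - P (u z)))"
    by (rule circle_integral_norm_le)
       (use u1 in \<open>auto intro!: integrable_circle_diff[where C = 1 and D = K] v1 PK simp: norm_mult norm_power simp del: complex_cnj_diff\<close>)
  \<comment> \<open>Invariance of arc length under \<open>u\<close> turns the error along
    \<open>u\<close> into that of the polynomial approximation itself.\<close>
  also have "\<dots> = (\<integral>z. cmod (v z - P z) \<partial>distr \<mu> \<mu> u)"
    by (rule integral_distr[symmetric, OF distr_circle_eq(1)[OF u u1 u0]]) measurable
  also have "\<dots> < \<epsilon>" using c by (simp add: distr_circle_eq(2)[OF u u1 u0] P_def)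
  finally have "cmod (?A - (\<Sum>i<p. cnj (c i) * ?e i)) < \<epsilon>" .
  then have "cmod ?A \<le> cmod (\<Sum>i<p. cnj (c i) * ?e i) + \<epsilon>"
    using norm_triangle_ineq2[of ?A "\<Sum>i<p. cnj (c i) * ?e i"] by simp
  also have "cmod (\<Sum>i<p. cnj (c i) * ?e i) \<le> (\<Sum>i<p. cmod (?d i) * cmod (?e i) + \<epsilon>)"
  proof (rule order_trans[OF norm_sum sum_mono])
    fix i assume "i \<in> {..<p}"
    then have "cmod (c i) \<le> cmod (?d i) + \<epsilon>"
      using dc[of i] N norm_triangle_ineq3[of "c i" "?d i"] by (simp add: norm_minus_commute)
    then have "cmod (c i) * cmod (?e i) \<le> (cmod (?d i) + \<epsilon>) * cmod (?e i)"
      by (rule mult_right_mono) simp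
    also have "\<dots> \<le> cmod (?d i) * cmod (?e i) + \<epsilon>"
      using mult_left_mono[OF e1[of i], of \<epsilon>] \<epsilon> by (simp add: distrib_right)
    finally show "cmod (cnj (c i) * ?e i) \<le> cmod (?d i) * cmod (?e i) + \<epsilon>"
      by (simp add: norm_mult)
  qed
  also have "(\<Sum>i<p. cmod (?d i) * cmod (?e i) + \<epsilon>) + \<epsilon> = (\<Sum>i<p. cmod (?d i) * cmod (?e i)) + \<epsilon>'"
    using \<epsilon>p by (simp add: sum.distrib)
  finally show "cmod ?A \<le> (\<Sum>i<p. cmod (?d i) * cmod (?e i)) + \<epsilon>'" by simp
qed

section \<open>Decay of correlations\<close>

lemma geometric_partial_sum_le:
  fixes x :: real
  assumes "0 \<le> x" "x < 1"
  shows "(\<Sum>k<K. x ^ k) \<le> 1 / (1 - x)"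
proof -
  have "(\<Sum>k<K. x ^ k) = (1 - x ^ K) / (1 - x)"
    using geometric_sum[of x K] assms by (simp add: divide_simps) (simp add: algebra_simps)
  also have "\<dots> \<le> 1 / (1 - x)" using assms by (intro divide_right_mono) auto
  finally show ?thesis .
qed

text \<open>Telescoping against a discrete antiderivative: \<open>h\<close> copies the integral of
  \<open>y^2 exp (- s y)\<close> over \<open>y \<ge> k\<close>, which is \<open>exp (- s k)\<close>
  times the same bracket.\<close>

lemma square_geometric_partial_sum_le:
  fixes x :: real
  assumes "0 \<le> x" "x < 1"
  shows "(\<Sum>k<K. (real k)\<^sup>2 * x ^ k) \<le> 2 / (1 - x) ^ 3"
proof -
  define s where "s = 1 - x"
  have s: "s > 0" "x = 1 - s" using assms by (auto simp: s_def)
  define h where "h k = x ^ k * ((real k)\<^sup>2 / s + 2 * real k / s\<^sup>2 + 2 / s ^ 3)" for k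
  have step: "(real k)\<^sup>2 * x ^ k \<le> h k - h (Suc k)" for k
  proof -
    have "h k - h (Suc k) = x ^ k * ((real k + 1)\<^sup>2 + 1 / s)"
      unfolding h_def power_Suc s(2) using s(1)
      by (simp add: field_simps power2_eq_square power3_eq_cube)
    moreover have "(real k)\<^sup>2 * x ^ k \<le> x ^ k * ((real k + 1)\<^sup>2 + 1 / s)"
      using assms s by (subst mult.commute, intro mult_left_mono) (auto simp: power2_eq_square algebra_simps)
    ultimately show ?thesis by simp
  qed
  have "(\<Sum>k<K. (real k)\<^sup>2 * x ^ k) \<le> (\<Sum>k<K. h k - h (Suc k))"
    by (intro sum_mono step)
  also have "\<dots> = h 0 - h K" by (rule sum_lessThan_telescope')
  also have "\<dots> \<le> h 0" using assms s by (simp add: h_def)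
  finally show ?thesis by (simp add: h_def s_def)
qed

text \<open>The positive frequencies of the Poisson kernel, that is, the sum of
  \<open>(\<rho> x) ^ j\<close> over \<open>j \<ge> 1\<close>; unlike the kernel itself it is
  analytic in \<open>x\<close>.\<close>

definition geometric :: "real \<Rightarrow> complex \<Rightarrow> complex" where
  "geometric \<rho> x = of_real \<rho> * x / (1 - of_real \<rho> * x)"

lemma poisson_geometric:
  assumes "0 \<le> \<rho>" "\<rho> < 1" "cmod x \<le> 1"
  shows "poisson \<rho> x = 1 + 2 * Re (geometric \<rho> x)"
proof -
  have "(1 + of_real \<rho> * x) / (1 - of_real \<rho> * x) = 1 + 2 * geometric \<rho> x"
    using poisson_denominator(2)[OF assms] by (simp add: geometric_def field_simps)
  then show ?thesis by (simp add: poisson_def)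
qed

lemma geometric_bound:
  assumes "0 \<le> \<rho>" "\<rho> < 1" "cmod x \<le> 1"
  shows "cmod (geometric \<rho> x) \<le> 1 / (1 - \<rho>)"
  unfolding geometric_def norm_divide
  using poisson_denominator[OF assms] assms by (intro frac_le) (auto simp: norm_mult mult_le_one)

lemma geometric_analytic:
  assumes "0 \<le> \<rho>" "\<rho> < 1"
  shows "geometric \<rho> analytic_on cball 0 1"
  unfolding geometric_def using poisson_denominator(2)[OF assms]
  by (intro analytic_intros) auto

lemma geometric_partial_sums:
  assumes "0 \<le> \<rho>" "\<rho> < 1" "cmod x \<le> 1"
  shows "(\<lambda>K. \<Sum>j<K. of_real \<rho> ^ Suc j * x ^ Suc j) \<longlonglongrightarrow> geometric \<rho> x"
    and "cmod (\<Sum>j<K. of_real \<rho> ^ Suc j * x ^ Suc j) \<le> 1 / (1 - \<rho>)"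
proof -
  have w: "cmod (of_real \<rho> * x) \<le> \<rho>" using assms by (simp add: norm_mult mult_left_le)
  then have "(\<lambda>j. (of_real \<rho> * x) * (of_real \<rho> * x) ^ j) sums ((of_real \<rho> * x) * (1 / (1 - of_real \<rho> * x)))"
    using assms by (intro sums_mult geometric_sums) simp
  then show "(\<lambda>K. \<Sum>j<K. of_real \<rho> ^ Suc j * x ^ Suc j) \<longlonglongrightarrow> geometric \<rho> x"
    by (simp add: sums_def geometric_def power_mult_distrib mult_ac)
  have "cmod (\<Sum>j<K. of_real \<rho> ^ Suc j * x ^ Suc j) \<le> (\<Sum>j<K. \<rho> ^ j)"
  proof (intro order_trans[OF norm_sum] sum_mono)
    fix j
    have "cmod (of_real \<rho> ^ Suc j * x ^ Suc j) = \<rho> ^ Suc j * cmod x ^ Suc j"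
      using assms by (simp only: norm_mult norm_power norm_of_real abs_of_nonneg)
    also have "\<dots> \<le> \<rho> ^ Suc j * 1"
      using assms power_le_one[of "cmod x" "Suc j"] by (intro mult_left_mono) auto
    also have "\<dots> \<le> \<rho> ^ j" using assms by (simp add: mult_left_le_one_le)
    finally show "cmod (of_real \<rho> ^ Suc j * x ^ Suc j) \<le> \<rho> ^ j" .
  qed
  also have "\<dots> \<le> 1 / (1 - \<rho>)" by (rule geometric_partial_sum_le[OF assms(1,2)])
  finally show "cmod (\<Sum>j<K. of_real \<rho> ^ Suc j * x ^ Suc j) \<le> 1 / (1 - \<rho>)" .
qed

context centred_inner
begin

abbreviation \<alpha> :: real where "\<alpha> \<equiv> cmod (deriv f 0)"

text \<open>The square root converts decay in the larger of two times into decay in their sum, as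
  \<open>max m l \<ge> (m + l) / 2\<close>.\<close>

definition \<sigma> :: real where "\<sigma> = sqrt rate"

lemma \<sigma>: "0 < \<sigma>" "\<sigma> < 1" "rate \<le> \<sigma>" "\<alpha> \<le> \<sigma>" "\<sigma>\<^sup>2 = rate"
proof -
  show "0 < \<sigma>" "\<sigma> < 1" "\<sigma>\<^sup>2 = rate" using rate by (auto simp: \<sigma>_def)
  then show "rate \<le> \<sigma>" by (metis less_eq_real_def mult_left_le power2_eq_square)
  then show "\<alpha> \<le> \<sigma>" using rate(3) by simp
qed

lemma rate_max_le: "rate ^ max m l \<le> \<sigma> ^ (m + l)"
proof -
  have "rate ^ max m l = \<sigma> ^ (2 * max m l)" by (simp add: power_mult \<sigma>(5))
  also have "\<dots> \<le> \<sigma> ^ (m + l)" using \<sigma>(1,2) by (intro power_decreasing) auto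
  finally show ?thesis .
qed

lemma return_interior_bound:
  assumes \<rho>: "0 < \<rho>" "\<rho> < 1" and x: "cmod x = \<rho>"
  shows "cmod (cauchy_ext (return 0 l) x) \<le> rate ^ l / (1 - \<rho>)"
    and "cmod (cauchy_ext (return 0 l) x) \<le> 1"
proof -
  have "\<rho> * cmod (cauchy_ext (return 0 l) x) \<le> rate ^ l * (\<rho> / (1 - \<rho>))"
    using funpow_contracts[of x l] funpow_quotient[of x l] \<rho> x by (simp add: norm_mult)
  then have "\<rho> * cmod (cauchy_ext (return 0 l) x) \<le> \<rho> * (rate ^ l / (1 - \<rho>))"
    by (simp add: mult_ac)
  then show "cmod (cauchy_ext (return 0 l) x) \<le> rate ^ l / (1 - \<rho>)"
    using \<rho>(1) by (simp only: mult_le_cancel_left_pos)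
  show "cmod (cauchy_ext (return 0 l) x) \<le> 1"
    by (rule cauchy_ext_bound[OF return_boundary(1)]) (use \<rho> x in simp)
qed

lemma exp_bound_power: "(1 + 1 / real p) ^ p \<le> 3" if "p \<ge> 1" for p :: nat
proof -
  have "(1 + 1 / real p) ^ p \<le> exp (1 / real p) ^ p"
    by (intro power_mono exp_ge_add_one_self) auto
  also have "\<dots> = exp 1" using that by (simp flip: exp_of_nat_mult)
  also have "\<dots> \<le> 3" by (rule exp_le)
  finally show ?thesis .
qed

text \<open>Each summand of \<open>mixed_correlation_bound\<close> is a Taylor coefficient of the
  \<open>k\<close>-th power of \<open>(f ^^ l) x / x\<close> times one of a power of
  \<open>f ^^ m\<close>. Cauchy's estimate at a common radius makes the factor belonging to the
  larger of \<open>l\<close> and \<open>m\<close> small and keeps the other bounded;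
  \<open>p\<close> such terms, each carrying a factor \<open>p + 1\<close>, give the square.\<close>

lemma off_diagonal_correlation:
  assumes p: "p \<ge> 1" and k: "k \<ge> 1"
  shows "cmod (\<E> z. ((T ^^ m) z * cnj z) ^ p * cnj (return 0 l ((T ^^ m) z) ^ k))
    \<le> 18 * (real p)\<^sup>2 * \<sigma> ^ (m + l)"
proof -
  \<comment> \<open>This radius balances the two losses in Cauchy's estimate:
    \<open>1 / (1 - \<rho>)\<close> is only \<open>p + 1\<close>, and
    \<open>(1 / \<rho>) ^ p\<close> is at most 3.\<close>
  define \<rho> where "\<rho> = real p / (real p + 1)"
  have \<rho>: "0 < \<rho>" "\<rho> < 1" using p by (auto simp: \<rho>_def)
  have \<rho>': "1 / (1 - \<rho>) = real p + 1" "1 / \<rho> = 1 + 1 / real p"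
    using p by (auto simp: \<rho>_def field_simps)
  have inv: "1 \<le> 1 / \<rho>" using \<rho> by simp
  have \<rho>p: "(1 / \<rho>) ^ i \<le> 3" if "i \<le> p" for i
    using order_trans[OF power_increasing[OF that inv] exp_bound_power[OF p, folded \<rho>'(2)]] .
  define K where "K = rate ^ max m l * (real p + 1)"
  note v = Hinfty_power(1)[OF return_boundary(1)[of 0 l], of k]
  note u = funpow_boundary(1)[of m]
  have ev: "cmod (cauchy_ext (\<lambda>z. return 0 l z ^ k) x) \<le> rate ^ l * (real p + 1)"
      "cmod (cauchy_ext (\<lambda>z. return 0 l z ^ k) x) \<le> 1" if x: "cmod x = \<rho>" for x
  proof -
    have e: "cmod (cauchy_ext (\<lambda>z. return 0 l z ^ k) x) = cmod (cauchy_ext (return 0 l) x) ^ k"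
      using Hinfty_power(2)[OF return_boundary(1), of x 0 l k] x \<rho> by (simp add: norm_power)
    have "cmod (cauchy_ext (return 0 l) x) ^ k \<le> cmod (cauchy_ext (return 0 l) x) ^ 1"
      using return_interior_bound(2)[OF \<rho> x] k by (intro power_decreasing) auto
    then show "cmod (cauchy_ext (\<lambda>z. return 0 l z ^ k) x) \<le> rate ^ l * (real p + 1)"
      "cmod (cauchy_ext (\<lambda>z. return 0 l z ^ k) x) \<le> 1"
      unfolding e using return_interior_bound[OF \<rho> x, of l] \<rho>'(1) by (auto simp: divide_inverse)
  qed
  have eu: "cmod (cauchy_ext (\<lambda>z. (T ^^ m) z ^ q) x) \<le> rate ^ m * (real p + 1)"
      "cmod (cauchy_ext (\<lambda>z. (T ^^ m) z ^ q) x) \<le> 1" if x: "cmod x = \<rho>" and q: "q \<ge> 1" for x q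
  proof -
    have x1: "cmod x < 1" using x \<rho> by simp
    have e: "cmod (cauchy_ext (\<lambda>z. (T ^^ m) z ^ q) x) = cmod ((f ^^ m) x) ^ q"
      using Hinfty_power(2)[OF u x1, of q] funpow_boundary(2)[OF x1, of m] by (simp add: norm_power)
    have "cmod ((f ^^ m) x) ^ q \<le> cmod ((f ^^ m) x) ^ 1"
      using funpow_less_1[OF x1, of m] q by (intro power_decreasing) auto
    moreover have "rate ^ m * (cmod x / (1 - cmod x)) \<le> rate ^ m * (real p + 1)"
      using rate(1) \<rho> \<rho>'(1) x by (intro mult_left_mono) (auto simp: divide_le_eq field_simps)
    ultimately show "cmod (cauchy_ext (\<lambda>z. (T ^^ m) z ^ q) x) \<le> rate ^ m * (real p + 1)"
      "cmod (cauchy_ext (\<lambda>z. (T ^^ m) z ^ q) x) \<le> 1"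
      unfolding e using funpow_contracts[OF x1, of m] funpow_less_1[OF x1, of m] by auto
  qed
  define d where "d i = cmod (\<E> z. return 0 l z ^ k * cnj z ^ i)" for i
  define e where "e i = cmod (\<E> z. (T ^^ m) z ^ (p - i) * cnj z ^ p)" for i
  have de: "d i * e i \<le> 9 * K" if i: "i < p" for i
  proof -
    have d1: "d i \<le> B * 3" if "\<And>x. cmod x = \<rho> \<Longrightarrow> cmod (cauchy_ext (\<lambda>z. return 0 l z ^ k) x) \<le> B" "0 \<le> B" for B
    proof -
      have "d i \<le> B / \<rho> ^ i" unfolding d_def by (rule fourier_coefficient_bound[OF v \<rho> that(1)])
      also have "\<dots> = B * (1 / \<rho>) ^ i" by (simp add: power_divide)
      also have "\<dots> \<le> B * 3" using \<rho>p[of i] i that(2) by (intro mult_left_mono) auto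
      finally show ?thesis .
    qed
    have e1: "e i \<le> B * 3" if "\<And>x. cmod x = \<rho> \<Longrightarrow> cmod (cauchy_ext (\<lambda>z. (T ^^ m) z ^ (p - i)) x) \<le> B" "0 \<le> B" for B
    proof -
      have "e i \<le> B / \<rho> ^ p" unfolding e_def
        by (rule fourier_coefficient_bound[OF Hinfty_power(1)[OF u] \<rho> that(1)])
      also have "\<dots> = B * (1 / \<rho>) ^ p" by (simp add: power_divide)
      also have "\<dots> \<le> B * 3" using \<rho>p[of p] that(2) by (intro mult_left_mono) auto
      finally show ?thesis .
    qed
    have de0: "0 \<le> d i" "0 \<le> e i" by (auto simp: d_def e_def)
    have i1: "p - i \<ge> 1" using i by simp
    show ?thesis
    proof (cases "m \<le> l")
      case True
      have "d i * e i \<le> (rate ^ l * (real p + 1) * 3) * (1 * 3)"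
        using d1[OF ev(1)] e1[OF eu(2)[OF _ i1]] de0 rate(1) by (intro mult_mono) auto
      then show ?thesis using True by (simp add: K_def max_def mult_ac)
    next
      case False
      have "d i * e i \<le> (1 * 3) * (rate ^ m * (real p + 1) * 3)"
        using d1[OF ev(2)] e1[OF eu(1)[OF _ i1]] de0 rate(1) by (intro mult_mono) auto
      then show ?thesis using False by (simp add: K_def max_def mult_ac)
    qed
  qed
  have "cauchy_ext (T ^^ m) 0 = 0" using funpow_boundary(2)[of 0 m] by simp
  from mixed_correlation_bound[OF u funpow_unit this v p]
  have "cmod (\<E> z. ((T ^^ m) z * cnj z) ^ p * cnj (return 0 l ((T ^^ m) z) ^ k))
     \<le> (\<Sum>i<p. d i * e i)" by (simp add: d_def e_def)
  also have "\<dots> \<le> (\<Sum>i<p. 9 * K)" by (intro sum_mono de) auto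
  also have "\<dots> = (9 * real p * (real p + 1)) * rate ^ max m l" by (simp add: K_def)
  also have "\<dots> \<le> (18 * (real p)\<^sup>2) * \<sigma> ^ (m + l)"
  proof (rule mult_mono[OF _ rate_max_le])
    have "real p * 1 \<le> real p * real p" using p by (intro mult_left_mono) auto
    then show "9 * real p * (real p + 1) \<le> 18 * (real p)\<^sup>2" by (simp add: algebra_simps power2_eq_square)
  qed (use rate(1) in auto)
  finally show ?thesis .
qed

lemma return_compose: "return m l z = return 0 l ((T ^^ m) z)"
proof -
  have "(T ^^ (m + l)) z = (T ^^ l) ((T ^^ m) z)" by (simp add: add.commute funpow_add)
  then show ?thesis by (simp add: return_def)
qed

lemma return_0_add:
  assumes "cmod z = 1"
  shows "cnj (return 0 m z) * return 0 (m + l) z = return m l z"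
  using circle_cnj(2)[OF assms] by (simp add: return_def mult_ac)

text \<open>On the circle \<open>cnj (return 0 m z) * return 0 (m + l) z\<close> is
  \<open>return m l z\<close>. If \<open>J \<le> k\<close>, all conjugates are absorbed this way and
  the mean is a product of powers of \<open>deriv f 0\<close>, which for \<open>J < k\<close>
  already fits into the second term. If \<open>J > k\<close>, there are \<open>p = J - k\<close>
  conjugates left over and \<open>off_diagonal_correlation\<close> applies.\<close>

lemma return_correlation:
  assumes J: "J \<ge> 1" and k: "k \<ge> 1"
  shows "cmod (\<E> z. cnj (return 0 m z) ^ J * return 0 (m + l) z ^ k)
    \<le> (if J = k then \<alpha> ^ (l * k) else 0) + 18 * (real J)\<^sup>2 * \<sigma> ^ (m + l)"
proof (cases "J \<le> k")
  case True
  have "(\<E> z. cnj (return 0 m z) ^ J * return 0 (m + l) z ^ k)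
      = (\<E> z. return m l z ^ J * return 0 (m + l) z ^ (k - J))"
  proof (rule mean_cong)
    fix z assume "z \<in> space \<mu>"
    then have z: "cmod z = 1" by simp
    have "return 0 (m + l) z ^ k = return 0 (m + l) z ^ J * return 0 (m + l) z ^ (k - J)"
      using True by (simp flip: power_add)
    then show "cnj (return 0 m z) ^ J * return 0 (m + l) z ^ k = return m l z ^ J * return 0 (m + l) z ^ (k - J)"
      by (simp add: return_0_add[OF z, of m l, symmetric] power_mult_distrib)
  qed simp
  also have "\<dots> = (deriv f 0 ^ l) ^ J * (deriv f 0 ^ (m + l)) ^ (k - J)"
    using Hinfty_mult(2)[OF Hinfty_power(1)[OF return_boundary(1)]
        Hinfty_power(1)[OF return_boundary(1)], of 0 m l J 0 "m + l" "k - J"]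
    by (simp add: Hinfty_power(2)[OF return_boundary(1)] return_boundary(2) flip: cauchy_ext_0)
  finally have eq: "cmod (\<E> z. cnj (return 0 m z) ^ J * return 0 (m + l) z ^ k)
      = \<alpha> ^ (l * J) * \<alpha> ^ ((m + l) * (k - J))"
    by (simp add: norm_mult norm_power power_mult)
  show ?thesis
  proof (cases "J = k")
    case True
    then show ?thesis unfolding eq using \<sigma>(1) by simp
  next
    case False
    then have kJ: "k - J \<ge> 1" using \<open>J \<le> k\<close> by simp
    have "\<alpha> ^ (l * J) * \<alpha> ^ ((m + l) * (k - J)) \<le> 1 * \<alpha> ^ (m + l)"
      using deriv_less_1 kJ by (intro mult_mono power_le_one power_decreasing) auto
    also have "\<dots> \<le> 1 * \<sigma> ^ (m + l)" using \<sigma>(4) by (intro mult_left_mono power_mono) auto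
    also have "\<dots> \<le> 18 * (real J)\<^sup>2 * \<sigma> ^ (m + l)"
    proof (rule mult_right_mono)
      have "1 \<le> (real J)\<^sup>2" using J by (intro one_le_power) simp
      then show "1 \<le> 18 * (real J)\<^sup>2" by linarith
    qed (use \<sigma>(1) in simp)
    finally show ?thesis unfolding eq using False by simp
  qed
next
  case False
  define p where "p = J - k"
  have p: "p \<ge> 1" "J = p + k" using False by (auto simp: p_def)
  have "(\<E> z. cnj (return 0 m z) ^ J * return 0 (m + l) z ^ k)
      = (\<E> z. cnj (((T ^^ m) z * cnj z) ^ p * cnj (return 0 l ((T ^^ m) z) ^ k)))"
  proof (rule mean_cong)
    fix z assume "z \<in> space \<mu>"
    then have z: "cmod z = 1" by simp
    have "cnj (return 0 m z) ^ J * return 0 (m + l) z ^ k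
      = cnj (return 0 m z) ^ p * (cnj (return 0 m z) * return 0 (m + l) z) ^ k"
      by (simp add: p(2) power_add power_mult_distrib)
    also have "\<dots> = cnj (return 0 m z) ^ p * return 0 l ((T ^^ m) z) ^ k"
      by (simp add: return_0_add[OF z] return_compose[of m])
    finally show "cnj (return 0 m z) ^ J * return 0 (m + l) z ^ k
      = cnj (((T ^^ m) z * cnj z) ^ p * cnj (return 0 l ((T ^^ m) z) ^ k))"
      by (simp add: return_def)
  qed simp
  then have "cmod (\<E> z. cnj (return 0 m z) ^ J * return 0 (m + l) z ^ k)
     = cmod (\<E> z. ((T ^^ m) z * cnj z) ^ p * cnj (return 0 l ((T ^^ m) z) ^ k))"
    by (simp only: Bochner_Integration.integral_cnj complex_mod_cnj)
  also have "\<dots> \<le> 18 * (real p)\<^sup>2 * \<sigma> ^ (m + l)"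
    by (rule off_diagonal_correlation[OF p(1) k])
  also have "\<dots> \<le> 18 * (real J)\<^sup>2 * \<sigma> ^ (m + l)"
    using \<sigma>(1) p(2) by (intro mult_right_mono mult_left_mono power_mono) auto
  finally show ?thesis using False by simp
qed

lemma return_measurable [measurable]: "return m l \<in> borel_measurable \<mu>"
  by (rule Hinfty_measurable[OF return_boundary(1)])

lemma geometric_return_measurable [measurable]:
  "(\<lambda>z. geometric \<rho> (return m l z)) \<in> borel_measurable \<mu>"
  unfolding geometric_def by measurable

text \<open>Both series are expanded, with partial sums dominated so that the truncation can be
  removed at the end. The exact diagonal terms sum to at most
  \<open>\<alpha> ^ l / (1 - \<alpha>)\<close>; the error terms are
  \<open>18 \<sigma> ^ (m + l)\<close> times a sum of \<open>j^2 (1 - s)^j\<close>, at most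
  \<open>2 / s^3\<close>, and a sum of \<open>(1 - t)^k\<close>, at most
  \<open>1 / t\<close>.\<close>

lemma geometric_correlation:
  assumes l: "l \<ge> 1" and s: "0 < s" "s \<le> 1" and t: "0 < t" "t \<le> 1"
  shows "cmod (\<E> z. cnj (geometric (1 - s) (return 0 m z)) * geometric (1 - t) (return 0 (m + l) z))
    \<le> \<alpha> ^ l / (1 - \<alpha>) + 36 * \<sigma> ^ (m + l) / (s ^ 3 * t)"
proof -
  define S where "S \<rho> K n z = (\<Sum>j<K. of_real \<rho> ^ Suc j * return 0 n z ^ Suc j)" for \<rho> K n z
  define \<rho> where "\<rho> = 1 - s"
  define \<tau> where "\<tau> = 1 - t"
  have \<rho>: "0 \<le> \<rho>" "\<rho> < 1" and \<tau>: "0 \<le> \<tau>" "\<tau> < 1" using s t by (auto simp: \<rho>_def \<tau>_def)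
  have Sm [measurable]: "S \<rho> K n \<in> borel_measurable \<mu>" for \<rho> K n
    unfolding S_def by measurable
  have Sb: "cmod (S \<rho> K n z) \<le> 1 / (1 - \<rho>)" if "cmod z = 1" "0 \<le> \<rho>" "\<rho> < 1" for \<rho> K n z
    unfolding S_def using geometric_partial_sums(2)[of \<rho> "return 0 n z" K] that return_unit[OF that(1)] by auto
  have lim: "(\<lambda>K. \<E> z. cnj (S \<rho> K m z) * S \<tau> K (m + l) z) \<longlonglongrightarrow>
      (\<E> z. cnj (geometric \<rho> (return 0 m z)) * geometric \<tau> (return 0 (m + l) z))"
  proof (rule integral_dominated_convergence[where w = "\<lambda>_. 1 / (1 - \<rho>) * (1 / (1 - \<tau>))"])
    show "AE z in \<mu>. (\<lambda>K. cnj (S \<rho> K m z) * S \<tau> K (m + l) z) \<longlonglongrightarrow>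
        cnj (geometric \<rho> (return 0 m z)) * geometric \<tau> (return 0 (m + l) z)"
    proof (rule AE_I2)
      fix z assume "z \<in> space \<mu>"
      then have g: "cmod (return 0 n z) \<le> 1" for n by (simp add: return_unit)
      show "(\<lambda>K. cnj (S \<rho> K m z) * S \<tau> K (m + l) z) \<longlonglongrightarrow>
          cnj (geometric \<rho> (return 0 m z)) * geometric \<tau> (return 0 (m + l) z)"
        unfolding S_def
        by (rule tendsto_mult[OF tendsto_cnj[OF geometric_partial_sums(1)[OF \<rho> g]]
              geometric_partial_sums(1)[OF \<tau> g]])
    qed
    show "AE z in \<mu>. cmod (cnj (S \<rho> K m z) * S \<tau> K (m + l) z) \<le> 1 / (1 - \<rho>) * (1 / (1 - \<tau>))" for K
    proof (rule AE_I2)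
      fix z assume "z \<in> space \<mu>"
      then have z: "cmod z = 1" by simp
      show "cmod (cnj (S \<rho> K m z) * S \<tau> K (m + l) z) \<le> 1 / (1 - \<rho>) * (1 / (1 - \<tau>))"
        unfolding norm_mult complex_mod_cnj
        using Sb[OF z \<rho>, of K m] Sb[OF z \<tau>, of K "m + l"] \<rho> by (intro mult_mono) auto
    qed
  qed measurable
  have "cmod (\<E> z. cnj (S \<rho> K m z) * S \<tau> K (m + l) z)
      \<le> \<alpha> ^ l / (1 - \<alpha>) + 36 * \<sigma> ^ (m + l) / (s ^ 3 * t)" for K
  proof -
    define c where "c j k = (\<E> z. cnj (return 0 m z) ^ Suc j * return 0 (m + l) z ^ Suc k)" for j k
    have ij: "integrable \<mu> (\<lambda>z. cnj (return 0 m z) ^ Suc j * return 0 (m + l) z ^ Suc k)" for j k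
    proof (rule integrable_circle[where C = 1])
      show "(\<lambda>z. cnj (return 0 m z) ^ Suc j * return 0 (m + l) z ^ Suc k) \<in> borel_measurable \<mu>"
        by measurable
    qed (simp add: norm_mult norm_power return_unit)
    have "(\<E> z. cnj (S \<rho> K m z) * S \<tau> K (m + l) z)
      = (\<E> z. (\<Sum>j<K. \<Sum>k<K. of_real (\<rho> ^ Suc j * \<tau> ^ Suc k) *
           (cnj (return 0 m z) ^ Suc j * return 0 (m + l) z ^ Suc k)))"
      unfolding S_def cnj_sum sum_product
      by (rule arg_cong[where f = "integral\<^sup>L \<mu>"]) (simp add: mult_ac)
    also have "\<dots> = (\<Sum>j<K. \<Sum>k<K. of_real (\<rho> ^ Suc j * \<tau> ^ Suc k) * c j k)"
    proof (subst Bochner_Integration.integral_sum)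
      fix j
      show "integrable \<mu> (\<lambda>z. \<Sum>k<K. of_real (\<rho> ^ Suc j * \<tau> ^ Suc k) *
           (cnj (return 0 m z) ^ Suc j * return 0 (m + l) z ^ Suc k))"
        by (rule Bochner_Integration.integrable_sum, rule Bochner_Integration.integrable_mult_right, rule ij)
    next
      have "(\<E> z. (\<Sum>k<K. of_real (\<rho> ^ Suc j * \<tau> ^ Suc k) *
           (cnj (return 0 m z) ^ Suc j * return 0 (m + l) z ^ Suc k)))
        = (\<Sum>k<K. of_real (\<rho> ^ Suc j * \<tau> ^ Suc k) * c j k)" for j
        unfolding c_def
        by (subst Bochner_Integration.integral_sum, rule Bochner_Integration.integrable_mult_right, rule ij)
           (simp only: integral_mult_right_zero)
      then show "(\<Sum>j<K. \<E> z. (\<Sum>k<K. of_real (\<rho> ^ Suc j * \<tau> ^ Suc k) *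
           (cnj (return 0 m z) ^ Suc j * return 0 (m + l) z ^ Suc k)))
        = (\<Sum>j<K. \<Sum>k<K. of_real (\<rho> ^ Suc j * \<tau> ^ Suc k) * c j k)"
        by (simp only:)
    qed
    also have "cmod \<dots> \<le> (\<Sum>j<K. \<Sum>k<K. (if j = k then (\<alpha> ^ l) ^ Suc k else 0)
        + 18 * \<sigma> ^ (m + l) * ((real (Suc j))\<^sup>2 * \<rho> ^ Suc j) * \<tau> ^ k)"
    proof (intro order_trans[OF norm_sum] sum_mono order_trans[OF norm_sum])
      fix j k
      have 1: "\<rho> ^ Suc j * \<tau> ^ Suc k \<le> 1" using \<rho> \<tau> by (intro mult_le_one power_le_one) auto
      have 2: "\<rho> ^ Suc j * \<tau> ^ Suc k \<le> \<rho> ^ Suc j * \<tau> ^ k"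
        using \<rho> \<tau> by (intro mult_left_mono power_decreasing) auto
      have 0: "0 \<le> \<rho> ^ Suc j * \<tau> ^ Suc k" using \<rho> \<tau> by simp
      have "cmod (of_real (\<rho> ^ Suc j * \<tau> ^ Suc k) * c j k) = (\<rho> ^ Suc j * \<tau> ^ Suc k) * cmod (c j k)"
        unfolding norm_mult[of _ "c j k"] norm_of_real using 0 by (simp only: abs_of_nonneg)
      also have "\<dots> \<le> (\<rho> ^ Suc j * \<tau> ^ Suc k) * ((if j = k then \<alpha> ^ (l * Suc k) else 0)
          + 18 * (real (Suc j))\<^sup>2 * \<sigma> ^ (m + l))"
        using return_correlation[of "Suc j" "Suc k" m l] 0 unfolding c_def
        by (intro mult_left_mono) auto
      also have "\<dots> = (\<rho> ^ Suc j * \<tau> ^ Suc k) * (if j = k then \<alpha> ^ (l * Suc k) else 0)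
          + (\<rho> ^ Suc j * \<tau> ^ Suc k) * (18 * (real (Suc j))\<^sup>2 * \<sigma> ^ (m + l))"
        by (rule distrib_left)
      also have "\<dots> \<le> 1 * (if j = k then \<alpha> ^ (l * Suc k) else 0)
          + (\<rho> ^ Suc j * \<tau> ^ k) * (18 * (real (Suc j))\<^sup>2 * \<sigma> ^ (m + l))"
        using 1 2 \<sigma>(1) by (intro add_mono mult_right_mono) auto
      finally show "cmod (of_real (\<rho> ^ Suc j * \<tau> ^ Suc k) * c j k)
        \<le> (if j = k then (\<alpha> ^ l) ^ Suc k else 0)
          + 18 * \<sigma> ^ (m + l) * ((real (Suc j))\<^sup>2 * \<rho> ^ Suc j) * \<tau> ^ k"
        by (simp only: mult_1 power_mult mult_ac)
    qed
    also have "\<dots> = (\<Sum>k<K. (\<alpha> ^ l) ^ Suc k)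
        + 18 * \<sigma> ^ (m + l) * (\<Sum>j<K. (real (Suc j))\<^sup>2 * \<rho> ^ Suc j) * (\<Sum>k<K. \<tau> ^ k)"
    proof -
      have "(\<Sum>j<K. \<Sum>k<K. (if j = k then (\<alpha> ^ l) ^ Suc k else 0)) = (\<Sum>k<K. (\<alpha> ^ l) ^ Suc k)"
        by simp
      moreover have "(\<Sum>j<K. \<Sum>k<K. 18 * \<sigma> ^ (m + l) * ((real (Suc j))\<^sup>2 * \<rho> ^ Suc j) * \<tau> ^ k)
          = (\<Sum>j<K. 18 * \<sigma> ^ (m + l) * ((real (Suc j))\<^sup>2 * \<rho> ^ Suc j)) * (\<Sum>k<K. \<tau> ^ k)"
        by (rule sum_product[symmetric])
      moreover have "(\<Sum>j<K. 18 * \<sigma> ^ (m + l) * ((real (Suc j))\<^sup>2 * \<rho> ^ Suc j))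
          = 18 * \<sigma> ^ (m + l) * (\<Sum>j<K. (real (Suc j))\<^sup>2 * \<rho> ^ Suc j)"
        by (rule sum_distrib_left[symmetric])
      ultimately show ?thesis by (simp only: sum.distrib)
    qed
    also have "\<dots> \<le> \<alpha> ^ l / (1 - \<alpha>) + 18 * \<sigma> ^ (m + l) * (2 / s ^ 3) * (1 / t)"
    proof (intro add_mono mult_mono mult_nonneg_nonneg sum_nonneg)
      have a1: "\<alpha> ^ l \<le> \<alpha>" using power_decreasing[OF l, of \<alpha>] deriv_less_1 by simp
      then have a2: "\<alpha> ^ l < 1" using deriv_less_1 by simp
      have "(\<Sum>k<K. (\<alpha> ^ l) ^ Suc k) = \<alpha> ^ l * (\<Sum>k<K. (\<alpha> ^ l) ^ k)"
        by (simp add: sum_distrib_left)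
      also have "\<dots> \<le> \<alpha> ^ l * (1 / (1 - \<alpha> ^ l))"
        using a2 by (intro mult_left_mono geometric_partial_sum_le) auto
      also have "\<dots> \<le> \<alpha> ^ l * (1 / (1 - \<alpha>))"
        using a1 deriv_less_1 by (intro mult_left_mono frac_le) auto
      finally show "(\<Sum>k<K. (\<alpha> ^ l) ^ Suc k) \<le> \<alpha> ^ l / (1 - \<alpha>)" by simp
      have "(\<Sum>j<K. (real (Suc j))\<^sup>2 * \<rho> ^ Suc j) \<le> (\<Sum>j<Suc K. (real j)\<^sup>2 * \<rho> ^ j)"
        by (subst sum.lessThan_Suc_shift) simp
      also have "\<dots> \<le> 2 / s ^ 3"
        using square_geometric_partial_sum_le[OF \<rho>, of "Suc K"] by (simp add: \<rho>_def)
      finally show "(\<Sum>j<K. (real (Suc j))\<^sup>2 * \<rho> ^ Suc j) \<le> 2 / s ^ 3" .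
      show "(\<Sum>k<K. \<tau> ^ k) \<le> 1 / t"
        using geometric_partial_sum_le[OF \<tau>, of K] by (simp add: \<tau>_def)
    qed (use \<sigma>(1) \<rho> \<tau> s t in auto)
    finally show ?thesis by simp
  qed
  then show ?thesis
    unfolding \<rho>_def[symmetric] \<tau>_def[symmetric]
    by (intro LIMSEQ_le_const2[OF tendsto_norm[OF lim]]) auto
qed

text \<open>In the product of \<open>1 + 2 Re X\<close> and \<open>1 + 2 Re Y\<close>, the term
  \<open>Re (X Y)\<close> has mean exactly \<open>Re (x y)\<close>, so the covariance reduces to
  \<open>2 Re (E - cnj x * y)\<close> with \<open>E\<close> the mean of \<open>cnj X * Y\<close>.
  \<open>geometric_correlation\<close> bounds \<open>E\<close>, while \<open>x\<close> and
  \<open>y\<close> are controlled by the powers \<open>m\<close> and \<open>m + l\<close> of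
  \<open>\<alpha>\<close>.\<close>

lemma poisson_correlation:
  assumes m: "m \<ge> 1" and l: "l \<ge> 1" and s: "0 < s" "s \<le> 1" and t: "0 < t" "t \<le> 1"
  shows "(\<E> z. poisson (1 - s) (return 0 m z) * poisson (1 - t) (return 0 (m + l) z))
    \<le> (\<E> z. poisson (1 - s) (return 0 m z)) * (\<E> z. poisson (1 - t) (return 0 (m + l) z))
      + 76 / (1 - \<alpha>)\<^sup>2 * (\<alpha> ^ l + \<sigma> ^ (m + l) / (s ^ 3 * t))"
proof -
  define \<rho> where "\<rho> = 1 - s"
  define \<tau> where "\<tau> = 1 - t"
  have \<rho>: "0 \<le> \<rho>" "\<rho> < 1" and \<tau>: "0 \<le> \<tau>" "\<tau> < 1" using s t by (auto simp: \<rho>_def \<tau>_def)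
  define X where "X z = geometric \<rho> (return 0 m z)" for z
  define Y where "Y z = geometric \<tau> (return 0 (m + l) z)" for z
  define x where "x = geometric \<rho> (deriv f 0 ^ m)"
  define y where "y = geometric \<tau> (deriv f 0 ^ (m + l))"
  note BX = Hinfty_compose_analytic[OF geometric_analytic[OF \<rho>] geometric_bound[OF \<rho>] return_boundary(1)[of 0 m]]
  note BY = Hinfty_compose_analytic[OF geometric_analytic[OF \<tau>] geometric_bound[OF \<tau>] return_boundary(1)[of 0 "m + l"]]
  have bX: "Hinfty (1 / (1 - \<rho>)) X" and EX: "(\<E> z. X z) = x"
    using BX(1) BX(2)[of 0] by (auto simp: X_def[abs_def] x_def return_boundary(2) simp flip: cauchy_ext_0)
  have bY: "Hinfty (1 / (1 - \<tau>)) Y" and EY: "(\<E> z. Y z) = y"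
    using BY(1) BY(2)[of 0] by (auto simp: Y_def[abs_def] y_def return_boundary(2) simp flip: cauchy_ext_0)
  have bXY: "Hinfty (1 / (1 - \<rho>) * (1 / (1 - \<tau>))) (\<lambda>z. X z * Y z)"
    by (rule Hinfty_mult(1)[OF bX bY])
  have EXY: "(\<E> z. X z * Y z) = x * y"
    using Hinfty_mult(2)[OF bX bY, of 0] EX EY by (simp add: cauchy_ext_0)
  note [measurable] = Hinfty_measurable[OF bX] Hinfty_measurable[OF bY]
  have i: "integrable \<mu> X" "integrable \<mu> Y"
      "integrable \<mu> (\<lambda>z. X z * Y z)"
    using bX bY bXY by (auto intro: integrable_circle Hinfty_measurable Hinfty_bound)
  have ic: "integrable \<mu> (\<lambda>z. cnj (X z) * Y z)"
  proof (rule integrable_circle)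
    show "cmod (cnj (X z) * Y z) \<le> 1 / (1 - \<rho>) * (1 / (1 - \<tau>))" if "cmod z = 1" for z
      using Hinfty_bound[OF bXY that] by (simp add: norm_mult)
  qed measurable
  define E where "E = (\<E> z. cnj (X z) * Y z)"
  have pX: "poisson \<rho> (return 0 m z) = 1 + 2 * Re (X z)"
    and pY: "poisson \<tau> (return 0 (m + l) z) = 1 + 2 * Re (Y z)" if "cmod z = 1" for z
    using poisson_geometric[OF \<rho>] poisson_geometric[OF \<tau>] return_unit[OF that] by (auto simp: X_def Y_def)
  have "(\<E> z. poisson \<rho> (return 0 m z)) = (\<E> z. 1 + 2 * Re (X z))"
    by (rule mean_cong) (use pX in auto)
  then have PX: "(\<E> z. poisson \<rho> (return 0 m z)) = 1 + 2 * Re x"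
    using i circle.prob_space by (simp add: EX)
  have "(\<E> z. poisson \<tau> (return 0 (m + l) z)) = (\<E> z. 1 + 2 * Re (Y z))"
    by (rule mean_cong) (use pY in auto)
  then have PY: "(\<E> z. poisson \<tau> (return 0 (m + l) z)) = 1 + 2 * Re y"
    using i circle.prob_space by (simp add: EY)
  have "(\<E> z. poisson \<rho> (return 0 m z) * poisson \<tau> (return 0 (m + l) z))
    = (\<E> z. 1 + 2 * Re (X z) + 2 * Re (Y z) + 2 * Re (X z * Y z) + 2 * Re (cnj (X z) * Y z))"
    by (rule mean_cong) (use pX pY in \<open>auto simp: algebra_simps\<close>)
  also have "\<dots> = 1 + 2 * Re x + 2 * Re y + 2 * Re (x * y) + 2 * Re E"
    using i ic circle.prob_space by (simp add: EX EY EXY E_def del: times_complex.sel)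
  also have "\<dots> = (1 + 2 * Re x) * (1 + 2 * Re y) + 2 * Re (E - cnj x * y)"
    by (simp add: algebra_simps)
  also have "Re (E - cnj x * y) \<le> cmod E + cmod x * cmod y"
    using complex_Re_le_cmod[of "E - cnj x * y"] norm_triangle_ineq4[of E "cnj x * y"]
    by (simp add: norm_mult)
  finally have main: "(\<E> z. poisson \<rho> (return 0 m z) * poisson \<tau> (return 0 (m + l) z))
    \<le> (1 + 2 * Re x) * (1 + 2 * Re y) + 2 * (cmod E + cmod x * cmod y)" by simp
  define \<beta> where "\<beta> = 1 / (1 - \<alpha>)"
  have \<beta>: "1 \<le> \<beta>" using deriv_less_1 by (simp add: \<beta>_def)
  then have \<beta>2: "\<beta> \<le> \<beta>\<^sup>2" by (simp add: power2_eq_square)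
  have gb: "cmod (geometric \<rho>' (deriv f 0 ^ n)) \<le> \<alpha> ^ n * \<beta>"
    if r: "0 \<le> \<rho>'" "\<rho>' < 1" and n: "n \<ge> 1" for \<rho>' n
  proof -
    have "\<rho>' * \<alpha> ^ n \<le> 1 * \<alpha> ^ 1"
      using r n deriv_less_1 by (intro mult_mono power_decreasing) auto
    then have "1 - \<alpha> \<le> cmod (1 - of_real \<rho>' * deriv f 0 ^ n)"
      using norm_triangle_ineq2[of 1 "of_real \<rho>' * deriv f 0 ^ n"] r by (simp add: norm_mult norm_power)
    moreover have "cmod (geometric \<rho>' (deriv f 0 ^ n)) = \<rho>' * \<alpha> ^ n / cmod (1 - of_real \<rho>' * deriv f 0 ^ n)"
      using r by (simp add: geometric_def norm_mult norm_divide norm_power)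
    moreover have "\<rho>' * \<alpha> ^ n \<le> \<alpha> ^ n" using r by (simp add: mult_left_le_one_le)
    ultimately have "cmod (geometric \<rho>' (deriv f 0 ^ n)) \<le> \<alpha> ^ n / (1 - \<alpha>)"
      using r deriv_less_1 by (auto intro!: frac_le)
    then show ?thesis by (simp add: \<beta>_def)
  qed
  have xy: "cmod x * cmod y \<le> \<sigma> ^ (m + l) * \<beta>\<^sup>2"
  proof -
    have "cmod x * cmod y \<le> (\<alpha> ^ m * \<beta>) * (\<alpha> ^ (m + l) * \<beta>)"
      unfolding x_def y_def using m l \<rho> \<tau> \<beta> by (intro mult_mono gb) auto
    also have "\<dots> \<le> (1 * \<beta>) * (\<sigma> ^ (m + l) * \<beta>)"
      using \<beta> \<sigma>(1,4) deriv_less_1 by (intro mult_mono power_mono power_le_one) auto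
    finally show ?thesis by (simp add: power2_eq_square mult_ac)
  qed
  define D where "D = \<sigma> ^ (m + l) / (s ^ 3 * t)"
  have st: "s ^ 3 * t \<le> 1" "s ^ 3 * t > 0" using s t by (auto simp: mult_le_one power_le_one)
  have D: "\<sigma> ^ (m + l) \<le> D" "0 \<le> D"
    unfolding D_def using st \<sigma>(1) by (auto simp: le_divide_eq mult_left_le)
  have "cmod E \<le> \<alpha> ^ l * \<beta> + 36 * D"
    using geometric_correlation[OF l s t, of m]
    by (simp add: E_def X_def Y_def \<rho>_def \<tau>_def D_def \<beta>_def)
  also have "\<dots> \<le> \<alpha> ^ l * \<beta>\<^sup>2 + 36 * (D * \<beta>\<^sup>2)"
    using \<beta> \<beta>2 D mult_left_mono[of 1 "\<beta>\<^sup>2" D] by (intro add_mono mult_left_mono) auto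
  finally have "cmod E \<le> \<alpha> ^ l * \<beta>\<^sup>2 + 36 * (D * \<beta>\<^sup>2)" .
  moreover have "cmod x * cmod y \<le> D * \<beta>\<^sup>2"
    using order_trans[OF xy mult_right_mono[OF D(1), of "\<beta>\<^sup>2"]] by simp
  moreover have "0 \<le> \<alpha> ^ l * \<beta>\<^sup>2" "0 \<le> D * \<beta>\<^sup>2" using D by auto
  ultimately have "2 * (cmod E + cmod x * cmod y) \<le> 76 * (\<alpha> ^ l * \<beta>\<^sup>2 + D * \<beta>\<^sup>2)"
    unfolding distrib_left by linarith
  then have "2 * (cmod E + cmod x * cmod y) \<le> 76 / (1 - \<alpha>)\<^sup>2 * (\<alpha> ^ l + D)"
    by (simp add: \<beta>_def power_divide algebra_simps add_divide_distrib)
  then show ?thesis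
    using main PX PY by (simp add: \<rho>_def \<tau>_def D_def)
qed

end

section \<open>Returns and Poisson kernels\<close>

lemma sin_ge_chord:
  assumes "0 \<le> x" "x \<le> pi / 2"
  shows "2 * x / pi \<le> sin x"
proof -
  have "convex_on {0..pi/2} (\<lambda>x. - sin x)"
  proof (rule f''_ge0_imp_convex)
    show "((\<lambda>x. - sin x) has_real_derivative - cos x) (at x)" for x :: real
      by (auto intro!: derivative_eq_intros)
    show "((\<lambda>x. - cos x) has_real_derivative sin x) (at x)" for x :: real
      by (auto intro!: derivative_eq_intros)
  qed (auto intro!: sin_ge_zero)
  from convex_onD_Icc[OF this, of "2 * x / pi"] show ?thesis using assms by (simp add: field_simps)
qed

lemma cmod_one_minus_Arg:
  assumes "cmod w = 1"
  shows "cmod (1 - w) = 2 * sin (\<bar>Arg w\<bar> / 2)"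
proof -
  define \<theta> where "\<theta> = Arg w"
  have w: "w = cis \<theta>" using rcis_cmod_Arg[of w] assms by (simp add: \<theta>_def rcis_def)
  have "(cmod (1 - w))\<^sup>2 = 2 - 2 * cos \<bar>\<theta>\<bar>"
    using sin_cos_squared_add[of \<theta>] unfolding w by (simp add: cmod_power2) (simp add: power2_eq_square algebra_simps)
  also have "\<dots> = (2 * sin (\<bar>\<theta>\<bar> / 2))\<^sup>2"
    using cos_double_sin[of "\<bar>\<theta>\<bar> / 2"] by (simp add: power_mult_distrib)
  finally have "(cmod (1 - w))\<^sup>2 = (2 * sin (\<bar>\<theta>\<bar> / 2))\<^sup>2" .
  moreover have "0 \<le> sin (\<bar>\<theta>\<bar> / 2)"
    using Arg_bounded[of w] by (intro sin_ge_zero) (auto simp: \<theta>_def abs_le_iff)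
  ultimately show ?thesis unfolding \<theta>_def by (intro power2_eq_imp_eq[of "cmod (1 - w)"]) auto
qed

lemma cmod_one_minus_le_Arg:
  assumes "cmod w = 1" shows "cmod (1 - w) \<le> \<bar>Arg w\<bar>"
  using cmod_one_minus_Arg[OF assms] abs_sin_x_le_abs_x[of "\<bar>Arg w\<bar> / 2"] by simp

lemma cmod_one_minus_ge_Arg:
  assumes "cmod w = 1" shows "2 * \<bar>Arg w\<bar> / pi \<le> cmod (1 - w)"
proof -
  have "\<bar>Arg w\<bar> \<le> pi" using Arg_bounded[of w] by (simp add: abs_le_iff)
  then show ?thesis using cmod_one_minus_Arg[OF assms] sin_ge_chord[of "\<bar>Arg w\<bar> / 2"] by simp
qed

text \<open>Replaces \<open>Arg\<close>, which jumps across the negative axis, by the continuous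
  function \<open>Re\<close>, so that measurability of a return becomes evident.\<close>

lemma Arg_less_iff:
  assumes "cmod w = 1" "0 < x"
  shows "\<bar>Arg w\<bar> < x \<longleftrightarrow> pi < x \<or> cos x < Re w"
proof (cases "pi < x")
  case True
  then show ?thesis using Arg_bounded[of w] by auto
next
  case False
  have "w \<noteq> 0" using assms by auto
  then have "Re w = cos \<bar>Arg w\<bar>" using cos_Arg[of w] assms by simp
  moreover have "cos x < cos \<bar>Arg w\<bar> \<longleftrightarrow> \<bar>Arg w\<bar> < x"
    using False assms Arg_bounded[of w] by (intro cos_mono_less_eq) auto
  ultimately show ?thesis using False by simp
qed

text \<open>The factor 7 is a bound for \<open>2 pi\<close>: points at normalised arc distance
  \<open>t\<close> are at most \<open>7 t\<close> apart. Adding \<open>t\<close> for pulling inwards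
  makes the denominator of the kernel at most \<open>(8 t)^2\<close>, whence 64.\<close>

lemma poisson_near:
  assumes t: "0 < t" "t \<le> 1" and w: "cmod w = 1" and near: "cmod (1 - w) \<le> 7 * t"
  shows "1 \<le> 64 * t * poisson (1 - t) w"
proof -
  have e: "1 - of_real (1 - t) * w = (1 - w) + of_real t * w" by (simp add: algebra_simps)
  have "cmod (1 - of_real (1 - t) * w) \<le> 8 * t"
    unfolding e using norm_triangle_ineq[of "1 - w" "of_real t * w"] near t w by (simp add: norm_mult)
  moreover have nz: "1 - of_real (1 - t) * w \<noteq> 0" using poisson_denominator(2)[of "1 - t" w] t w by simp
  ultimately have d: "(cmod (1 - of_real (1 - t) * w))\<^sup>2 \<le> 64 * t\<^sup>2" "0 < (cmod (1 - of_real (1 - t) * w))\<^sup>2"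
    using power_mono[of "cmod (1 - of_real (1 - t) * w)" "8 * t" 2] by (auto simp: power_mult_distrib)
  have "t\<^sup>2 \<le> t" using t by (simp add: power2_eq_square mult_left_le)
  then have num: "t \<le> 1 - (1 - t)\<^sup>2" by (simp add: power2_diff)
  have "64 * t * poisson (1 - t) w = 64 * t * (1 - (1 - t)\<^sup>2) / (cmod (1 - of_real (1 - t) * w))\<^sup>2"
    using w by (simp add: poisson_eq)
  also have "\<dots> \<ge> 64 * t * t / (64 * t\<^sup>2)"
    using t num d by (intro frac_le mult_left_mono) auto
  finally show ?thesis using t by (simp add: power2_eq_square)
qed

text \<open>Away from 1 both denominators are comparable to the squared chord: one is at least
  \<open>(d / 2)^2\<close>, the other at most \<open>(2 d)^2\<close>, a factor 16. The numerators
  are at most \<open>2 \<epsilon> t\<close> and at least \<open>t\<close>. So the tail shrinks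
  linearly with \<open>\<epsilon>\<close>.\<close>

lemma poisson_far:
  assumes t: "0 < t" "t \<le> 1" and \<epsilon>: "0 < \<epsilon>" "\<epsilon> \<le> 1" and w: "cmod w = 1" and far: "2 * t \<le> cmod (1 - w)"
  shows "poisson (1 - \<epsilon> * t) w \<le> 32 * \<epsilon> * poisson (1 - t) w"
proof -
  define d where "d = cmod (1 - w)"
  have d0: "d > 0" using far t unfolding d_def by linarith
  have \<epsilon>t: "0 < \<epsilon> * t" "\<epsilon> * t \<le> t" "\<epsilon> * t \<le> 1" using \<epsilon> t by (auto simp: mult_left_le_one_le mult_le_one)
  have e: "1 - of_real (1 - x) * w = (1 - w) + of_real x * w" for x by (simp add: algebra_simps)
  have u: "cmod (1 - of_real (1 - t) * w) \<le> 2 * d" "1 - of_real (1 - t) * w \<noteq> 0"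
  proof -
    show "cmod (1 - of_real (1 - t) * w) \<le> 2 * d"
      unfolding e d_def using norm_triangle_ineq[of "1 - w" "of_real t * w"] far t w
      by (simp add: norm_mult)
    show "1 - of_real (1 - t) * w \<noteq> 0"
      using t w by (intro poisson_denominator(2)) auto
  qed
  have l: "d / 2 \<le> cmod (1 - of_real (1 - \<epsilon> * t) * w)"
  proof -
    have "cmod (of_real (\<epsilon> * t) * w) = \<epsilon> * t"
      using \<epsilon>t(1) w by (simp add: norm_mult del: of_real_mult)
    then have "d - \<epsilon> * t \<le> cmod (1 - of_real (1 - \<epsilon> * t) * w)"
      unfolding e d_def using norm_diff_ineq[of "1 - w" "of_real (\<epsilon> * t) * w"] by linarith
    moreover have "2 * (\<epsilon> * t) \<le> d" using \<epsilon>t(2) far unfolding d_def by linarith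
    ultimately show ?thesis by linarith
  qed
  have "1 - (1 - \<epsilon> * t)\<^sup>2 \<le> 2 * (\<epsilon> * t)" by (simp add: power2_diff)
  moreover have "(d / 2)\<^sup>2 \<le> (cmod (1 - of_real (1 - \<epsilon> * t) * w))\<^sup>2" using l d0 by (intro power_mono) auto
  ultimately have "poisson (1 - \<epsilon> * t) w \<le> 2 * (\<epsilon> * t) / (d / 2)\<^sup>2"
    using w d0 \<epsilon>t(1) by (simp only: poisson_eq mult_1_right) (intro frac_le, auto)
  also have "\<dots> = 32 * \<epsilon> * (t / (2 * d)\<^sup>2)" by (simp add: power2_eq_square)
  also have "t / (2 * d)\<^sup>2 \<le> (1 - (1 - t)\<^sup>2) / (cmod (1 - of_real (1 - t) * w))\<^sup>2"
  proof (rule frac_le)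
    have "t\<^sup>2 \<le> t" using t by (simp add: power2_eq_square mult_left_le)
    then show "t \<le> 1 - (1 - t)\<^sup>2" "0 \<le> 1 - (1 - t)\<^sup>2" using t by (auto simp: power2_diff)
    show "(cmod (1 - of_real (1 - t) * w))\<^sup>2 \<le> (2 * d)\<^sup>2" using u by (intro power_mono) auto
  qed (use u in auto)
  also have "(1 - (1 - t)\<^sup>2) / (cmod (1 - of_real (1 - t) * w))\<^sup>2 = poisson (1 - t) w"
    using w by (simp add: poisson_eq)
  finally show ?thesis using \<epsilon> by simp
qed

text \<open>The square of the sum is expanded one summand at a time. On the diagonal the raw second
  moment is bounded, and the square of the mean, being nonnegative, is given away.\<close>

lemma second_moment_growth:
  fixes X :: "nat \<Rightarrow> complex \<Rightarrow> real"
  assumes [measurable]: "\<And>n. X n \<in> borel_measurable \<mu>"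
    and bound: "\<And>n z. cmod z = 1 \<Longrightarrow> \<bar>X n z\<bar> \<le> B"
    and diag: "\<And>n. (\<E> z. (X n z)\<^sup>2) \<le> p n"
    and off: "\<And>m n. m < n \<Longrightarrow> (\<E> z. X m z * X n z)
        \<le> (\<E> z. X m z) * (\<E> z. X n z) + q m n"
  shows "(\<E> z. (\<Sum>n<N. X n z)\<^sup>2)
    \<le> (\<E> z. (\<Sum>n<N. X n z))\<^sup>2 + (\<Sum>n<N. p n + 2 * (\<Sum>m<n. q m n))"
proof (induction N)
  case 0
  then show ?case by simp
next
  case (Suc N)
  have B: "0 \<le> B" using bound[of 1 0] by simp
  have i1: "integrable \<mu> (X n)" for n
    by (rule integrable_circle) (use bound in auto)
  have i2: "integrable \<mu> (\<lambda>z. X m z * X n z)" for m n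
    by (rule integrable_circle[where C = "B * B"]) (use bound B in \<open>auto simp: abs_mult intro!: mult_mono\<close>)
  have i2': "integrable \<mu> (\<lambda>z. (X n z)\<^sup>2)" for n
    using i2[of n n] by (simp add: power2_eq_square)
  have i3: "integrable \<mu> (\<lambda>z. (\<Sum>n<N. X n z)\<^sup>2)"
    unfolding power2_eq_square sum_product by (intro Bochner_Integration.integrable_sum i2)
  have i4: "integrable \<mu> (\<lambda>z. (\<Sum>n<N. X n z) * X N z)"
    unfolding sum_distrib_right by (intro Bochner_Integration.integrable_sum i2)
  define E where "E n = (\<E> z. X n z)" for n
  have ES: "(\<E> z. (\<Sum>n<N. X n z)) = (\<Sum>n<N. E n)" for N
    unfolding E_def by (rule Bochner_Integration.integral_sum) (rule i1)
  have "(\<E> z. (\<Sum>n<Suc N. X n z)\<^sup>2)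
    = (\<E> z. (\<Sum>n<N. X n z)\<^sup>2 + 2 * ((\<Sum>n<N. X n z) * X N z) + (X N z)\<^sup>2)"
    by (rule mean_cong) (auto simp: power2_sum)
  also have "\<dots> = (\<E> z. (\<Sum>n<N. X n z)\<^sup>2)
      + 2 * (\<E> z. (\<Sum>n<N. X n z) * X N z) + (\<E> z. (X N z)\<^sup>2)"
    using i3 i4 i2' by simp
  also have "(\<E> z. (\<Sum>n<N. X n z) * X N z) = (\<Sum>n<N. (\<E> z. X n z * X N z))"
    unfolding sum_distrib_right by (rule Bochner_Integration.integral_sum) (rule i2)
  also have "(\<Sum>n<N. (\<E> z. X n z * X N z)) \<le> (\<Sum>n<N. E n * E N + q n N)"
    unfolding E_def by (intro sum_mono off) auto
  also have "(\<Sum>n<N. E n * E N + q n N) = (\<Sum>n<N. E n) * E N + (\<Sum>n<N. q n N)"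
    by (simp add: sum.distrib sum_distrib_right)
  finally have "(\<E> z. (\<Sum>n<Suc N. X n z)\<^sup>2)
      \<le> (\<E> z. (\<Sum>n<N. X n z)\<^sup>2)
        + 2 * ((\<Sum>n<N. E n) * E N + (\<Sum>n<N. q n N)) + (\<E> z. (X N z)\<^sup>2)"
    by simp
  moreover have "(\<Sum>n<Suc N. E n)\<^sup>2 = (\<Sum>n<N. E n)\<^sup>2 + 2 * ((\<Sum>n<N. E n) * E N) + (E N)\<^sup>2"
    by (simp add: power2_sum)
  moreover have "0 \<le> (E N)\<^sup>2" by simp
  moreover have "(\<Sum>n<Suc N. p n + 2 * (\<Sum>m<n. q m n)) =
      (\<Sum>n<N. p n + 2 * (\<Sum>m<n. q m n)) + (p N + 2 * (\<Sum>m<N. q m N))" by simp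
  moreover have arith: "a \<le> b + 2 * (c + d) + e \<Longrightarrow> g = h + 2 * c + k \<Longrightarrow> 0 \<le> k \<Longrightarrow> u = v + (s + 2 * d) \<Longrightarrow>
      b \<le> h + v \<Longrightarrow> e \<le> s \<Longrightarrow> a \<le> g + u" for a b c d e g h k u v s :: real
    by (simp add: algebra_simps)
  ultimately show ?case using Suc diag[of N] unfolding ES by blast
qed

text \<open>Write \<open>x = y ^ (k + 1)\<close> with \<open>y < 1\<close>: of the factors
  \<open>y ^ n\<close>, \<open>k\<close> absorb \<open>n ^ k\<close>, as \<open>n * y ^ n\<close> is
  bounded, and one remains to be summed.\<close>

lemma summable_power_times_geometric:
  assumes "0 < x" "x < 1"
  shows "summable (\<lambda>n. real n ^ k * x ^ n)"
proof -
  define y where "y = root (Suc k) x"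
  have y: "0 < y" "y < 1" using assms by (auto simp: y_def)
  have yk: "y ^ Suc k = x" unfolding y_def by (rule real_root_pow_pos2) (use assms in auto)
  have "(\<lambda>n. real n * y ^ n) \<longlonglongrightarrow> 0"
    using powser_times_n_limit_0[of y] y by simp
  then obtain K where K: "\<And>n. norm (real n * y ^ n) \<le> K"
    using Bseq_def convergentI convergent_imp_Bseq by metis
  show ?thesis
  proof (rule summable_comparison_test)
    show "summable (\<lambda>n. K ^ k * y ^ n)" using y by (intro summable_mult summable_geometric) auto
    have "norm (real n ^ k * x ^ n) \<le> K ^ k * y ^ n" for n
    proof -
      have "x ^ n = (y ^ k) ^ n * y ^ n" unfolding yk[symmetric] by (simp add: power_mult_distrib)
      also have "(y ^ k) ^ n = (y ^ n) ^ k" by (metis mult.commute power_mult)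
      finally have "x ^ n = (y ^ n) ^ k * y ^ n" .
      then have "real n ^ k * x ^ n = (real n * y ^ n) ^ k * y ^ n" by (simp add: power_mult_distrib)
      also have "\<dots> \<le> K ^ k * y ^ n" using K[of n] y by (intro mult_right_mono power_mono) auto
      finally show ?thesis using assms by simp
    qed
    then show "\<exists>N. \<forall>n\<ge>N. norm (real n ^ k * x ^ n) \<le> K ^ k * y ^ n" by blast
  qed
qed

section \<open>Single returns and the convergent case\<close>

context centred_inner
begin

text \<open>Normalised arc length is \<open>\<bar>Arg\<bar> / (2 pi)\<close>, hence the factor.
  There is no domain condition, since \<open>T\<close> is total.\<close>

definition hit :: "(nat \<Rightarrow> real) \<Rightarrow> nat \<Rightarrow> complex \<Rightarrow> bool" where
  "hit r n z \<longleftrightarrow> \<bar>Arg (return 0 n z)\<bar> < 2 * pi * r n"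

lemma hit_sets: "{z \<in> space \<mu>. hit r n z} \<in> sets \<mu>"
proof (cases "r n > 0")
  case True
  then have "{z \<in> space \<mu>. hit r n z}
      = {z \<in> space \<mu>. pi < 2 * pi * r n \<or> cos (2 * pi * r n) < Re (return 0 n z)}"
    using Arg_less_iff[of "return 0 n _" "2 * pi * r n"] return_unit by (auto simp: hit_def)
  also have "\<dots> \<in> sets \<mu>"
    by measurable
  finally show ?thesis .
next
  case False
  then have "2 * pi * r n \<le> 0" by (simp add: mult_nonneg_nonpos)
  then have "{z \<in> space \<mu>. hit r n z} = {}"
    by (auto simp: hit_def not_less intro: order_trans)
  then show ?thesis by (simp only: sets.empty_sets)
qed

definition harnack_const :: real where "harnack_const = (1 + \<alpha>) / (1 - \<alpha>)"

lemma harnack_const: "1 \<le> harnack_const"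
  using deriv_less_1 by (simp add: harnack_const_def)

lemma poisson_return_measurable [measurable]:
  "(\<lambda>z. poisson \<rho> (return 0 n z)) \<in> borel_measurable \<mu>"
  by (rule measurable_compose[OF return_measurable borel_measurable_poisson])

lemma integrable_poisson_return:
  assumes "0 \<le> \<rho>" "\<rho> < 1"
  shows "integrable \<mu> (\<lambda>z. poisson \<rho> (return 0 n z))"
proof (rule integrable_circle[where C = "(1 + \<rho>) / (1 - \<rho>)"])
  show "norm (poisson \<rho> (return 0 n z)) \<le> (1 + \<rho>) / (1 - \<rho>)" if "cmod z = 1" for z
    using poisson_nonneg[OF assms, of "return 0 n z"] poisson_bound(2)[OF assms, of "return 0 n z"]
      return_unit[OF that, of 0 n] by simp
qed measurable

text \<open>The mean is the kernel at \<open>deriv f 0 ^ n\<close>, a point of modulus at most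
  \<open>\<alpha>\<close> as \<open>n \<ge> 1\<close>, so Harnack's inequality is uniform in
  \<open>n\<close> and in \<open>\<rho>\<close>.\<close>

lemma integral_poisson_return:
  assumes "0 \<le> \<rho>" "\<rho> < 1" "n \<ge> 1"
  shows "1 / harnack_const \<le> (\<E> z. poisson \<rho> (return 0 n z))"
    and "(\<E> z. poisson \<rho> (return 0 n z)) \<le> harnack_const"
proof -
  have eq: "(\<E> z. poisson \<rho> (return 0 n z)) = poisson \<rho> (deriv f 0 ^ n)"
    using integral_poisson[of \<rho> 1 "return 0 n"] assms return_boundary by simp
  have a: "\<alpha> ^ n \<le> \<alpha>" "0 \<le> \<alpha> ^ n" using power_decreasing[OF assms(3), of \<alpha>] deriv_less_1 by auto
  have a1: "0 < 1 + \<alpha> ^ n" using a(2) by linarith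
  have "1 / harnack_const = (1 - \<alpha>) / (1 + \<alpha>)" by (simp add: harnack_const_def)
  also have "\<dots> \<le> (1 - \<alpha> ^ n) / (1 + \<alpha> ^ n)" using a a1 deriv_less_1 by (intro frac_le) auto
  also have "\<dots> \<le> poisson \<rho> (deriv f 0 ^ n)"
    using poisson_lower[OF assms(1,2), of "deriv f 0 ^ n"] a deriv_less_1 by (simp add: norm_power)
  finally show "1 / harnack_const \<le> (\<E> z. poisson \<rho> (return 0 n z))" by (simp add: eq)
  have "poisson \<rho> (deriv f 0 ^ n) \<le> (1 + \<alpha> ^ n) / (1 - \<alpha> ^ n)"
    using poisson_upper[OF assms(1,2), of "deriv f 0 ^ n"] a deriv_less_1 by (simp add: norm_power)
  also have "\<dots> \<le> harnack_const" unfolding harnack_const_def using a deriv_less_1 by (intro frac_le) auto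
  finally show "(\<E> z. poisson \<rho> (return 0 n z)) \<le> harnack_const" by (simp add: eq)
qed

lemma measure_hit_le:
  assumes n: "n \<ge> 1" and r: "r n > 0"
  shows "measure \<mu> {z \<in> space \<mu>. hit r n z} \<le> 64 * harnack_const * r n"
proof -
  \<comment> \<open>The cap keeps \<open>1 - t\<close> a legitimate radius; once
    \<open>r n > 1 / 2\<close>, the condition of \<open>poisson_near\<close> holds at every point,
    because chords are at most 2.\<close>
  define t where "t = min (r n) (1 / 2)"
  have t: "0 < t" "t \<le> 1 / 2" "t \<le> r n" using r by (auto simp: t_def)
  let ?A = "{z \<in> space \<mu>. hit r n z}"
  have "measure \<mu> ?A = (\<E> z. indicator ?A z)"
    by (simp add: Int_absorb2 subset_iff)
  also have "\<dots> \<le> (\<E> z. 64 * t * poisson (1 - t) (return 0 n z))"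
  proof (rule integral_mono)
    show "integrable \<mu> (indicator ?A :: _ \<Rightarrow> real)"
      using hit_sets by (intro integrable_real_indicator) (auto simp: circle.emeasure_eq_measure)
    show "integrable \<mu> (\<lambda>z. 64 * t * poisson (1 - t) (return 0 n z))"
      using integrable_poisson_return[of "1 - t" n] t by simp
    fix z assume "z \<in> space \<mu>"
    then have w: "cmod (return 0 n z) = 1" by (simp add: return_unit)
    show "indicator ?A z \<le> 64 * t * poisson (1 - t) (return 0 n z)"
    proof (cases "z \<in> ?A")
      case True
      have "cmod (1 - return 0 n z) \<le> 7 * t"
      proof (cases "r n \<le> 1 / 2")
        case True
        have "cmod (1 - return 0 n z) \<le> 2 * pi * t"
          using cmod_one_minus_le_Arg[OF w] \<open>z \<in> ?A\<close> True by (simp add: hit_def t_def min_def)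
        also have "\<dots> \<le> 7 * t" using pi_approx t by (intro mult_right_mono) auto
        finally show ?thesis .
      next
        case False
        then have "t = 1 / 2" by (simp add: t_def)
        then show ?thesis using norm_triangle_ineq4[of 1 "return 0 n z"] w by simp
      qed
      then show ?thesis using poisson_near[OF t(1) _ w] t True by simp
    next
      case False
      then show ?thesis using poisson_nonneg[of "1 - t" "return 0 n z"] t w by simp
    qed
  qed
  also have "\<dots> = 64 * t * (\<E> z. poisson (1 - t) (return 0 n z))"
    by simp
  also have "\<dots> \<le> 64 * t * harnack_const"
    using integral_poisson_return(2)[of "1 - t" n] n t by (intro mult_left_mono) auto
  also have "\<dots> \<le> 64 * r n * harnack_const"
    using t harnack_const by (intro mult_right_mono mult_left_mono) auto
  finally show ?thesis by (simp add: mult_ac)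
qed

lemma finitely_many_hits:
  assumes r: "\<And>n. n \<ge> 1 \<Longrightarrow> r n > 0" and sum: "summable (\<lambda>n. r (Suc n))"
  shows "AE z in \<mu>. finite {n. n \<ge> 1 \<and> hit r n z}"
proof -
  let ?A = "\<lambda>n. {z \<in> space \<mu>. hit r (Suc n) z}"
  have "summable (\<lambda>n. measure \<mu> (?A n))"
  proof (rule summable_comparison_test)
    show "summable (\<lambda>n. 64 * harnack_const * r (Suc n))" by (rule summable_mult[OF sum])
    show "\<exists>N. \<forall>n\<ge>N. norm (measure \<mu> (?A n)) \<le> 64 * harnack_const * r (Suc n)"
      using measure_hit_le r by auto
  qed
  then have "AE z in \<mu>. eventually (\<lambda>n. z \<in> space \<mu> - ?A n) sequentially"
    by (intro borel_cantelli_AE1 hit_sets) (auto simp: circle.emeasure_eq_measure)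
  then show ?thesis
  proof eventually_elim
    case (elim z)
    then obtain N where N: "\<And>n. n \<ge> N \<Longrightarrow> z \<in> space \<mu> - ?A n"
      by (auto simp: eventually_sequentially)
    have "{n. n \<ge> 1 \<and> hit r n z} \<subseteq> {..N}"
    proof
      fix n assume n: "n \<in> {n. n \<ge> 1 \<and> hit r n z}"
      show "n \<in> {..N}"
      proof (rule ccontr)
        assume "n \<notin> {..N}"
        then have "n - 1 \<ge> N" by simp
        then have "z \<in> space \<mu>" "\<not> hit r (Suc (n - 1)) z" using N[of "n - 1"] by auto
        then show False using n by auto
      qed
    qed
    then show ?case by (rule finite_subset) simp
  qed
qed

end

section \<open>Infinitely many returns\<close>

context centred_inner
begin

lemma hit_indicator_measurable [measurable]:
  "(\<lambda>z. indicator {z \<in> space \<mu>. hit r n z} z :: real) \<in> borel_measurable \<mu>"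
  by (rule borel_measurable_indicator[OF hit_sets])

text \<open>The weighted kernel sum \<open>Z\<close> splits into returns, contributing at most 2
  each, and misses \<open>Y\<close>. The mean of \<open>Z\<close> grows without bound, so few
  returns force either a deviation of \<open>Z\<close> from its mean, rare by Chebyshev, or a large
  \<open>Y\<close>, of probability of order \<open>\<epsilon>\<close> by Markov. The truncated radii
  \<open>t\<close> vanish at discarded times and are not too small otherwise.\<close>

lemma few_hits_measure_le:
  fixes K :: real
  assumes t: "\<And>n. 0 \<le> t n" "\<And>n. t n \<le> 1" "\<And>n. t n \<le> r n \<or> t n = 0" "t 0 = 0"
    and t_lower: "\<And>n. t n > 0 \<Longrightarrow> 1 / (2 * (real n)\<^sup>2) \<le> t n"
    and div: "\<And>B. \<exists>N. B \<le> (\<Sum>n<N. t n)" and \<epsilon>: "0 < \<epsilon>" "\<epsilon> \<le> 1"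
  shows "measure \<mu> {z \<in> space \<mu>.
      \<forall>N. (\<Sum>n\<in>{1..<N}. indicator {z \<in> space \<mu>. hit r n z} z) \<le> K}
    \<le> \<epsilon> + 128 * \<epsilon> * harnack_const\<^sup>2" (is "measure _ ?G \<le> _")
proof -
  define c where "c = harnack_const"
  have c: "1 \<le> c" using harnack_const by (simp add: c_def)
  define s where "s n = \<epsilon> * t n" for n
  have s: "0 \<le> s n" "s n \<le> 1" "s n \<le> t n" for n
    using t(1,2)[of n] \<epsilon> by (auto simp: s_def mult_le_one mult_left_le_one_le)
  have s_pos: "t n > 0" "n \<ge> 1" if "s n > 0" for n
    using that \<epsilon> t(4) by (auto simp: s_def zero_less_mult_iff Suc_le_eq intro: gr0I)
  define h where "h n z = (indicator {z \<in> space \<mu>. hit r n z} z :: real)" for n z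
  have h01: "h n z = 0 \<or> h n z = 1" for n z by (simp add: h_def indicator_def)
  have hm [measurable]: "h n \<in> borel_measurable \<mu>" for n
    unfolding h_def by (rule hit_indicator_measurable)
  \<comment> \<open>The weight \<open>s n\<close> cancels the height of the kernel, so these
    functions lie between 0 and 2 and have means comparable to \<open>s n\<close>.\<close>
  define X where "X n z = s n * poisson (1 - s n) (return 0 n z)" for n z
  have Xm [measurable]: "X n \<in> borel_measurable \<mu>" for n
    unfolding X_def by measurable
  have X0: "0 \<le> X n z" and X2: "X n z \<le> 2" if z: "cmod z = 1" for n z
  proof -
    show "0 \<le> X n z"
    proof (cases "s n = 0")
      case False
      then show ?thesis unfolding X_def
        using s[of n] poisson_nonneg[of "1 - s n" "return 0 n z"] return_unit[OF z, of 0 n] by simp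
    qed (simp add: X_def)
    show "X n z \<le> 2"
    proof (cases "s n = 0")
      case False
      then have sn: "s n > 0" using s[of n] by simp
      have "poisson (1 - s n) (return 0 n z) \<le> (2 - s n) / s n"
        using sn s[of n] poisson_bound(2)[of "1 - s n" "return 0 n z"] return_unit[OF z, of 0 n] by simp
      then have "X n z \<le> s n * ((2 - s n) / s n)"
        unfolding X_def using sn by (intro mult_left_mono) auto
      then show ?thesis using sn by simp
    qed (simp add: X_def)
  qed
  have EX: "s n / c \<le> (\<E> z. X n z)" "(\<E> z. X n z) \<le> s n * c" for n
  proof -
    have eq: "(\<E> z. X n z) = s n * (\<E> z. poisson (1 - s n) (return 0 n z))"
      unfolding X_def by (rule integral_mult_right_zero)
    have "s n * (1 / c) \<le> (\<E> z. X n z) \<and> (\<E> z. X n z) \<le> s n * c"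
    proof (cases "s n = 0")
      case False
      then have "s n > 0" using s[of n] by simp
      then show ?thesis unfolding eq c_def
        using integral_poisson_return[of "1 - s n" n] s[of n] s_pos[of n] by (intro conjI mult_left_mono) auto
    qed (simp add: eq)
    then show "s n / c \<le> (\<E> z. X n z)" "(\<E> z. X n z) \<le> s n * c"
      by auto
  qed
  have iX: "integrable \<mu> (X n)" for n
    by (rule integrable_circle[where C = 2]) (use X0 X2 in auto)
  have iXX: "integrable \<mu> (\<lambda>z. X m z * X n z)" for m n
  proof (rule integrable_circle)
    show "norm (X m z * X n z) \<le> 2 * 2" if z: "cmod z = 1" for z
      unfolding norm_mult using X0[OF z] X2[OF z] by (intro mult_mono) auto
  qed measurable
  define C where "C = 76 / (1 - \<alpha>)\<^sup>2"
  have C: "C \<ge> 0" by (simp add: C_def)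
  define D where "D = C * (4 / \<epsilon>\<^sup>2)"
  have D: "D \<ge> 0" using C by (simp add: D_def)
  \<comment> \<open>The first term sums over \<open>m < n\<close> to at most a multiple of
    \<open>s n\<close>. The second is the loss \<open>1 / (s m)^2\<close>, traded for a polynomial
    in \<open>n\<close> by \<open>t_lower\<close>; summed over \<open>m\<close> it is still summable
    in \<open>n\<close> thanks to \<open>\<sigma> ^ n\<close>.\<close>
  define q where "q m n = C * (s n * \<alpha> ^ (n - m)) + D * (real n ^ 4 * \<sigma> ^ n)" for m n
  have q0: "0 \<le> q m n" for m n
    using C D s[of n] \<sigma>(1) by (simp add: q_def)
  have diag: "(\<E> z. (X n z)\<^sup>2) \<le> 2 * c * s n" for n
  proof -
    have "(\<E> z. (X n z)\<^sup>2) \<le> (\<E> z. 2 * X n z)"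
    proof (rule integral_mono)
      show "integrable \<mu> (\<lambda>z. (X n z)\<^sup>2)" using iXX[of n n] by (simp add: power2_eq_square)
      show "integrable \<mu> (\<lambda>z. 2 * X n z)" using iX by simp
      show "(X n z)\<^sup>2 \<le> 2 * X n z" if "z \<in> space \<mu>" for z
        using X0[of z n] X2[of z n] that unfolding power2_eq_square by (intro mult_right_mono) auto
    qed
    then have "(\<E> z. (X n z)\<^sup>2) \<le> 2 * (s n * c)" using EX(2)[of n] by simp
    then show ?thesis by (simp add: mult_ac)
  qed
  have off: "(\<E> z. X m z * X n z)
      \<le> (\<E> z. X m z) * (\<E> z. X n z) + q m n" if mn: "m < n" for m n
  proof (cases "s m = 0 \<or> s n = 0")
    case True
    then show ?thesis using q0 by (auto simp: X_def)
  next
    case False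
    then have sp: "s m > 0" "s n > 0" using s[of m] s[of n] by auto
    have m1: "m \<ge> 1" using s_pos(2)[OF sp(1)] .
    have n_eq: "m + (n - m) = n" using mn by simp
    define P where "P k z = poisson (1 - s k) (return 0 k z)" for k z
    have PP: "(\<E> z. P m z * P n z)
      \<le> (\<E> z. P m z) * (\<E> z. P n z)
        + C * (\<alpha> ^ (n - m) + \<sigma> ^ n / (s m ^ 3 * s n))"
      using poisson_correlation[OF m1 _ sp(1) s(2) sp(2) s(2), of "n - m"] mn n_eq
      unfolding P_def C_def by simp
    have EXP: "(\<E> z. X k z) = s k * (\<E> z. P k z)" for k
      unfolding X_def P_def by (rule integral_mult_right_zero)
    have "(\<E> z. X m z * X n z) = (\<E> z. (s m * s n) * (P m z * P n z))"
      unfolding X_def P_def by (simp add: mult_ac)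
    also have "\<dots> = (s m * s n) * (\<E> z. P m z * P n z)"
      by (rule integral_mult_right_zero)
    also have "\<dots> \<le> (s m * s n) * ((\<E> z. P m z) * (\<E> z. P n z)
        + C * (\<alpha> ^ (n - m) + \<sigma> ^ n / (s m ^ 3 * s n)))"
      using PP sp by (intro mult_left_mono) auto
    also have "\<dots> = (\<E> z. X m z) * (\<E> z. X n z)
        + C * (s m * s n * \<alpha> ^ (n - m) + \<sigma> ^ n * (1 / (s m)\<^sup>2))"
      unfolding EXP using sp by (simp add: field_simps power2_eq_square power3_eq_cube)
    also have "C * (s m * s n * \<alpha> ^ (n - m) + \<sigma> ^ n * (1 / (s m)\<^sup>2))
        \<le> C * (s n * \<alpha> ^ (n - m) + \<sigma> ^ n * (4 / \<epsilon>\<^sup>2 * real n ^ 4))"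
    proof (intro mult_left_mono add_mono C)
      show "s m * s n * \<alpha> ^ (n - m) \<le> s n * \<alpha> ^ (n - m)"
        using s[of m] sp by (intro mult_right_mono mult_left_le_one_le) auto
      have "\<epsilon> / (2 * (real m)\<^sup>2) \<le> s m"
        unfolding s_def using mult_left_mono[OF t_lower[OF s_pos(1)[OF sp(1)]], of \<epsilon>] \<epsilon> by simp
      moreover have p: "0 < \<epsilon> / (2 * (real m)\<^sup>2)" using \<epsilon> m1 by simp
      ultimately have "1 / (s m)\<^sup>2 \<le> 1 / (\<epsilon> / (2 * (real m)\<^sup>2))\<^sup>2"
        using sp by (intro divide_left_mono power_mono mult_pos_pos zero_less_power) auto
      also have "\<dots> = 4 / \<epsilon>\<^sup>2 * real m ^ 4"
        by (simp add: power_divide power_mult_distrib flip: power_mult)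
      also have "\<dots> \<le> 4 / \<epsilon>\<^sup>2 * real n ^ 4" using mn by (intro mult_left_mono power_mono) auto
      finally show "1 / (s m)\<^sup>2 \<le> 4 / \<epsilon>\<^sup>2 * real n ^ 4" .
    qed (use \<sigma>(1) in auto)
    finally show ?thesis by (simp add: q_def D_def algebra_simps)
  qed
  have qsum: "(\<Sum>m<n. q m n) \<le> C / (1 - \<alpha>) * s n + D * (real n ^ 5 * \<sigma> ^ n)" for n
  proof -
    have "(\<Sum>m<n. \<alpha> ^ (n - m)) \<le> (\<Sum>m<n. \<alpha> ^ (n - Suc m))"
      using deriv_less_1 by (intro sum_mono power_decreasing) auto
    also have "\<dots> = (\<Sum>i<n. \<alpha> ^ i)" by (rule sum.nat_diff_reindex)
    also have "\<dots> \<le> 1 / (1 - \<alpha>)" using deriv_less_1 by (intro geometric_partial_sum_le) auto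
    finally have g: "(\<Sum>m<n. \<alpha> ^ (n - m)) \<le> 1 / (1 - \<alpha>)" .
    have "(\<Sum>m<n. q m n) = (C * s n) * (\<Sum>m<n. \<alpha> ^ (n - m)) + D * (real n ^ 5 * \<sigma> ^ n)"
      by (simp add: q_def sum.distrib sum_distrib_left mult_ac power_Suc[symmetric] numeral_eq_Suc)
    also have "\<dots> \<le> (C * s n) * (1 / (1 - \<alpha>)) + D * (real n ^ 5 * \<sigma> ^ n)"
      using C D s[of n] by (intro add_mono mult_left_mono g) auto
    finally show ?thesis by simp
  qed
  define W where "W = (\<Sum>n. real n ^ 5 * \<sigma> ^ n)"
  have W: "(\<Sum>n<N. real n ^ 5 * \<sigma> ^ n) \<le> W" for N
    unfolding W_def using \<sigma>(1,2) by (intro sum_le_suminf summable_power_times_geometric) auto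
  have W0: "0 \<le> W" using W[of 0] by simp
  define A where "A = 2 * c + 2 * (C / (1 - \<alpha>))"
  have A: "0 \<le> A" using c C deriv_less_1 by (simp add: A_def)
  define S where "S N = (\<Sum>n<N. s n)" for N
  have S0: "0 \<le> S N" for N unfolding S_def by (intro sum_nonneg s)
  have total: "(\<Sum>n<N. 2 * c * s n + 2 * (\<Sum>m<n. q m n)) \<le> A * S N + 2 * D * W" for N
  proof -
    have "(\<Sum>n<N. 2 * c * s n + 2 * (\<Sum>m<n. q m n))
        \<le> (\<Sum>n<N. A * s n + 2 * D * (real n ^ 5 * \<sigma> ^ n))"
    proof (rule sum_mono)
      fix n
      show "2 * c * s n + 2 * (\<Sum>m<n. q m n) \<le> A * s n + 2 * D * (real n ^ 5 * \<sigma> ^ n)"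
        using mult_left_mono[OF qsum[of n], of 2] by (simp add: A_def algebra_simps)
    qed
    also have "\<dots> = A * S N + 2 * D * (\<Sum>n<N. real n ^ 5 * \<sigma> ^ n)"
      by (simp add: S_def sum.distrib sum_distrib_left)
    also have "\<dots> \<le> A * S N + 2 * D * W" using A D W by (intro add_mono mult_left_mono) auto
    finally show ?thesis .
  qed
  define Z where "Z N z = (\<Sum>n<N. X n z)" for N z
  define EZ where "EZ N = (\<E> z. Z N z)" for N
  have iZ: "integrable \<mu> (Z N)" for N
    unfolding Z_def by (intro Bochner_Integration.integrable_sum iX)
  have Zm [measurable]: "Z N \<in> borel_measurable \<mu>" for N
    by (rule borel_measurable_integrable[OF iZ])
  have EZ: "S N / c \<le> EZ N" for N
  proof -
    have "EZ N = (\<Sum>n<N. \<E> z. X n z)"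
      unfolding EZ_def Z_def by (rule Bochner_Integration.integral_sum) (rule iX)
    then show ?thesis unfolding S_def sum_divide_distrib using EX(1) by (simp add: sum_mono)
  qed
  have iZZ: "integrable \<mu> (\<lambda>z. (Z N z)\<^sup>2)" for N
    unfolding power2_eq_square Z_def sum_product by (intro Bochner_Integration.integrable_sum iXX)
  have iV: "integrable \<mu> (\<lambda>z. (Z N z - EZ N)\<^sup>2)" for N
    unfolding power2_diff using iZZ[of N] iZ[of N] by simp
  have var: "(\<E> z. (Z N z - EZ N)\<^sup>2) \<le> A * S N + 2 * D * W" for N
  proof -
    have "(\<E> z. (Z N z - EZ N)\<^sup>2)
        = (\<E> z. (Z N z)\<^sup>2) + (EZ N)\<^sup>2 - 2 * EZ N * EZ N"
      unfolding power2_diff using iZZ[of N] iZ[of N] circle.prob_space by (simp add: EZ_def mult_ac)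
    also have "\<dots> = (\<E> z. (Z N z)\<^sup>2) - (EZ N)\<^sup>2"
      by (simp add: power2_eq_square)
    also have "\<dots> \<le> (\<Sum>n<N. 2 * c * s n + 2 * (\<Sum>m<n. q m n))"
      using second_moment_growth[of X 2 "\<lambda>n. 2 * c * s n" q N, OF Xm _ diag off] X0 X2
      by (auto simp: Z_def EZ_def)
    also have "\<dots> \<le> A * S N + 2 * D * W" by (rule total)
    finally show ?thesis .
  qed
  define Y where "Y N z = (\<Sum>n<N. X n z * (1 - h n z))" for N z
  have iXh: "integrable \<mu> (\<lambda>z. X n z * (1 - h n z))" for n
  proof (rule integrable_circle[where C = 2])
    show "norm (X n z * (1 - h n z)) \<le> 2" if "cmod z = 1" for z
      using X0[OF that, of n] X2[OF that, of n] h01[of n z] by auto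
  qed measurable
  have iY: "integrable \<mu> (Y N)" for N
    unfolding Y_def by (intro Bochner_Integration.integrable_sum iXh)
  have Ym [measurable]: "Y N \<in> borel_measurable \<mu>" for N
    by (rule borel_measurable_integrable[OF iY])
  \<comment> \<open>A miss puts the return function outside the arc of radius \<open>t n\<close>,
    where the kernel at scale \<open>s n = \<epsilon> t n\<close> is at most
    \<open>32 \<epsilon>\<close> times the kernel at scale \<open>t n\<close>; the latter has mean
    at most \<open>c\<close>.\<close>
  have EXh: "(\<E> z. X n z * (1 - h n z)) \<le> 32 * \<epsilon> * c * s n" for n
  proof (cases "s n = 0")
    case True
    then show ?thesis by (simp add: X_def)
  next
    case False
    then have sn: "s n > 0" using s[of n] by simp
    note tn = s_pos[OF sn]
    have tr: "t n \<le> r n" using t(3)[of n] tn by auto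
    have \<rho>: "0 \<le> 1 - t n" "1 - t n < 1" using tn t(2)[of n] by auto
    have "(\<E> z. X n z * (1 - h n z))
        \<le> (\<E> z. (s n * (32 * \<epsilon>)) * poisson (1 - t n) (return 0 n z))"
    proof (rule integral_mono[OF iXh])
      show "integrable \<mu> (\<lambda>z. (s n * (32 * \<epsilon>)) * poisson (1 - t n) (return 0 n z))"
        using integrable_poisson_return[OF \<rho>] by simp
      fix z assume z: "z \<in> space \<mu>"
      then have w: "cmod (return 0 n z) = 1" by (simp add: return_unit)
      show "X n z * (1 - h n z) \<le> (s n * (32 * \<epsilon>)) * poisson (1 - t n) (return 0 n z)"
      proof (cases "hit r n z")
        case True
        then show ?thesis using z sn \<epsilon> poisson_nonneg[OF \<rho>, of "return 0 n z"] w by (simp add: h_def)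
      next
        case False
        then have "2 * pi * t n \<le> \<bar>Arg (return 0 n z)\<bar>"
          using order_trans[OF mult_left_mono[OF tr, of "2 * pi"]] by (simp add: hit_def not_less)
        then have "2 * (2 * pi * t n) / pi \<le> 2 * \<bar>Arg (return 0 n z)\<bar> / pi"
          by (intro divide_right_mono mult_left_mono) auto
        then have "2 * t n \<le> cmod (1 - return 0 n z)"
          using cmod_one_minus_ge_Arg[OF w] tn by simp
        then have "poisson (1 - s n) (return 0 n z) \<le> 32 * \<epsilon> * poisson (1 - t n) (return 0 n z)"
          unfolding s_def using tn t(2) \<epsilon> w by (intro poisson_far) auto
        then have "s n * poisson (1 - s n) (return 0 n z) \<le> s n * (32 * \<epsilon> * poisson (1 - t n) (return 0 n z))"
          using sn by (intro mult_left_mono) auto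
        then show ?thesis using False by (simp add: h_def X_def mult_ac)
      qed
    qed
    also have "\<dots> = (s n * (32 * \<epsilon>)) * (\<E> z. poisson (1 - t n) (return 0 n z))"
      by (rule integral_mult_right_zero)
    also have "\<dots> \<le> (s n * (32 * \<epsilon>)) * c"
      unfolding c_def using integral_poisson_return(2)[OF \<rho> tn(2)] sn \<epsilon> by (intro mult_left_mono) auto
    finally show ?thesis by (simp add: mult_ac)
  qed
  have EY: "(\<E> z. Y N z) \<le> 32 * \<epsilon> * c * S N" for N
  proof -
    have "(\<E> z. Y N z) = (\<Sum>n<N. \<E> z. X n z * (1 - h n z))"
      unfolding Y_def by (rule Bochner_Integration.integral_sum) (rule iXh)
    also have "\<dots> \<le> (\<Sum>n<N. 32 * \<epsilon> * c * s n)" by (intro sum_mono EXh)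
    finally show ?thesis by (simp add: S_def sum_distrib_left)
  qed
  \<comment> \<open>The term at time 0 has weight 0 because \<open>t 0 = 0\<close>, so the count may
    start at 1.\<close>
  have ZHY: "Z N z \<le> 2 * (\<Sum>n\<in>{1..<N}. h n z) + Y N z" if z: "cmod z = 1" for N z
  proof -
    have "Z N z - Y N z = (\<Sum>n<N. X n z * h n z)"
      by (simp add: Z_def Y_def algebra_simps flip: sum_subtractf)
    also have "\<dots> = (\<Sum>n\<in>{1..<N}. X n z * h n z)"
      by (rule sum.mono_neutral_right) (auto simp: X_def s_def t(4) not_le)
    also have "\<dots> \<le> (\<Sum>n\<in>{1..<N}. 2 * h n z)"
      using X2[OF z] h01 by (intro sum_mono mult_right_mono) (auto simp: h_def)
    finally show ?thesis by (simp add: sum_distrib_left)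
  qed
  \<comment> \<open>Three demands on the total weight: at least 1, so that constants may be
    multiplied by it; more than \<open>8 c \<bar>K\<bar>\<close>, for the contradiction below; and
    so large that Chebyshev's bound is at most \<open>\<epsilon>\<close>.\<close>
  define Q where "Q = Max {1, 8 * c * \<bar>K\<bar> + 1, 4 * c\<^sup>2 * (A + 2 * D * W) / \<epsilon>}"
  have Q: "1 \<le> Q" "8 * c * \<bar>K\<bar> < Q" "4 * c\<^sup>2 * (A + 2 * D * W) / \<epsilon> \<le> Q"
    unfolding Q_def by (auto simp: less_max_iff_disj le_max_iff_disj)
  obtain N where "Q / \<epsilon> \<le> (\<Sum>n<N. t n)" using div by blast
  then have "Q \<le> S N" using \<epsilon> by (simp add: S_def s_def divide_le_eq mult.commute flip: sum_distrib_left)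
  \<comment> \<open>The mean of \<open>Z\<close> is at least \<open>S N / c\<close>; the thresholds
    are a half and a quarter of this. If neither is reached, the returns contribute more than the
    remaining quarter.\<close>
  define a where "a = S N / (2 * c)"
  define b where "b = S N / (4 * c)"
  have SN: "1 \<le> S N" "8 * c * \<bar>K\<bar> < S N" "4 * c\<^sup>2 * (A + 2 * D * W) / \<epsilon> \<le> S N"
    using Q \<open>Q \<le> S N\<close> by auto
  have ab: "0 < a" "0 < b" using SN c by (auto simp: a_def b_def)
  let ?U = "{z \<in> space \<mu>. a \<le> \<bar>Z N z - EZ N\<bar>}"
  let ?V = "{z \<in> space \<mu>. b \<le> Y N z}"
  have "?G \<subseteq> ?U \<union> ?V"
  proof
    fix z assume z: "z \<in> ?G"
    then have z1: "cmod z = 1" by simp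
    have H: "(\<Sum>n\<in>{1..<N}. h n z) \<le> K" using z by (auto simp: h_def)
    show "z \<in> ?U \<union> ?V"
    proof (rule ccontr)
      assume "z \<notin> ?U \<union> ?V"
      then have "EZ N - Z N z < a" "Y N z < b" using z by auto
      moreover have "Z N z \<le> 2 * K + Y N z" using ZHY[OF z1, of N] H by simp
      moreover have "2 * a \<le> EZ N" using EZ[of N] by (simp add: a_def)
      moreover have "a = 2 * b" by (simp add: a_def b_def)
      ultimately have "b < 2 * K" by linarith
      then have "S N < 8 * c * K" using c by (simp add: b_def divide_less_eq mult_ac)
      also have "\<dots> \<le> 8 * c * \<bar>K\<bar>" using c by (intro mult_left_mono) auto
      finally show False using SN by simp
    qed
  qed
  then have "measure \<mu> ?G \<le> measure \<mu> (?U \<union> ?V)"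
    by (rule circle.finite_measure_mono) measurable
  also have "\<dots> \<le> measure \<mu> ?U + measure \<mu> ?V"
    by (rule measure_Un_le) measurable
  also have "measure \<mu> ?U \<le> (\<E> z. (Z N z - EZ N)\<^sup>2) / a\<^sup>2"
    by (rule circle.second_moment_method) (use iV ab in auto)
  also have "\<dots> \<le> (A * S N + 2 * D * W) / a\<^sup>2" by (intro divide_right_mono var) auto
  also have "\<dots> \<le> (A * S N + 2 * D * W * S N) / a\<^sup>2"
    using SN(1) D W0 mult_left_mono[of 1 "S N" "2 * D * W"] by (intro divide_right_mono add_mono) auto
  also have "\<dots> = 4 * c\<^sup>2 * (A + 2 * D * W) / S N"
    using SN(1) c by (simp add: a_def field_simps power2_eq_square)
  also have "\<dots> \<le> \<epsilon>"
    using SN \<epsilon> by (simp add: divide_le_eq mult.commute)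
  also have "measure \<mu> ?V \<le> (\<E> z. Y N z) / b"
  proof (rule integral_Markov_inequality_measure[OF iY])
    show "AE z in \<mu>. 0 \<le> Y N z"
      unfolding Y_def by (intro AE_I2 sum_nonneg mult_nonneg_nonneg) (use X0 h01 in \<open>auto simp: h_def\<close>)
  qed (use ab in auto)
  also have "\<dots> \<le> 32 * \<epsilon> * c * S N / b" using ab EY by (intro divide_right_mono) auto
  also have "\<dots> = 128 * \<epsilon> * c\<^sup>2" using SN(1) c by (simp add: b_def power2_eq_square)
  finally show ?thesis by (simp add: c_def)
qed

text \<open>Points with finitely many returns are exhausted by the countably many sets
  \<open>G K\<close>, each of measure 0 because \<open>few_hits_measure_le\<close> holds for
  arbitrarily small \<open>\<epsilon>\<close>.\<close>

lemma infinitely_many_hits: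
  assumes r: "\<And>n. n \<ge> 1 \<Longrightarrow> r n > 0" and nsum: "\<not> summable (\<lambda>n. r (Suc n))"
  shows "AE z in \<mu>. infinite {n. n \<ge> 1 \<and> hit r n z}"
proof -
  \<comment> \<open>Times with \<open>r n < 1 / n^2\<close> are switched off and large radii are
    capped at \<open>1 / 2\<close>; the cap is why the lower bound below carries a factor 2.\<close>
  define t where "t n = (if n \<ge> 1 \<and> 1 / (real n)\<^sup>2 \<le> r n then min (r n) (1 / 2) else 0)" for n
  have t: "0 \<le> t n" "t n \<le> 1" "t n \<le> r n \<or> t n = 0" "t 0 = 0" for n
    using r[of n] by (auto simp: t_def)
  have t_lower: "1 / (2 * (real n)\<^sup>2) \<le> t n" if "t n > 0" for n
  proof -
    have n: "n \<ge> 1" "1 / (real n)\<^sup>2 \<le> r n" "t n = min (r n) (1 / 2)"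
      using that by (auto simp: t_def split: if_splits)
    have "1 \<le> (real n)\<^sup>2" using n(1) by (intro one_le_power) simp
    then have "1 / (2 * (real n)\<^sup>2) \<le> 1 / 2" "1 / (2 * (real n)\<^sup>2) \<le> 1 / (real n)\<^sup>2"
      using n(1) by (intro frac_le; simp)+
    then show ?thesis using n by auto
  qed
  \<comment> \<open>A summable \<open>t\<close> tends to 0, so the cap is eventually inactive and
    \<open>r n\<close> is at most \<open>t n + 1 / n^2\<close>, contradicting divergence.\<close>
  have nt: "\<not> summable t"
  proof
    assume st: "summable t"
    then have "\<forall>\<^sub>F n in sequentially. t n < 1 / 2"
      by (intro order_tendstoD(2)[OF summable_LIMSEQ_zero]) auto
    then have ev: "\<forall>\<^sub>F n in sequentially. t (Suc n) < 1 / 2"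
      using eventually_sequentially_Suc[of "\<lambda>n. t n < 1 / 2"] by blast
    have "summable (\<lambda>n. t (Suc n) + inverse (real (Suc n) ^ 2))"
      using st inverse_power_summable[of 2, where 'a = real]
      by (intro summable_add) (auto simp: summable_Suc_iff simp del: of_nat_Suc intro: summable_Suc_iff[THEN iffD2])
    moreover have "\<forall>\<^sub>F n in sequentially. norm (r (Suc n)) \<le> t (Suc n) + inverse (real (Suc n) ^ 2)"
      using ev
    proof eventually_elim
      case (elim n)
      have "0 \<le> inverse (real (Suc n) ^ 2)" by simp
      then show ?case using elim r[of "Suc n"] t(1)[of "Suc n"]
        by (auto simp: t_def min_def inverse_eq_divide not_le split: if_splits)
    qed
    ultimately have "summable (\<lambda>n. r (Suc n))"
      by (rule summable_comparison_test_ev[rotated])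
    then show False using nsum by simp
  qed
  have div: "\<exists>N. B \<le> (\<Sum>n<N. t n)" for B
  proof (rule ccontr)
    assume "\<not> ?thesis"
    then have "(\<Sum>n<N. t n) \<le> B" for N by (auto simp: not_le intro: less_imp_le)
    then have "summable t" by (intro summableI_nonneg_bounded[of t B] t)
    then show False using nt by simp
  qed
  define G where "G K = {z \<in> space \<mu>.
      \<forall>N. (\<Sum>n\<in>{1..<N}. indicator {z \<in> space \<mu>. hit r n z} z) \<le> real K}" for K
  have Gm: "G K \<in> sets \<mu>" for K
    unfolding G_def by measurable
  have "measure \<mu> (G K) = 0" for K
  proof (rule antisym)
    define c where "c = 1 + 128 * harnack_const\<^sup>2"
    have c: "c > 0" by (simp add: c_def add_pos_nonneg)
    show "measure \<mu> (G K) \<le> 0"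
    proof (rule field_le_epsilon)
      fix e :: real assume e: "e > 0"
      define \<epsilon> where "\<epsilon> = min 1 (e / c)"
      have \<epsilon>: "0 < \<epsilon>" "\<epsilon> \<le> 1" using e c by (auto simp: \<epsilon>_def)
      have "measure \<mu> (G K) \<le> \<epsilon> + 128 * \<epsilon> * harnack_const\<^sup>2"
        unfolding G_def by (rule few_hits_measure_le[OF t t_lower div \<epsilon>])
      also have "\<dots> = \<epsilon> * c" by (simp add: c_def algebra_simps)
      also have "\<dots> \<le> e / c * c" using c by (intro mult_right_mono) (auto simp: \<epsilon>_def)
      finally show "measure \<mu> (G K) \<le> 0 + e" using c by simp
    qed
  qed simp
  then have "G K \<in> null_sets \<mu>" for K
    using Gm by (auto simp: null_sets_def circle.emeasure_eq_measure)
  then have "AE z in \<mu>. z \<notin> G K" for K by (rule AE_not_in)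
  then have "AE z in \<mu>. \<forall>K. z \<notin> G K" by (simp add: AE_all_countable)
  then show ?thesis using AE_space
  proof eventually_elim
    case (elim z)
    show ?case
    proof
      assume fin: "finite {n. n \<ge> 1 \<and> hit r n z}"
      have "(\<Sum>n\<in>{1..<N}. indicator {z \<in> space \<mu>. hit r n z} z)
          \<le> real (card {n. n \<ge> 1 \<and> hit r n z})" for N
      proof -
        have "(\<Sum>n\<in>{1..<N}. indicator {z \<in> space \<mu>. hit r n z} z)
          = real (card {n \<in> {1..<N}. hit r n z})"
          using elim(2) by (simp add: indicator_def sum.If_cases Int_def)
        also have "\<dots> \<le> real (card {n. n \<ge> 1 \<and> hit r n z})"
          using fin by (auto intro!: card_mono)
        finally show ?thesis .
      qed
      then show False using elim by (auto simp: G_def)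
    qed
  qed
qed

end

section \<open>Measurability of the boundary map\<close>

lemma at_left_one_seq: "filterlim (\<lambda>n. 1 - 1 / real (n + 2)) (at_left 1) sequentially"
proof (rule tendsto_imp_filterlim_at_left)
  show "(\<lambda>n. 1 - 1 / real (n + 2)) \<longlonglongrightarrow> 1" by real_asymp
qed auto

text \<open>Rational radii make the existence of a unimodular radial limit a Borel condition.\<close>

lemma has_boundary_value_iff:
  assumes f: "f holomorphic_on unit_disk" and z: "cmod z = 1"
  shows "has_boundary_value f z \<longleftrightarrow> (\<forall>k::nat. \<exists>N::nat. \<forall>p::rat. \<forall>q::rat.
      1 - 1 / real (N + 2) < of_rat p \<and> of_rat p < (1::real) \<and> 1 - 1 / real (N + 2) < of_rat q \<and> of_rat q < (1::real) \<longrightarrow>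
      dist (f (of_real (of_rat p) * z)) (f (of_real (of_rat q) * z)) < 1 / real (k + 1) \<and>
      \<bar>cmod (f (of_real (of_rat q) * z)) - 1\<bar> < 1 / real (k + 1))"
    (is "_ \<longleftrightarrow> (\<forall>k. \<exists>N. \<forall>p q. ?A N p q \<longrightarrow> ?B k p q)" is "_ \<longleftrightarrow> ?Q")
proof
  assume "has_boundary_value f z"
  then obtain w where w: "cmod w = 1" and lim: "((\<lambda>r. f (of_real r * z)) \<longlongrightarrow> w) (at_left 1)"
    by (auto simp: has_boundary_value_def)
  show ?Q
  proof
    fix k :: nat
    have "\<forall>\<^sub>F r in at_left 1. dist (f (of_real r * z)) w < 1 / real (k + 1) / 2"
      by (rule tendstoD[OF lim]) simp
    then obtain b where b: "b < 1" "\<And>r. b < r \<Longrightarrow> r < 1 \<Longrightarrow> dist (f (of_real r * z)) w < 1 / real (k + 1) / 2"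
      unfolding eventually_at_left_field by blast
    have "\<forall>\<^sub>F n in sequentially. b < 1 - 1 / real (n + 2)"
      by (rule order_tendstoD(1)[OF _ b(1)]) real_asymp
    then obtain N where N: "b < 1 - 1 / real (N + 2)" by (auto simp: eventually_sequentially)
    show "\<exists>N. \<forall>p q. ?A N p q \<longrightarrow> ?B k p q"
    proof (intro exI[of _ N] allI impI)
      fix p q :: rat
      assume pq: "?A N p q"
      have dp: "dist (f (of_real (of_rat p) * z)) w < 1 / real (k + 1) / 2"
        and dq: "dist (f (of_real (of_rat q) * z)) w < 1 / real (k + 1) / 2"
        using pq N by (intro b(2); linarith)+
      have "dist (f (of_real (of_rat p) * z)) (f (of_real (of_rat q) * z)) < 1 / real (k + 1)"
        using dist_triangle_half_l[OF dp dq] .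
      moreover have "\<bar>cmod (f (of_real (of_rat q) * z)) - 1\<bar> \<le> dist (f (of_real (of_rat q) * z)) w"
        using norm_triangle_ineq3[of "f (of_real (of_rat q) * z)" w] w by (simp add: dist_norm)
      moreover have "1 / real (k + 1) / 2 \<le> 1 / real (k + 1)" by (simp add: field_simps)
      ultimately show "?B k p q"
        using dq by linarith
    qed
  qed
next
  assume Q: ?Q
  \<comment> \<open>These radii are rational, so the criterion applies to them and yields the
    candidate limit; the shift by 2 keeps them positive.\<close>
  define x where "x n = f (of_real (1 - 1 / real (n + 2)) * z)" for n
  have x_rat: "\<exists>p::rat. (of_rat p :: real) = 1 - 1 / real (n + 2)" for n
    by (rule exI[of _ "1 - 1 / rat_of_nat (n + 2)"]) (simp add: of_rat_diff of_rat_divide of_rat_add)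
  have in_range: "1 - 1 / real (N + 2) < 1 - 1 / real (n + 2)" if "n > N" for n N :: nat
    using that by (simp add: frac_less2)
  have "Cauchy x"
  proof (rule metric_CauchyI)
    fix e :: real assume "e > 0"
    obtain k where "1 / real (Suc k) < e" by (rule nat_approx_posE[OF \<open>e > 0\<close>])
    then have k: "1 / real (k + 1) < e" by simp
    obtain N where N: "\<forall>p q. ?A N p q \<longrightarrow> ?B k p q"
      using Q[THEN spec, of k] by (rule exE)
    show "\<exists>M. \<forall>m\<ge>M. \<forall>n\<ge>M. dist (x m) (x n) < e"
    proof (intro exI[of _ "Suc N"] allI impI)
      fix m n assume mn: "Suc N \<le> m" "Suc N \<le> n"
      obtain p q :: rat where pq: "(of_rat p :: real) = 1 - 1 / real (m + 2)" "(of_rat q :: real) = 1 - 1 / real (n + 2)"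
        using x_rat by metis
      have "dist (x m) (x n) < 1 / real (k + 1)"
        unfolding x_def pq[symmetric]
        by (rule N[rule_format, THEN conjunct1]) (use pq in_range[of N m] in_range[of N n] mn in auto)
      then show "dist (x m) (x n) < e" using k by simp
    qed
  qed
  then obtain w where w: "x \<longlonglongrightarrow> w" by (metis Cauchy_convergent convergentD)
  \<comment> \<open>Passes from rational to all radii: by continuity inside the disc some rational
    radius gives a value within \<open>1 / (k + 1)\<close>, and the criterion puts that value within
    \<open>1 / (k + 1)\<close> of \<open>w\<close>.\<close>
  have near: "\<exists>b<1. \<forall>r. b < r \<and> r < 1 \<longrightarrow> dist (f (of_real r * z)) w \<le> 2 / real (k + 1) \<and>
      \<bar>cmod (f (of_real r * z)) - 1\<bar> \<le> 2 / real (k + 1)" for k :: nat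
  proof -
    obtain N where N: "\<forall>p q. ?A N p q \<longrightarrow> ?B k p q"
      using Q[THEN spec, of k] by (rule exE)
    show ?thesis
    proof (intro exI[of _ "1 - 1 / real (N + 2)"] conjI allI impI)
      fix r :: real assume r: "1 - 1 / real (N + 2) < r \<and> r < 1"
      have "1 / real (N + 2) \<le> 1" by simp
      then have r0: "r > 0" using r by linarith
      have isc: "isCont (\<lambda>s. f (of_real s * z)) r"
      proof -
        have "continuous_on {0<..<1} (\<lambda>s::real. f (of_real s * z))"
          by (rule continuous_on_compose2[OF holomorphic_on_imp_continuous_on[OF f]])
             (use z in \<open>auto intro!: continuous_intros simp: norm_mult\<close>)
        then show ?thesis using r r0 by (simp add: continuous_on_eq_continuous_at)
      qed
      have pos: "0 < 1 / real (k + 1)" by simp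
      have "\<exists>d>0. \<forall>s. dist s r < d \<longrightarrow> dist (f (of_real s * z)) (f (of_real r * z)) < 1 / real (k + 1)"
        by (rule continuous_at_eps_delta[THEN iffD1, OF isc, THEN spec, THEN mp, OF pos])
      then obtain d where d: "d > 0" "\<And>s. \<bar>s - r\<bar> < d \<Longrightarrow> dist (f (of_real s * z)) (f (of_real r * z)) < 1 / real (k + 1)"
        by (auto simp: dist_real_def)
      obtain q0 :: rat where q0: "r < of_rat q0" "of_rat q0 < min 1 (r + d)"
        using of_rat_dense[of r "min 1 (r + d)"] r d(1) by auto
      have q: "1 - 1 / real (N + 2) < of_rat q0" "of_rat q0 < (1::real)" "\<bar>of_rat q0 - r\<bar> < d"
        using q0 r by auto
      have dr: "dist (f (of_real r * z)) (f (of_real (of_rat q0) * z)) < 1 / real (k + 1)"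
        using d(2)[OF q(3)] by (simp add: dist_commute)
      have "dist (f (of_real (of_rat q0) * z)) w \<le> 1 / real (k + 1)"
      proof (rule LIMSEQ_le_const2[OF tendsto_dist[OF tendsto_const w]])
        show "\<exists>M. \<forall>n\<ge>M. dist (f (of_real (of_rat q0) * z)) (x n) \<le> 1 / real (k + 1)"
        proof (intro exI[of _ "Suc N"] allI impI)
          fix n assume n: "Suc N \<le> n"
          obtain p :: rat where p: "(of_rat p :: real) = 1 - 1 / real (n + 2)" using x_rat by metis
          have "dist (f (of_real (of_rat q0) * z)) (f (of_real (of_rat p) * z)) < 1 / real (k + 1)"
            using N[rule_format, of q0 p] q p in_range[of N n] n by auto
          then show "dist (f (of_real (of_rat q0) * z)) (x n) \<le> 1 / real (k + 1)"
            unfolding x_def p[symmetric] by simp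
        qed
      qed
      then have "dist (f (of_real r * z)) w \<le> 1 / real (k + 1) + 1 / real (k + 1)"
        using dr dist_triangle[of "f (of_real r * z)" w "f (of_real (of_rat q0) * z)"] by linarith
      then show "dist (f (of_real r * z)) w \<le> 2 / real (k + 1)" by simp
      have "\<bar>cmod (f (of_real r * z)) - cmod (f (of_real (of_rat q0) * z))\<bar> \<le> 1 / real (k + 1)"
        using norm_triangle_ineq3[of "f (of_real r * z)" "f (of_real (of_rat q0) * z)"] dr
        by (simp add: dist_norm)
      then have "\<bar>cmod (f (of_real r * z)) - 1\<bar> \<le> 1 / real (k + 1) + 1 / real (k + 1)"
        using N[rule_format, of q0 q0] q by linarith
      then show "\<bar>cmod (f (of_real r * z)) - 1\<bar> \<le> 2 / real (k + 1)" by simp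
    qed simp
  qed
  have small: "\<exists>k::nat. 2 / real (k + 1) < e" if e: "e > 0" for e :: real
  proof -
    obtain k where "1 / real (Suc k) < e / 2" by (rule nat_approx_posE[OF half_gt_zero[OF e]])
    then show ?thesis by (intro exI[of _ k]) (simp add: field_simps)
  qed
  have lim: "((\<lambda>r. f (of_real r * z)) \<longlongrightarrow> w) (at_left 1)"
  proof (rule tendstoI)
    fix e :: real assume "e > 0"
    then obtain k :: nat where k: "2 / real (k + 1) < e" using small by blast
    obtain b where "b < 1" "\<And>r. b < r \<Longrightarrow> r < 1 \<Longrightarrow> dist (f (of_real r * z)) w \<le> 2 / real (k + 1)"
      using near[of k] by blast
    then show "\<forall>\<^sub>F r in at_left 1. dist (f (of_real r * z)) w < e"
      unfolding eventually_at_left_field using k by (intro exI[of _ b]) (auto intro: le_less_trans)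
  qed
  have "((\<lambda>r. cmod (f (of_real r * z))) \<longlongrightarrow> 1) (at_left 1)"
  proof (rule tendstoI)
    fix e :: real assume "e > 0"
    then obtain k :: nat where k: "2 / real (k + 1) < e" using small by blast
    obtain b where "b < 1" "\<And>r. b < r \<Longrightarrow> r < 1 \<Longrightarrow> \<bar>cmod (f (of_real r * z)) - 1\<bar> \<le> 2 / real (k + 1)"
      using near[of k] by blast
    then show "\<forall>\<^sub>F r in at_left 1. dist (cmod (f (of_real r * z))) 1 < e"
      unfolding eventually_at_left_field dist_real_def using k by (intro exI[of _ b]) (auto intro: le_less_trans)
  qed
  then have "cmod w = 1"
    using tendsto_unique[OF _ tendsto_norm[OF lim]] by (simp add: trivial_limit_at_left_real)
  then show "has_boundary_value f z"
    using lim by (auto simp: has_boundary_value_def)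
qed

lemma boundary_domain_sets:
  assumes f: "f holomorphic_on unit_disk"
  shows "{z \<in> space \<mu>. has_boundary_value f z} \<in> sets \<mu>"
proof -
  \<comment> \<open>The default 0 covers rationals outside the open unit interval, where nothing is
    known about \<open>f\<close>, so that \<open>F p\<close> is measurable for every
    \<open>p\<close>.\<close>
  define F where "F p z = (if (0::real) < of_rat p \<and> of_rat p < (1::real) then f (of_real (of_rat p) * z) else 0)"
    for p :: rat and z
  have Fm [measurable]: "F p \<in> borel_measurable \<mu>" for p
  proof (cases "(0::real) < of_rat p \<and> of_rat p < (1::real)")
    case True
    have "continuous_on unit_circle (\<lambda>z. f (of_real (of_rat p) * z))"
      by (rule continuous_on_compose2[OF holomorphic_on_imp_continuous_on[OF f]])
         (use True in \<open>auto intro!: continuous_intros simp: norm_mult\<close>)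
    then have "(\<lambda>z. f (of_real (of_rat p) * z)) \<in> borel_measurable \<mu>"
      by (rule borel_measurable_circle_continuous)
    then show ?thesis using True by (simp add: F_def[abs_def])
  next
    case False
    then have "F p = (\<lambda>z. 0)" by (auto simp: F_def)
    then show ?thesis by simp
  qed
  define P where "P N p \<longleftrightarrow> 1 - 1 / real (N + 2) < of_rat p \<and> of_rat p < (1::real)" for N :: nat and p :: rat
  have PF: "F p z = f (of_real (of_rat p) * z)" if "P N p" for N p z
  proof -
    have "0 \<le> 1 - 1 / real (N + 2)" by simp
    then have "0 < real_of_rat p" using that unfolding P_def by linarith
    then show ?thesis using that by (simp add: F_def P_def)
  qed
  have "{z \<in> space \<mu>. has_boundary_value f z} =
    {z \<in> space \<mu>. \<forall>k::nat. \<exists>N::nat. \<forall>p::rat. \<forall>q::rat. P N p \<and> P N q \<longrightarrow>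
      dist (F p z) (F q z) < 1 / real (k + 1) \<and> \<bar>cmod (F q z) - 1\<bar> < 1 / real (k + 1)}"
  proof (rule Collect_cong, rule conj_cong[OF refl])
    fix z assume "z \<in> space \<mu>"
    then have "cmod z = 1" by simp
    from has_boundary_value_iff[OF f this]
    show "has_boundary_value f z \<longleftrightarrow> (\<forall>k::nat. \<exists>N::nat. \<forall>p::rat. \<forall>q::rat. P N p \<and> P N q \<longrightarrow>
      dist (F p z) (F q z) < 1 / real (k + 1) \<and> \<bar>cmod (F q z) - 1\<bar> < 1 / real (k + 1))"
      unfolding P_def[symmetric] conj_assoc[symmetric] using PF by (simp add: P_def conj_assoc) (metis (no_types, lifting) P_def PF)
  qed
  also have "\<dots> \<in> sets \<mu>" by measurable
  finally show ?thesis .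
qed

text \<open>Total and unimodular, so that its iterates need no side condition.\<close>

definition patched_boundary_map :: "(complex \<Rightarrow> complex) \<Rightarrow> complex \<Rightarrow> complex" where
  "patched_boundary_map f z = (if has_boundary_value f z then boundary_map f z else 1)"

lemma boundary_map_tendsto:
  assumes "has_boundary_value f z"
  shows "((\<lambda>r. f (of_real r * z)) \<longlongrightarrow> boundary_map f z) (at_left 1)" "cmod (boundary_map f z) = 1"
proof -
  obtain w where w: "cmod w = 1" "((\<lambda>r. f (of_real r * z)) \<longlongrightarrow> w) (at_left 1)"
    using assms by (auto simp: has_boundary_value_def)
  have "boundary_map f z = w"
    unfolding boundary_map_def by (rule tendsto_Lim[OF _ w(2)]) (simp add: trivial_limit_at_left_real)
  then show "((\<lambda>r. f (of_real r * z)) \<longlongrightarrow> boundary_map f z) (at_left 1)" "cmod (boundary_map f z) = 1"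
    using w by auto
qed

text \<open>A pointwise limit along a fixed sequence of radii; replacing the functions by 1 off the
  domain makes them converge at every point of the circle.\<close>

lemma patched_boundary_map_measurable:
  assumes f: "f holomorphic_on unit_disk"
  shows "patched_boundary_map f \<in> borel_measurable \<mu>"
proof -
  let ?D = "{z \<in> space \<mu>. has_boundary_value f z}"
  note [measurable] = boundary_domain_sets[OF f]
  define g where "g n z = (if z \<in> ?D then f (of_real (1 - 1 / real (n + 2)) * z) else 1)" for n :: nat and z
  have "g n \<in> borel_measurable \<mu>" for n
  proof -
    have "continuous_on unit_circle (\<lambda>z. f (of_real (1 - 1 / real (n + 2)) * z))"
      by (rule continuous_on_compose2[OF holomorphic_on_imp_continuous_on[OF f]])
         (auto intro!: continuous_intros simp: norm_mult simp del: of_real_diff)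
    then have m: "(\<lambda>z. f (of_real (1 - 1 / real (n + 2)) * z)) \<in> borel_measurable \<mu>"
      by (rule borel_measurable_circle_continuous)
    show ?thesis unfolding g_def
      by (intro measurable_If_set m sets.Int boundary_domain_sets[OF f] sets.top) simp
  qed
  then show ?thesis
  proof (rule borel_measurable_LIMSEQ_metric)
    fix z assume z: "z \<in> space \<mu>"
    show "(\<lambda>n. g n z) \<longlonglongrightarrow> patched_boundary_map f z"
    proof (cases "has_boundary_value f z")
      case True
      then show ?thesis
        using filterlim_compose[OF boundary_map_tendsto(1)[OF True] at_left_one_seq] z
        by (simp add: g_def patched_boundary_map_def)
    qed (simp add: g_def patched_boundary_map_def)
  qed
qed

text \<open>The exclusion of rotations becomes \<open>cmod (deriv f 0) < 1\<close> through the
  equality case of the Schwarz lemma.\<close>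

lemma inner_function_centred_inner:
  assumes inner: "inner_function f" and centred: "f 0 = 0"
    and not_rotation: "\<not> (\<exists>c. cmod c = 1 \<and> (\<forall>z \<in> unit_disk. f z = c * z))"
  shows "centred_inner f (patched_boundary_map f)"
proof
  show holo: "f holomorphic_on ball 0 1" using inner by (simp add: inner_function_def)
  show maps: "cmod (f x) < 1" if "cmod x < 1" for x
    using inner that by (auto simp: inner_function_def image_subset_iff)
  show "f 0 = 0" by (rule centred)
  show "cmod (deriv f 0) < 1"
  proof (rule ccontr)
    assume "\<not> ?thesis"
    then have "cmod (deriv f 0) = 1" using Schwarz_Lemma(2)[OF holo centred maps, of 0] by simp
    then obtain \<alpha> where "\<forall>z. cmod z < 1 \<longrightarrow> f z = \<alpha> * z" "cmod \<alpha> = 1"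
      using Schwarz_Lemma(3)[OF holo centred maps, of 0] by auto
    then show False using not_rotation by auto
  qed
  show "patched_boundary_map f \<in> borel_measurable \<mu>"
    by (rule patched_boundary_map_measurable[OF holo])
  show "cmod (patched_boundary_map f z) = 1" if "cmod z = 1" for z
    using boundary_map_tendsto(2) by (simp add: patched_boundary_map_def)
  have "AE z in \<mu>. has_boundary_value f z" using inner by (simp add: inner_function_def)
  then show "AE z in \<mu>. ((\<lambda>r. f (of_real r * z)) \<longlongrightarrow> patched_boundary_map f z) (at_left 1)"
    by eventually_elim (use boundary_map_tendsto(1) in \<open>simp add: patched_boundary_map_def\<close>)
qed

text \<open>The two maps agree wherever a boundary value exists. The disjunction serves the domain
  condition for either map: as the orbits coincide up to step \<open>k\<close>, each alternative at
  \<open>k\<close> gives the other.\<close>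

lemma funpow_patched_boundary_map:
  assumes "\<forall>k<n. has_boundary_value f ((boundary_map f ^^ k) z) \<or> has_boundary_value f ((patched_boundary_map f ^^ k) z)"
  shows "(patched_boundary_map f ^^ n) z = (boundary_map f ^^ n) z"
  using assms
proof (induction n)
  case (Suc n)
  then have "(patched_boundary_map f ^^ n) z = (boundary_map f ^^ n) z" by simp
  moreover have "has_boundary_value f ((boundary_map f ^^ n) z)"
    using Suc.prems calculation by (metis lessI)
  ultimately show ?case by (simp add: patched_boundary_map_def[of f "(boundary_map f ^^ n) z"])
qed simp

lemma funpow_domain_iff:
  "(\<forall>k<n. has_boundary_value f ((boundary_map f ^^ k) z)) \<longleftrightarrow>
   (\<forall>k<n. has_boundary_value f ((patched_boundary_map f ^^ k) z))"
proof (induction n)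
  case (Suc n)
  have "(patched_boundary_map f ^^ n) z = (boundary_map f ^^ n) z"
    if "\<forall>k<n. has_boundary_value f ((boundary_map f ^^ k) z)"
    using that by (intro funpow_patched_boundary_map) auto
  then show ?case using Suc by (auto simp: less_Suc_eq)
qed simp

section \<open>Returns of the original boundary map and the dichotomy\<close>

context centred_inner
begin

lemma hit_iff_arc_ball:
  assumes "cmod z = 1"
  shows "(T ^^ n) z \<in> arc_ball z (r n) \<longleftrightarrow> hit r n z"
proof -
  have "(T ^^ n) z / z = return 0 n z"
  proof -
    have "z \<noteq> 0" using assms by auto
    then show ?thesis using circle_cnj(2)[OF assms] by (simp add: return_def divide_eq_eq mult.assoc)
  qed
  then show ?thesis
    using funpow_unit[OF assms, of n]
    by (simp add: arc_ball_def arc_dist_def hit_def divide_less_eq mult_ac)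
qed

end

text \<open>Rotations are excluded because the dichotomy fails for them: under
  \<open>f z = c * z\<close> all points return at the same times, and under the identity they return
  at every time even if the radii are summable. Measurability is part of the claim since
  \<open>emeasure\<close> is 0 by convention off the measurable sets; the shifted series starts the
  sum at \<open>n = 1\<close>.\<close>

theorem theorem6:
  fixes f :: "complex \<Rightarrow> complex" and r :: "nat \<Rightarrow> real"
  assumes one_comp: "one_component f"
    and centred: "f 0 = 0"
    and not_rotation: "\<not> (\<exists>c. cmod c = 1 \<and> (\<forall>z \<in> unit_disk. f z = c * z))"
    and r_pos: "\<And>n. n \<ge> 1 \<Longrightarrow> r n > 0"
  shows "recurrence_set f r \<in> sets circle_measure \<and>
         emeasure circle_measure (recurrence_set f r) =
           (if summable (\<lambda>n. r (Suc n)) then 0 else 1)"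
proof -
  have inner: "inner_function f" using one_comp by (simp add: one_component_def)
  define T where "T = patched_boundary_map f"
  interpret centred_inner f T
    unfolding T_def by (rule inner_function_centred_inner[OF inner centred not_rotation])
  have D: "{z \<in> space \<mu>. has_boundary_value f z} \<in> sets \<mu>"
    by (rule boundary_domain_sets[OF holo])
  define P where "P n z \<longleftrightarrow> (\<forall>k<n. has_boundary_value f ((T ^^ k) z)) \<and> hit r n z" for n z
  have P_iff: "(\<forall>k<n. has_boundary_value f ((boundary_map f ^^ k) z)) \<and> (boundary_map f ^^ n) z \<in> arc_ball z (r n)
      \<longleftrightarrow> P n z" if z: "cmod z = 1" for n z
    using funpow_domain_iff[of n f z] funpow_patched_boundary_map[of n f z] hit_iff_arc_ball[OF z, of n r]
    by (auto simp: P_def T_def)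
  have rec_eq: "recurrence_set f r = {z \<in> space \<mu>. infinite {n. n \<ge> 1 \<and> P n z}}"
    unfolding recurrence_set_def using P_iff by auto
  have Dk: "{z \<in> space \<mu>. has_boundary_value f ((T ^^ k) z)} \<in> sets \<mu>" for k
  proof -
    have "{z \<in> space \<mu>. has_boundary_value f ((T ^^ k) z)}
        = (T ^^ k) -` {z \<in> space \<mu>. has_boundary_value f z} \<inter> space \<mu>"
      using funpow_unit by auto
    then show ?thesis using measurable_sets[OF funpow_distr(1) D] by simp
  qed
  have Pm: "{z \<in> space \<mu>. P n z} \<in> sets \<mu>" for n
    unfolding P_def
    by (intro sets.sets_Collect_conj hit_sets sets.sets_Collect_countable_All sets.sets_Collect_imp
        sets.sets_Collect_const Dk)
  have meas: "recurrence_set f r \<in> sets \<mu>"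
    unfolding rec_eq infinite_nat_iff_unbounded_le mem_Collect_eq
    by (intro sets.sets_Collect_countable_All sets.sets_Collect_countable_Ex sets.sets_Collect_conj
        sets.sets_Collect_const Pm)
  \<comment> \<open>The domain has full measure and \<open>T ^^ k\<close> preserves arc length, so
    almost every orbit stays in the domain at all times and the domain conditions disappear.\<close>
  have "AE z in \<mu>. has_boundary_value f ((T ^^ k) z)" for k
  proof -
    have "AE z in distr \<mu> \<mu> (T ^^ k). has_boundary_value f z"
      unfolding funpow_distr(2) using inner by (simp add: inner_function_def)
    then show ?thesis by (rule AE_distrD[OF funpow_distr(1)])
  qed
  then have "AE z in \<mu>. \<forall>k. has_boundary_value f ((T ^^ k) z)"
    by (simp add: AE_all_countable)
  then have rec_AE: "AE z in \<mu>. z \<in> recurrence_set f r \<longleftrightarrow> infinite {n. n \<ge> 1 \<and> hit r n z}"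
    using AE_space by eventually_elim (auto simp: rec_eq P_def)
  have "emeasure \<mu> (recurrence_set f r) = (if summable (\<lambda>n. r (Suc n)) then 0 else 1)"
  proof (cases "summable (\<lambda>n. r (Suc n))")
    case True
    have fin: "AE z in \<mu>. finite {n. n \<ge> 1 \<and> hit r n z}"
      by (rule finitely_many_hits) (use r_pos True in auto)
    have "AE z in \<mu>. z \<notin> recurrence_set f r"
      using rec_AE fin by eventually_elim auto
    then have "emeasure \<mu> (recurrence_set f r) = 0"
      using meas by (simp add: AE_iff_null_sets[symmetric] AE_iff_measurable[OF meas] null_sets_def emeasure_eq_0_AE)
    then show ?thesis using True by simp
  next
    case False
    have inf: "AE z in \<mu>. infinite {n. n \<ge> 1 \<and> hit r n z}"
      by (rule infinitely_many_hits) (use r_pos False in auto)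
    have "AE z in \<mu>. z \<in> recurrence_set f r"
      using rec_AE inf by eventually_elim auto
    then have "emeasure \<mu> (recurrence_set f r) = 1"
      by (rule circle.emeasure_eq_1_AE[OF meas])
    then show ?thesis using False by simp
  qed
  with meas show ?thesis by simp
qed

end
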